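(* For all $2<p\le6$ there holds $$\overline{S}_{3,p}=S_{3,p}=\frac{p}{2^{\frac2p}}\bigg[\frac{4\pi\,\Gamma^2\big(\frac{p}{p-2}\big)}{(p-2)\,\Gamma\big(\frac{2p}{p-2}\big)}\bigg]^{\frac{p-2}{p}}.$$
   Context: $S_{3,p}$ denotes the best (largest) constant in the inequality $\int_{\mathbb{R}^3}|\nabla u|^2dx\ge S_{3,p}\big(\int_{\mathbb{R}^3}|x|^{\frac{p-6}{2}}|u|^pdx\big)^{2/p}$ for all real-valued $u\in C_c^\infty(\mathbb{R}^3)$. $\overline{S}_{3,p}$ denotes the best (largest) constant in the inequality $$\int_{\mathbb{H}^3}|\nabla_{\mathbb{H}^3}v|^2dV\ge\int_{\mathbb{H}^3}v^2dV+\overline{S}_{3,p}\Big(\int_{\mathbb{H}^3}(\sinh\rho)^{\frac{p-6}{2}}|v|^pdV\Big)^{2/p},\qquad v\in C_c^\infty(\mathbb{H}^3),$$ where $\mathbb{H}^3$ is the $3$-dimensional hyperbolic space (curvature $-1$) with Riemannian gradient $\nabla_{\mathbb{H}^3}$ and volume element $dV$, and $\rho$ is the hyperbolic distance to a fixed point. Equivalently (half-space model, $\mathbb{R}^3_+=\{x_3>0\}$, $e_3=(0,0,1)$), $\overline{S}_{3,p}$ is the best constant in $$\int_{\mathbb{R}^3_+}|\nabla u|^2dx\ge\frac14\int_{\mathbb{R}^3_+}\frac{u^2}{x_3^2}dx+\overline{S}_{3,p}\bigg(\int_{\mathbb{R}^3_+}\Big(\frac{|x-e_3|\,|x+e_3|}{2}\Big)^{\frac{p-6}{2}}|u|^pdx\bigg)^{2/p},\qquad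 u\in C_c^\infty(\mathbb{R}^3_+).$$ $\Gamma$ is the Gamma function. *)

theory Defs
  imports "HOL-Analysis.Analysis"
begin

section \<open>Test functions\<close>

primrec continuously_differentiable :: "nat \<Rightarrow> ('a::real_normed_vector \<Rightarrow> 'b::real_normed_vector) \<Rightarrow> bool"
  where
  "continuously_differentiable 0 f \<longleftrightarrow> continuous_on UNIV f"
| "continuously_differentiable (Suc k) f \<longleftrightarrow>
     (\<forall>x. f differentiable (at x)) \<and>
     (\<forall>w. continuously_differentiable k (\<lambda>x. frechet_derivative f (at x) w))"

definition smooth :: "('a::real_normed_vector \<Rightarrow> 'b::real_normed_vector) \<Rightarrow> bool"
  where "smooth f \<longleftrightarrow> (\<forall>k. continuously_differentiable k f)"

text \<open>The space of compactly supported smooth functions on an open set \<open>U\<close>; its elements are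
  identified with their extensions by zero to the whole space.\<close>

definition test_functions :: "'a::real_normed_vector set \<Rightarrow> ('a \<Rightarrow> real) set"
  where "test_functions U =
    {u. smooth u \<and> compact (closure {x. u x \<noteq> 0}) \<and> closure {x. u x \<noteq> 0} \<subseteq> U}"

definition grad :: "(real^3 \<Rightarrow> real) \<Rightarrow> real^3 \<Rightarrow> real^3"
  where "grad u x = (\<chi> i. frechet_derivative u (at x) (axis i 1))"

lemma grad_inner:
  assumes "u differentiable (at x)"
  shows "grad u x \<bullet> w = frechet_derivative u (at x) w"
proof -
  have lin: "linear (frechet_derivative u (at x))"
    using assms by (rule linear_frechet_derivative)
  have "frechet_derivative u (at x) w = frechet_derivative u (at x) (\<Sum>i\<in>UNIV. w $ i *\<^sub>R axis i 1)"
    using basis_expansion[of w] by (simp add: scalar_mult_eq_scaleR)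
  also have "\<dots> = (\<Sum>i\<in>UNIV. w $ i * frechet_derivative u (at x) (axis i 1))"
    using lin by (simp add: linear_sum linear_scale)
  finally show ?thesis
    by (simp add: grad_def inner_vec_def mult.commute)
qed

section \<open>Hyperbolic space (upper half-space model, curvature -1)\<close>

definition H3 :: "(real^3) set"
  where "H3 = {x. 0 < x $ 3}"

definition hyp_metric :: "real^3 \<Rightarrow> real^3 \<Rightarrow> real^3 \<Rightarrow> real"
  where "hyp_metric x a b = (a \<bullet> b) / (x $ 3)\<^sup>2"

definition hyp_grad :: "(real^3 \<Rightarrow> real) \<Rightarrow> real^3 \<Rightarrow> real^3"
  where "hyp_grad v x = (x $ 3)\<^sup>2 *\<^sub>R grad v x"

lemma hyp_metric_hyp_grad:
  assumes "x \<in> H3" and "v differentiable (at x)"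
  shows "hyp_metric x (hyp_grad v x) w = frechet_derivative v (at x) w"
  using assms by (simp add: hyp_metric_def hyp_grad_def H3_def grad_inner)

text \<open>The density is the square root of the determinant of the metric, \<open>x\<^sub>3 powi (-3)\<close>.\<close>

definition hyp_volume :: "(real^3) measure"
  where "hyp_volume = density lborel (\<lambda>x. ennreal (indicator H3 x / (x $ 3) ^ 3))"

definition hyp_dist :: "real^3 \<Rightarrow> real^3 \<Rightarrow> real"
  where "hyp_dist x y = arcosh (1 + (dist x y)\<^sup>2 / (2 * x $ 3 * y $ 3))"

lemma sinh_hyp_dist_e3:
  assumes "x \<in> H3"
  shows "sinh (hyp_dist (axis 3 1) x) = norm (x - axis 3 1) * norm (x + axis 3 1) / (2 * x $ 3)"
proof -
  define A where "A = (dist (axis 3 1) x)\<^sup>2 / (2 * x $ 3)"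
  have x3: "0 < x $ 3" using assms by (simp add: H3_def)
  then have A0: "0 \<le> A" by (simp add: A_def)
  have e: "(dist (axis 3 1) x)\<^sup>2 = (norm (x - axis 3 1))\<^sup>2"
    by (simp add: dist_norm norm_minus_commute)
  have "(norm (x + axis 3 1))\<^sup>2 = (norm (x - axis 3 1))\<^sup>2 + 4 * x $ 3"
    by (simp add: power2_norm_eq_inner inner_add inner_diff inner_axis inner_axis' algebra_simps)
  then have A2: "A + 2 = (norm (x + axis 3 1))\<^sup>2 / (2 * x $ 3)"
    using x3 by (simp add: A_def e field_simps)
  have "hyp_dist (axis 3 1) x = arcosh (1 + A)"
    by (simp add: hyp_dist_def A_def)
  then have "sinh (hyp_dist (axis 3 1) x) = sqrt ((1 + A)\<^sup>2 - 1)"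
    using A0 by (simp add: sinh_arcosh_real)
  also have "(1 + A)\<^sup>2 - 1 = A * (A + 2)"
    by (simp add: power2_eq_square algebra_simps)
  also have "\<dots> = (norm (x - axis 3 1) * norm (x + axis 3 1) / (2 * x $ 3))\<^sup>2"
    unfolding A2 unfolding A_def e by (simp add: power2_eq_square)
  finally show ?thesis
    using x3 by (simp add: real_sqrt_abs)
qed

section \<open>The best constants\<close>

definition euclidean_inequality :: "real \<Rightarrow> real \<Rightarrow> bool"
  where "euclidean_inequality p C \<longleftrightarrow>
    (\<forall>u \<in> test_functions (UNIV :: (real^3) set).
       (LINT x|lborel. (norm (grad u x))\<^sup>2)
       \<ge> C * (LINT x|lborel. norm x powr ((p - 6) / 2) * \<bar>u x\<bar> powr p) powr (2 / p))"

definition hyperbolic_inequality :: "real^3 \<Rightarrow> real \<Rightarrow> real \<Rightarrow> bool"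
  where "hyperbolic_inequality b p C \<longleftrightarrow>
    (\<forall>v \<in> test_functions H3.
       (LINT x|hyp_volume. hyp_metric x (hyp_grad v x) (hyp_grad v x))
       \<ge> (LINT x|hyp_volume. (v x)\<^sup>2)
          + C * (LINT x|hyp_volume. sinh (hyp_dist b x) powr ((p - 6) / 2) * \<bar>v x\<bar> powr p) powr (2 / p))"

definition S3 :: "real \<Rightarrow> real"
  where "S3 p = (GREATEST C. euclidean_inequality p C)"

text \<open>The parameter \<open>b\<close> is the fixed point from which the hyperbolic distance is measured.\<close>

definition S3_bar :: "real^3 \<Rightarrow> real \<Rightarrow> real"
  where "S3_bar b p = (GREATEST C. hyperbolic_inequality b p C)"

end

theory Submission
  imports Defs "HOL-Complex_Analysis.Great_Picard"
begin

text \<open>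
  The hyperbolic inequality with the sharp constant is reduced to radially decreasing functions.
  Instead of the Dirichlet energy one works with the integral of \<open>(sup v - v)\<^sup>2\<close>, the supremum being
  taken over the hyperbolic ball of radius \<open>\<eta>\<close> around each point: divided by \<open>\<eta>\<^sup>2\<close>, its limit superior as \<open>\<eta> \<rightarrow> 0\<close>
  is at most the Dirichlet energy, it does not increase under polarisation in hyperbolic reflections, and it needs no
  derivative. Among functions with a common modulus of continuity, Arzela-Ascoli gives a maximiser
  of a strictly radially decreasing linear functional; polarisation would increase the functional unless the
  maximiser were radially decreasing. The weight decreases with the distance since \<open>p \<le> 6\<close>.

  For a radial function \<open>f\<close> put \<open>w = f sinh r / sqrt r\<close>. Up to a total derivative,
  \<open>f'\<^sup>2 sinh\<^sup>2 r - f\<^sup>2 sinh\<^sup>2 r\<close> is \<open>r w'\<^sup>2 + w\<^sup>2 / (4 r)\<close>, and completing the square as in Bogomolny's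
  argument, upwards and downwards from the maximum of \<open>w\<close>, gives Bliss' inequality with its sharp constant.

  Conversely, test functions concentrated at the base point turn any hyperbolic inequality into
  the Euclidean one with the same constant, and truncations of the Euclidean extremals
  \<open>(1 + |x| powr ((p - 2) / 2)) powr (- 2 / (p - 2))\<close> show that no larger Euclidean constant is possible.
\<close>

section \<open>Inversions in spheres\<close>

text \<open>Why the two constants agree: with \<open>f = w * sqrt r / sinh r\<close> the hyperbolic
  radial energy minus the L2 term equals, up to a total derivative, the energy of the radial
  Euclidean function \<open>w / sqrt r\<close>. In dimension 3 the spectral gap term is exactly what
  the curvature produces, so the only trace of curvature is in the weighted term, where
  \<open>sinh r \<ge> r\<close> enters with a negative power and can only help. In the variable
  \<open>ln r\<close> what remains is the autonomous problem for \<open>w'^2 + w^2 / 4\<close>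
  against \<open>w^p\<close>. Once the maximum \<open>M\<close> of \<open>w\<close> is prescribed,
  each side of the maximum contributes \<open>M^2 * bliss_gap p\<close>, and minimising over
  \<open>M\<close> yields the sharp constant.

  The energy built from suprema is used asymmetrically. For radially decreasing functions its lower
  bound is exact at every fixed \<open>\<eta>\<close>, without an error term, so it applies to a
  rearranged function known only through compactness. The limit
  \<open>\<eta> \<rightarrow> 0\<close> is taken for the given test function alone, which is
  smooth.\<close>

definition inversion :: "real^3 \<Rightarrow> real \<Rightarrow> real^3 \<Rightarrow> real^3"
  where "inversion c k x = c + (k / (norm (x - c))\<^sup>2) *\<^sub>R (x - c)"

lemma inversion_minus_centre: "inversion c k x - c = (k / (norm (x - c))\<^sup>2) *\<^sub>R (x - c)"
  by (simp add: inversion_def)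

lemma inversion_neq_centre: "k > 0 \<Longrightarrow> x \<noteq> c \<Longrightarrow> inversion c k x \<noteq> c"
  by (simp add: inversion_def)

lemma inversion_inversion [simp]:
  assumes "k > 0" "x \<noteq> c"
  shows "inversion c k (inversion c k x) = x"
proof -
  define n where "n = norm (x - c)"
  have n: "n > 0" using assms by (simp add: n_def)
  have "norm (inversion c k x - c) = k / n"
    unfolding inversion_minus_centre using n assms
    by (simp add: n_def[symmetric] power2_eq_square)
  then have "inversion c k (inversion c k x) = c + (k / (k / n)\<^sup>2) *\<^sub>R ((k / n\<^sup>2) *\<^sub>R (x - c))"
    by (subst inversion_def) (simp add: inversion_minus_centre n_def)
  also have "(k / (k / n)\<^sup>2) *\<^sub>R ((k / n\<^sup>2) *\<^sub>R (x - c)) = x - c"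
    using n assms by (simp add: power2_eq_square)
  finally show ?thesis by simp
qed

lemma inversion_has_derivative:
  assumes "x \<noteq> c"
  shows "(inversion c k has_derivative
    (\<lambda>h. (k / (norm (x - c))\<^sup>2) *\<^sub>R h - (2 * k / (norm (x - c))^4 * ((x - c) \<bullet> h)) *\<^sub>R (x - c))) (at x)"
proof -
  have nz: "(x - c) \<bullet> (x - c) \<noteq> 0" using assms by simp
  have eq: "inversion c k = (\<lambda>x. c + (k / ((x - c) \<bullet> (x - c))) *\<^sub>R (x - c))"
    by (rule ext) (simp add: inversion_def power2_norm_eq_inner)
  have n4: "norm (x - c) ^ 4 = ((x - c) \<bullet> (x - c)) * ((x - c) \<bullet> (x - c))"
  proof -
    have "norm (x - c) ^ 4 = (norm (x - c))\<^sup>2 * (norm (x - c))\<^sup>2" by (simp add: power4_eq_xxxx power2_eq_square)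
    then show ?thesis by (simp only: power2_norm_eq_inner)
  qed
  show ?thesis
    unfolding eq n4 power2_norm_eq_inner
    by (rule derivative_eq_intros refl nz | simp)+
       (use nz in \<open>simp add: fun_eq_iff algebra_simps inner_commute\<close>)
qed

text \<open>The map multiplies by \<open>a\<close> on the plane orthogonal to \<open>y\<close> and
  by \<open>a - b * (norm y)^2\<close> along \<open>y\<close>.\<close>

lemma det_id_minus_rank_one:
  fixes y :: "real^3"
  shows "det (matrix (\<lambda>h. a *\<^sub>R h - (b * (y \<bullet> h)) *\<^sub>R y)) = a^3 - a\<^sup>2 * b * (norm y)\<^sup>2"
  unfolding det_3 matrix_def power2_norm_eq_inner
  by (simp add: inner_vec_def sum_3 axis_def power2_eq_square power3_eq_cube algebra_simps)

lemma inversion_measurable [measurable]: "inversion c k \<in> borel_measurable borel"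
  unfolding inversion_def by measurable

lemma inversion_image:
  assumes "k > 0"
  shows "inversion c k ` (- {c}) = - {c}"
proof (intro equalityI subsetI)
  fix x assume "x \<in> - {c}"
  then have "x = inversion c k (inversion c k x)" "inversion c k x \<in> - {c}"
    using assms by (auto simp: inversion_neq_centre)
  then show "x \<in> inversion c k ` (- {c})" by blast
qed (use assms in \<open>auto simp: inversion_neq_centre\<close>)

text \<open>The derivative of an inversion is \<open>k / (norm (x - c))^2\<close> times a Euclidean
  reflection, hence the density. Equality with Lebesgue measure is checked on boxes. The centre,
  which is mapped to itself because \<open>k / 0 = 0\<close>, is removed as a null set.\<close>

lemma inversion_lborel:
  fixes c :: "real^3"
  assumes k: "k > 0"
  shows "distr (density lborel (\<lambda>x. ennreal ((k / (norm (x - c))\<^sup>2)^3))) borel (inversion c k) = lborel"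
    (is "distr ?D borel ?g = lborel")
proof (rule lborel_eqI[symmetric])
  fix l u :: "real^3"
  assume lu: "\<And>b. b \<in> Basis \<Longrightarrow> l \<bullet> b \<le> u \<bullet> b"
  let ?J = "\<lambda>x. (k / (norm (x - c))\<^sup>2)^3"
  let ?g' = "\<lambda>x h. (k / (norm (x - c))\<^sup>2) *\<^sub>R h - (2 * k / (norm (x - c))^4 * ((x - c) \<bullet> h)) *\<^sub>R (x - c)"
  \<comment> \<open>The change of variables theorem speaks of vector-valued functions, so the
    indicator takes its values in \<open>real^1\<close>.\<close>
  let ?f = "\<lambda>x. vec (indicator (box l u) x) :: real^1"
  have det: "\<bar>det (matrix (?g' x))\<bar> = ?J x" if "x \<in> - {c}" for x
  proof -
    define n where "n = norm (x - c)"
    have n: "n > 0" using that by (simp add: n_def)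
    have "det (matrix (?g' x)) = (k / n\<^sup>2) ^ 3 - (k / n\<^sup>2)\<^sup>2 * (2 * k / n ^ 4) * n\<^sup>2"
      unfolding n_def by (rule det_id_minus_rank_one)
    also have "\<dots> = - ((k / n\<^sup>2) ^ 3)"
      using n by (simp add: field_simps power2_eq_square power3_eq_cube power4_eq_xxxx)
    finally show ?thesis using k by (simp add: n_def)
  qed
  have inj: "inj_on ?g (- {c})"
    by (rule inj_on_inverseI[where g = ?g]) (use k in auto)
  have int_box: "(indicator (box l u) :: real^3 \<Rightarrow> real) absolutely_integrable_on - {c}"
    "integral (- {c}) (indicator (box l u) :: real^3 \<Rightarrow> real) = measure lborel (box l u)"
  proof -
    have "((indicator (box l u) :: real^3 \<Rightarrow> real) has_integral measure lborel (box l u)) UNIV"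
    proof -
      have "((\<lambda>x. 1) has_integral measure lborel (box l u)) (box l u)"
        by (rule has_integral_measure_lborel) (use emeasure_lborel_box_finite[of l u] in \<open>auto simp: less_top\<close>)
      then have "((\<lambda>x. if x \<in> box l u then 1 else 0) has_integral measure lborel (box l u)) UNIV"
        by (simp only: has_integral_restrict_UNIV)
      moreover have "(indicator (box l u) :: real^3 \<Rightarrow> real) = (\<lambda>x. if x \<in> box l u then 1 else 0)"
        by (auto simp: indicator_def fun_eq_iff)
      ultimately show ?thesis by simp
    qed
    then have h: "((indicator (box l u) :: real^3 \<Rightarrow> real) has_integral measure lborel (box l u)) (- {c})"
      by (subst has_integral_spike_set_eq[of _ UNIV]) (auto intro: negligible_subset[of "{c}"])
    then show "integral (- {c}) (indicator (box l u) :: real^3 \<Rightarrow> real) = measure lborel (box l u)"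
      by (rule integral_unique)
    show "(indicator (box l u) :: real^3 \<Rightarrow> real) absolutely_integrable_on - {c}"
      by (rule nonnegative_absolutely_integrable_1) (use h in auto)
  qed
  have "(\<lambda>x. \<bar>det (matrix (?g' x))\<bar> *\<^sub>R ?f (?g x)) absolutely_integrable_on (- {c}) \<and>
        integral (- {c}) (\<lambda>x. \<bar>det (matrix (?g' x))\<bar> *\<^sub>R ?f (?g x)) = vec (measure lborel (box l u)) \<longleftrightarrow>
        ?f absolutely_integrable_on (?g ` (- {c})) \<and> integral (?g ` (- {c})) ?f = vec (measure lborel (box l u))"
    by (rule has_absolute_integral_change_of_variables)
       (use inversion_has_derivative[THEN has_derivative_at_withinI] inj in auto)
  moreover have "?f absolutely_integrable_on (?g ` (- {c})) \<and> integral (?g ` (- {c})) ?f = vec (measure lborel (box l u))"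
    unfolding inversion_image[OF k]
    using int_box by (simp add: absolutely_integrable_on_1_iff integral_on_1_eq)
  ultimately have A: "(\<lambda>x. (\<bar>det (matrix (?g' x))\<bar> *\<^sub>R ?f (?g x)) $ 1) absolutely_integrable_on (- {c})"
    and B: "integral (- {c}) (\<lambda>x. (\<bar>det (matrix (?g' x))\<bar> *\<^sub>R ?f (?g x)) $ 1) = measure lborel (box l u)"
    by (auto simp: absolutely_integrable_on_1_iff integral_on_1_eq vec_eq_iff)
  let ?h = "\<lambda>x. ?J x * indicator (box l u) (?g x)"
  have "((\<lambda>x. (\<bar>det (matrix (?g' x))\<bar> *\<^sub>R ?f (?g x)) $ 1) has_integral measure lborel (box l u)) (- {c})"
    using A B by (simp add: has_integral_iff absolutely_integrable_on_def)
  then have "(?h has_integral measure lborel (box l u)) (- {c})"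
    by (rule has_integral_eq[rotated]) (use det in auto)
  then have "(?h has_integral measure lborel (box l u)) UNIV"
    by (subst has_integral_spike_set_eq[of _ "- {c}"]) (auto intro: negligible_subset[of "{c}"])
  then have I: "(\<integral>\<^sup>+x. ennreal (?h x) \<partial>lborel) = ennreal (measure lborel (box l u))"
    using k by (intro nn_integral_has_integral_lborel) auto
  have "emeasure (distr ?D borel ?g) (box l u) = (\<integral>\<^sup>+x. ennreal (?J x) * indicator (?g -` box l u) x \<partial>lborel)"
  proof (subst emeasure_distr)
    have "?g -` box l u \<in> sets borel"
      using measurable_sets_borel[OF inversion_measurable[of c k], of "box l u"] by simp
    then show "emeasure ?D (?g -` box l u \<inter> space ?D) = (\<integral>\<^sup>+x. ennreal (?J x) * indicator (?g -` box l u) x \<partial>lborel)"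
      by (subst emeasure_density) auto
  qed auto
  also have "\<dots> = (\<integral>\<^sup>+x. ennreal (?h x) \<partial>lborel)"
    by (intro nn_integral_cong) (auto simp: indicator_def)
  also have "\<dots> = ennreal (\<Prod>b\<in>Basis. (u - l) \<bullet> b)"
    using lu by (simp add: I measure_lborel_box_eq)
  finally show "emeasure (distr ?D borel ?g) (box l u) = ennreal (\<Prod>b\<in>Basis. (u - l) \<bullet> b)" .
qed simp

section \<open>The one-dimensional Bliss inequality\<close>

lemma sinh_ge_self: "0 \<le> x \<Longrightarrow> x \<le> sinh (x::real)"
proof -
  assume x: "0 \<le> x"
  have "(\<lambda>x. sinh x - x) 0 \<le> (\<lambda>x. sinh x - x) x"
  proof (rule DERIV_nonneg_imp_nondecreasing[OF x])
    fix t :: real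
    show "\<exists>y. ((\<lambda>x. sinh x - x) has_real_derivative y) (at t) \<and> 0 \<le> y"
      by (intro exI[of _ "cosh t - 1"] conjI) (auto intro!: derivative_eq_intros cosh_real_ge_1)
  qed
  then show ?thesis by simp
qed

text \<open>All variables are numbers at one radius \<open>r\<close>: \<open>s\<close> and
  \<open>c\<close> are \<open>sinh r\<close> and \<open>cosh r\<close>, and \<open>w'\<close> is the
  derivative of \<open>w\<close>. The right-hand side is the derivative of
  \<open>- f^2 * sinh r * cosh r + w^2 / 2 + \<sigma> * G w\<close>, where \<open>G\<close> is the
  primitive of \<open>y * sqrt (1 - (y / M) powr (p - 2))\<close>. The number \<open>g\<close> is
  chosen so that \<open>w^2 / (4 * r)\<close> splits into \<open>g^2 / (4 * r)\<close> and an upper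
  bound of the weighted term; what is left over is the square of
  \<open>sqrt r * w' - \<sigma> * g / (2 * sqrt r)\<close>.\<close>

lemma bliss_pointwise:
  fixes r f f' p M s c w g :: real
  assumes r: "0 < r" and s: "r \<le> s" and cs: "c\<^sup>2 = s\<^sup>2 + 1" and p: "2 < p" and f: "0 \<le> f"
    and w: "w = f * s / sqrt r" and wM: "w \<le> M" and g: "g = w * sqrt (1 - (w / M) powr (p - 2))"
    and M: "0 < M" and sg: "\<sigma> = 1 \<or> \<sigma> = -1"
    and w': "w' = (f' * s + f * c) / sqrt r - f * s / (2 * r * sqrt r)"
  shows "f'\<^sup>2 * s\<^sup>2 - f\<^sup>2 * s\<^sup>2 - M powr (2 - p) / 4 * (f powr p * s powr ((p - 2) / 2))
     \<ge> - (2 * f * f' * (s * c) + f\<^sup>2 * (c\<^sup>2 + s\<^sup>2)) + w * w' + \<sigma> * (g * w')"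
proof -
  define q where "q = sqrt r"
  have q: "q > 0" "q\<^sup>2 = r" using r by (auto simp: q_def)
  have s0: "s > 0" using r s by simp
  have w0: "w \<ge> 0" using f s0 r by (simp add: w)
  have fs: "f * s = w * q" using q(1) by (simp add: w q_def[symmetric])
  \<comment> \<open>The left-hand side is the derivative of
    \<open>f * sinh r = w * sqrt r\<close>.\<close>
  have w1: "f' * s + f * c = q * w' + w / (2 * q)"
  proof -
    have "w' = (f' * s + f * c) / q - (f * s) / (2 * q\<^sup>2 * q)" unfolding w' q_def[symmetric] q(2) ..
    also have "(f * s) / (2 * q\<^sup>2 * q) = w / (2 * q\<^sup>2)" using q(1) by (simp add: fs)
    finally have "(f' * s + f * c) / q = w' + w / (2 * q\<^sup>2)" by simp
    then have "f' * s + f * c = (w' + w / (2 * q\<^sup>2)) * q"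
      using q(1) by (metis divide_eq_eq less_irrefl)
    also have "\<dots> = q * w' + w / (2 * q)" using q(1) by (simp add: distrib_right power2_eq_square)
    finally show ?thesis .
  qed
  \<comment> \<open>The subtracted terms, together with the \<open>- f^2 * s^2\<close> of the claim,
    are the derivative of \<open>- f^2 * sinh r * cosh r\<close>. This is where the L2 term of the
    hyperbolic inequality is consumed.\<close>
  have "f'\<^sup>2 * s\<^sup>2 = (f' * s + f * c)\<^sup>2 - 2 * f * f' * (s * c) - f\<^sup>2 * c\<^sup>2"
    by (simp add: power2_eq_square algebra_simps)
  also have "(f' * s + f * c)\<^sup>2 = (q * w')\<^sup>2 + w * w' + (w / (2 * q))\<^sup>2"
    unfolding w1 using q(1) by (simp add: power2_eq_square field_simps)
  finally have E: "f'\<^sup>2 * s\<^sup>2 - f\<^sup>2 * s\<^sup>2 = - (2 * f * f' * (s * c) + f\<^sup>2 * (c\<^sup>2 + s\<^sup>2)) + w * w' + (q * w')\<^sup>2 + (w / (2 * q))\<^sup>2"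
    by (simp add: algebra_simps)
  \<comment> \<open>Substituting \<open>f = w * sqrt r / s\<close> leaves \<open>s\<close> with the
    negative exponent \<open>- (p + 2) / 2\<close>, so \<open>s \<ge> r\<close> leads to the
    Euclidean weight \<open>w powr p / r\<close>.\<close>
  have W: "f powr p * s powr ((p - 2) / 2) \<le> w powr p / r"
  proof (cases "f = 0")
    case False
    then have fp: "f > 0" using f by simp
    have "f = w * q / s" using fs s0 by (simp add: field_simps)
    then have "f powr p = w powr p * q powr p / s powr p"
      using w0 q(1) s0 by (simp add: powr_mult powr_divide)
    also have "q powr p = r powr (p / 2)"
      using r by (simp add: q_def powr_half_sqrt[symmetric] powr_powr)
    finally have "f powr p * s powr ((p - 2) / 2) = w powr p * (r powr (p / 2) * (s powr ((p - 2) / 2) / s powr p))"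
      by simp
    also have "s powr ((p - 2) / 2) / s powr p = s powr (- (p + 2) / 2)"
      by (simp add: powr_diff[symmetric] field_simps)
    also have "r powr (p / 2) * s powr (- (p + 2) / 2) \<le> r powr (p / 2) * r powr (- (p + 2) / 2)"
      using r s p by (intro mult_left_mono powr_mono2') auto
    also have "r powr (p / 2) * r powr (- (p + 2) / 2) = r powr (-1)"
      by (simp add: powr_add[symmetric] field_simps)
    also have "r powr (-1) = 1 / r" using r by (simp add: powr_minus_divide)
    finally show ?thesis using w0 by (simp add: mult_left_mono)
  qed (use w0 r in simp)
  have c1: "M powr (2 - p) / 4 * (w powr p / r) = (w / (2 * q))\<^sup>2 * (w / M) powr (p - 2)"
  proof (cases "w = 0")
    case False
    then have wp: "w > 0" using w0 by simp
    have "(w / M) powr (p - 2) = w powr p / w\<^sup>2 * M powr (2 - p)"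
      using wp M by (simp add: powr_divide powr_diff)
    then show ?thesis using wp q by (simp add: power2_eq_square field_simps)
  qed (use p in auto)
  have yle: "(w / M) powr (p - 2) \<le> 1"
    using powr_mono2[of "p - 2" "w / M" 1] p w0 wM M by simp
  have g2: "(g / (2 * q))\<^sup>2 = (w / (2 * q))\<^sup>2 * (1 - (w / M) powr (p - 2))"
    using yle by (simp add: g power_mult_distrib power_divide)
  have amgm: "(q * w')\<^sup>2 + (g / (2 * q))\<^sup>2 \<ge> \<sigma> * (g * w')"
  proof -
    have "0 \<le> (q * w' - \<sigma> * (g / (2 * q)))\<^sup>2" by simp
    also have "\<dots> = (q * w')\<^sup>2 + (\<sigma> * (g / (2 * q)))\<^sup>2 - \<sigma> * (g * w')"
      using q(1) by (simp add: power2_diff)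
    also have "(\<sigma> * (g / (2 * q)))\<^sup>2 = \<sigma>\<^sup>2 * (g / (2 * q))\<^sup>2" by (rule power_mult_distrib)
    finally show ?thesis using sg by auto
  qed
  have "M powr (2 - p) / 4 * (f powr p * s powr ((p - 2) / 2)) \<le> M powr (2 - p) / 4 * (w powr p / r)"
    using W by (intro mult_left_mono) auto
  then show ?thesis using E amgm c1 g2 by (simp add: algebra_simps)
qed

text \<open>Only the origin matters: there the quotient has the value 0 by \<open>x / 0 = 0\<close>,
  which is also its limit, since \<open>sinh h / h\<close> tends to 1 and \<open>sqrt h\<close> to
  0.\<close>

lemma continuous_on_sinh_div_sqrt: "continuous_on {0..} (\<lambda>r::real. sinh r / sqrt r)"
proof -
  have "((\<lambda>h::real. (sinh (0 + h) - sinh 0) / h) \<longlongrightarrow> cosh 0) (at 0)"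
    by (rule DERIV_D) (auto intro!: derivative_eq_intros)
  then have l: "((\<lambda>h::real. sinh h / h) \<longlongrightarrow> 1) (at 0 within {0..})"
    by (auto intro: tendsto_within_subset)
  have "((\<lambda>h::real. sqrt h) \<longlongrightarrow> sqrt 0) (at 0 within {0..})"
    by (intro tendsto_intros)
  from tendsto_mult[OF l this] have "((\<lambda>h::real. sinh h / h * sqrt h) \<longlongrightarrow> 0) (at 0 within {0..})"
    by simp
  moreover have "\<forall>\<^sub>F h::real in at 0 within {0..}. sinh h / h * sqrt h = sinh h / sqrt h"
    by (auto simp: eventually_at_filter field_simps intro!: always_eventually)
  ultimately have z: "continuous (at 0 within {0..}) (\<lambda>r::real. sinh r / sqrt r)"
    by (simp add: continuous_within tendsto_cong)
  show ?thesis
    unfolding continuous_on_eq_continuous_within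
  proof
    fix x :: real assume "x \<in> {0..}"
    then show "continuous (at x within {0..}) (\<lambda>r. sinh r / sqrt r)"
    proof (cases "x = 0")
      case False
      have "isCont (\<lambda>r. sinh r / sqrt r) x" using False by (intro continuous_intros) auto
      then show ?thesis by (rule continuous_at_imp_continuous_at_within)
    qed (use z in auto)
  qed
qed

text \<open>The contribution of one monotone branch of \<open>w\<close>, for maximum \<open>1\<close>, to the completed square.\<close>

definition bliss_gap :: "real \<Rightarrow> real"
  where "bliss_gap p = integral {0..1} (\<lambda>y. y * sqrt (1 - y powr (p - 2)))"

lemma bliss_gap_scaled:
  assumes p: "2 < p" and M: "0 < M"
  shows "continuous_on {0..M} (\<lambda>y. y * sqrt (1 - (y / M) powr (p - 2)))"
    and "integral {0..M} (\<lambda>y. y * sqrt (1 - (y / M) powr (p - 2))) = M\<^sup>2 * bliss_gap p"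
proof -
  let ?h = "\<lambda>y. y * sqrt (1 - (y / M) powr (p - 2))"
  show c: "continuous_on {0..M} ?h"
    using p M by (intro continuous_intros continuous_on_powr') auto
  have "((\<lambda>x. M *\<^sub>R ?h (M * x)) has_integral integral {M * 0..M * 1} ?h) {0..1}"
    by (rule has_integral_substitution[where c = 0 and d = M])
       (use M c in \<open>auto intro!: derivative_eq_intros simp: mult_left_le\<close>)
  then have "((\<lambda>x. M\<^sup>2 * (x * sqrt (1 - x powr (p - 2)))) has_integral integral {0..M} ?h) {0..1}"
    using M by (simp add: power2_eq_square mult.assoc)
  then have "integral {0..M} ?h = integral {0..1} (\<lambda>x. M\<^sup>2 * (x * sqrt (1 - x powr (p - 2))))"
    by (rule integral_unique[symmetric])
  then show "integral {0..M} ?h = M\<^sup>2 * bliss_gap p"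
    unfolding bliss_gap_def by (simp only: integral_mult_right)
qed

text \<open>\<open>bliss_pointwise\<close> is integrated with \<open>\<sigma> = 1\<close> up to the
  point \<open>r0\<close> of the maximum and with \<open>\<sigma> = -1\<close> beyond it. Since
  \<open>w\<close> vanishes at 0 and at \<open>R\<close>, each side leaves the integral of
  \<open>h\<close> over \<open>{0..M}\<close>. Only the values of \<open>w\<close> at 0,
  \<open>r0\<close> and \<open>R\<close> enter, whatever it does in between.\<close>

lemma bliss_max:
  fixes f f' :: "real \<Rightarrow> real"
  assumes p: "2 < p" and R: "0 < R"
    and der: "\<And>r. (f has_real_derivative f' r) (at r)" and cont: "continuous_on UNIV f'"
    and f0: "\<And>r. 0 \<le> f r" and fR: "f R = 0" and M: "0 < M"
    and max: "\<And>r. r \<in> {0..R} \<Longrightarrow> f r * sinh r / sqrt r \<le> M"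
    and r0: "r0 \<in> {0..R}" "f r0 * sinh r0 / sqrt r0 = M"
  shows "integral {0..R} (\<lambda>r. (f' r)\<^sup>2 * (sinh r)\<^sup>2) - integral {0..R} (\<lambda>r. (f r)\<^sup>2 * (sinh r)\<^sup>2)
    \<ge> M powr (2 - p) / 4 * integral {0..R} (\<lambda>r. f r powr p * sinh r powr ((p - 2) / 2)) + 2 * (M\<^sup>2 * bliss_gap p)"
proof -
  define L1 where "L1 = (\<lambda>r. (f' r)\<^sup>2 * (sinh r)\<^sup>2)"
  define L2 where "L2 = (\<lambda>r. (f r)\<^sup>2 * (sinh r)\<^sup>2)"
  define L3 where "L3 = (\<lambda>r. f r powr p * sinh r powr ((p - 2) / 2))"
  define L where "L = (\<lambda>r. L1 r - L2 r - M powr (2 - p) / 4 * L3 r)"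
  define w where "w = (\<lambda>r. f r * sinh r / sqrt r)"
  define w' where "w' = (\<lambda>r. (f' r * sinh r + f r * cosh r) / sqrt r - f r * sinh r / (2 * r * sqrt r))"
  define h where "h = (\<lambda>y. y * sqrt (1 - (y / M) powr (p - 2)))"
  define G where "G = (\<lambda>y. integral {0..y} h)"
  define Phi where "Phi = (\<lambda>\<sigma> r. - ((f r)\<^sup>2 * (sinh r * cosh r)) + (w r)\<^sup>2 / 2 + \<sigma> * G (w r))"
  \<comment> \<open>At \<open>r = 0\<close> the function \<open>w\<close> need not be
    differentiable. The value \<open>L 0\<close> makes \<open>D \<le> L\<close> trivial there, and
    the fundamental theorem asks for derivatives in the interior only.\<close>
  define D where "D = (\<lambda>\<sigma> r. if r = 0 then L r else
     - (2 * f r * f' r * (sinh r * cosh r) + (f r)\<^sup>2 * ((cosh r)\<^sup>2 + (sinh r)\<^sup>2)) + w r * w' r + \<sigma> * (h (w r) * w' r))"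
  have contf: "continuous_on A f" for A
    using der DERIV_isCont by (blast intro: continuous_at_imp_continuous_on)
  have contf': "continuous_on A f'" for A
    using cont continuous_on_subset by blast
  have contL: "continuous_on {0..R} L1" "continuous_on {0..R} L2" "continuous_on {0..R} L3"
    unfolding L1_def L2_def L3_def using p f0
    by (auto intro!: continuous_intros contf contf' continuous_on_powr')
  then have intL: "L1 integrable_on {0..R}" "L2 integrable_on {0..R}" "L3 integrable_on {0..R}"
    using integrable_continuous_real by blast+
  have contLL: "continuous_on {0..R} L" unfolding L_def by (intro continuous_intros contL)
  have conth: "continuous_on {0..M} h" unfolding h_def by (rule bliss_gap_scaled[OF p M])
  have w0: "0 \<le> w r" if "r \<in> {0..R}" for r
    using that f0[of r] by (auto simp: w_def)
  have wM: "w r \<in> {0..M}" if "r \<in> {0..R}" for r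
    using that max[of r] w0[of r] by (auto simp: w_def)
  have contw: "continuous_on {0..R} w"
  proof -
    have "continuous_on {0..R} (\<lambda>r. f r * (sinh r / sqrt r))"
      by (intro continuous_intros contf continuous_on_subset[OF continuous_on_sinh_div_sqrt]) auto
    then show ?thesis by (simp add: w_def)
  qed
  have derw: "(w has_real_derivative w' r) (at r)" if "r > 0" for r
  proof -
    have a: "((\<lambda>r. f r * sinh r) has_real_derivative f' r * sinh r + f r * cosh r) (at r)"
      by (auto intro!: derivative_eq_intros der simp: algebra_simps)
    define q where "q = sqrt r"
    have qq: "q > 0" "r = q * q" using that by (auto simp: q_def)
    have D: "(w has_real_derivative ((f' r * sinh r + f r * cosh r) * sqrt r - f r * sinh r * (inverse (sqrt r) / 2)) / (sqrt r * sqrt r)) (at r)"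
      unfolding w_def using DERIV_divide[OF a DERIV_real_sqrt[OF that]] that by simp
    have eq: "(A * q - F * (inverse q / 2)) / (q * q) = A / q - F / (2 * (q * q) * q)" for A F
      using qq(1) by (simp add: field_simps)
    show ?thesis
      using D[folded q_def, unfolded eq, folded qq(2)] unfolding w'_def q_def[symmetric] .
  qed
  have derG: "(G has_real_derivative h y) (at y within {0..M})" if "y \<in> {0..M}" for y
    unfolding G_def by (rule integral_has_real_derivative[OF conth that])
  have contG: "continuous_on {0..M} G"
    by (rule DERIV_continuous_on) (rule derG)
  have contPhi: "continuous_on {0..R} (Phi \<sigma>)" for \<sigma>
    unfolding Phi_def
    by (intro continuous_intros contf contw continuous_on_compose2[OF contG contw]) (use wM in auto)
  have derPhi: "(Phi \<sigma> has_real_derivative D \<sigma> r) (at r)" if r: "r \<in> {0<..<R}" for \<sigma> r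
  proof -
    have at: "at r within {0<..<R} = at r" using r by (intro at_within_open) auto
    have "((G \<circ> w) has_real_derivative h (w r) * w' r) (at r within {0<..<R})"
    proof (rule DERIV_image_chain)
      show "(G has_real_derivative h (w r)) (at (w r) within w ` {0<..<R})"
        by (rule DERIV_subset[OF derG]) (use r wM in auto)
      show "(w has_real_derivative w' r) (at r within {0<..<R})"
        using derw[of r] r by (simp add: at)
    qed
    then have GG: "((\<lambda>r. G (w r)) has_real_derivative h (w r) * w' r) (at r)" by (simp add: at o_def)
    show ?thesis
    proof -
      have "((\<lambda>r. - ((f r)\<^sup>2 * (sinh r * cosh r)) + (w r)\<^sup>2 / 2 + \<sigma> * G (w r)) has_real_derivative
        - (2 * f r * f' r * (sinh r * cosh r) + (f r)\<^sup>2 * ((cosh r)\<^sup>2 + (sinh r)\<^sup>2)) + w r * w' r + \<sigma> * (h (w r) * w' r)) (at r)"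
        using r by (auto intro!: derivative_eq_intros der GG derw simp: power2_eq_square)
      moreover have "D \<sigma> r = - (2 * f r * f' r * (sinh r * cosh r) + (f r)\<^sup>2 * ((cosh r)\<^sup>2 + (sinh r)\<^sup>2)) + w r * w' r + \<sigma> * (h (w r) * w' r)"
        using r by (simp add: D_def)
      ultimately show ?thesis unfolding Phi_def by (simp only:)
    qed
  qed
  have DL: "D \<sigma> r \<le> L r" if r: "r \<in> {0..R}" and \<sigma>: "\<sigma> = 1 \<or> \<sigma> = -1" for r \<sigma>
  proof (cases "r = 0")
    case False
    then have "r > 0" using r by simp
    then show ?thesis
      using bliss_pointwise[of r "sinh r" "cosh r" p "f r" "w r" M "h (w r)" \<sigma> "w' r" "f' r"]
        p M f0 \<sigma> wM[OF r] sinh_ge_self[of r]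
      by (simp add: D_def L_def L1_def L2_def L3_def w_def[THEN fun_cong] w'_def[THEN fun_cong] h_def cosh_square_eq)
  qed (simp add: D_def)
  have I: "Phi \<sigma> b - Phi \<sigma> a \<le> integral {a..b} L" if "a \<le> b" "0 \<le> a" "b \<le> R" "\<sigma> = 1 \<or> \<sigma> = -1" for a b \<sigma>
  proof -
    have "(D \<sigma> has_integral (Phi \<sigma> b - Phi \<sigma> a)) {a..b}"
      using that by (intro fundamental_theorem_of_calculus_interior continuous_on_subset[OF contPhi])
        (auto intro!: derPhi simp: has_real_derivative_iff_has_vector_derivative[symmetric])
    moreover have "(L has_integral integral {a..b} L) {a..b}"
      using that by (intro integrable_integral integrable_continuous_real continuous_on_subset[OF contLL]) auto
    ultimately show ?thesis
      using that by (elim has_integral_le) (auto intro!: DL)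
  qed
  have "Phi 1 r0 - Phi 1 0 + (Phi (-1) R - Phi (-1) r0) \<le> integral {0..r0} L + integral {r0..R} L"
    using r0 by (intro add_mono I) auto
  also have "\<dots> = integral {0..R} L"
    using r0 contLL by (intro Henstock_Kurzweil_Integration.integral_combine integrable_continuous_real) auto
  also have "\<dots> = integral {0..R} L1 - integral {0..R} L2 - M powr (2 - p) / 4 * integral {0..R} L3"
  proof -
    have "integral {0..R} L = integral {0..R} (\<lambda>r. L1 r - L2 r) - integral {0..R} (\<lambda>r. M powr (2 - p) / 4 * L3 r)"
      unfolding L_def
      by (intro Henstock_Kurzweil_Integration.integral_diff integrable_diff integrable_on_mult_right intL)
    then show ?thesis
      using Henstock_Kurzweil_Integration.integral_diff[OF intL(1,2)] by simp
  qed
  \<comment> \<open>At \<open>r0\<close> the parts without \<open>\<sigma>\<close> cancel and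
    \<open>G (w r0) = G M\<close> is counted twice; at 0 and at \<open>R\<close> all parts of
    \<open>Phi\<close> vanish.\<close>
  also have "Phi 1 r0 - Phi 1 0 + (Phi (-1) R - Phi (-1) r0) = 2 * G M"
    using r0 fR by (simp add: Phi_def w_def G_def)
  also have "G M = M\<^sup>2 * bliss_gap p"
    unfolding G_def h_def by (rule bliss_gap_scaled[OF p M])
  finally show ?thesis by (simp add: L1_def L2_def L3_def)
qed

lemma powr_ge_tangent:
  fixes t a :: real
  assumes "1 \<le> a" "0 < t"
  shows "1 + a * (t - 1) \<le> t powr a"
proof -
  have d: "((\<lambda>x. x powr a) has_real_derivative a) (at 1 within {0<..})"
    using has_field_derivative_at_within[OF has_real_derivative_powr[of 1 a]] by simp
  have "a * (t - 1) \<le> t powr a - 1 powr a"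
    by (rule convex_on_imp_above_tangent[OF powr_convex _ _ _ d]) (use assms in \<open>auto simp: interior_open\<close>)
  then show ?thesis by simp
qed

text \<open>Here \<open>A\<close> stands for \<open>M^2\<close>. As a function of \<open>A\<close>
  the right-hand side is minimal where \<open>A powr (p / 2) = (p - 2) * X / (16 * g)\<close>, and
  the left-hand side is its value there. With the minimiser \<open>B\<close> and
  \<open>t = B / A\<close> the claim becomes Bernoulli's inequality for
  \<open>t powr (p / 2)\<close>.\<close>

lemma weighted_am_gm_min:
  fixes A X g p :: real
  assumes p: "2 < p" and A: "0 < A" and X: "0 \<le> X" and g: "0 < g"
  shows "2 * g * p / (p - 2) * ((p - 2) * X / (16 * g)) powr (2 / p) \<le> A powr (- (p - 2) / 2) / 4 * X + 2 * A * g"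
proof (cases "X = 0")
  case False
  then have X: "X > 0" using X by simp
  define B where "B = ((p - 2) * X / (16 * g)) powr (2 / p)"
  have B: "B > 0" using X g p by (simp add: B_def)
  have Bp: "B powr (p / 2) = (p - 2) * X / (16 * g)"
    using X g p by (simp add: B_def powr_powr)
  define t where "t = B / A"
  have t: "t > 0" using A B by (simp add: t_def)
  have "t powr (p / 2) \<ge> 1 + (p / 2) * (t - 1)"
    using powr_ge_tangent[of "p/2" t] t p by simp
  then have "(4 * g / (p - 2)) * A * (t powr (p / 2)) \<ge> (4 * g / (p - 2)) * A * (1 + (p / 2) * (t - 1))"
    using A g p by (intro mult_left_mono) auto
  moreover have "A powr (- (p - 2) / 2) / 4 * X = (4 * g / (p - 2)) * A * (t powr (p / 2))"
  proof -
    have "X = 16 * g / (p - 2) * B powr (p / 2)" using Bp g p by (simp add: field_simps)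
    moreover have "t powr (p / 2) = B powr (p / 2) * A powr (- p / 2)"
      using A B by (simp add: t_def powr_divide powr_minus_divide)
    moreover have "A * A powr (- p / 2) = A powr (- (p - 2) / 2)"
    proof -
      have "A * A powr (- p / 2) = A powr (1 + - p / 2)" using A by (simp only: powr_add) simp
      then show ?thesis by (simp add: field_simps)
    qed
    ultimately have "A powr (- (p - 2) / 2) / 4 * X = A * A powr (- p / 2) / 4 * (16 * (g / (p - 2)) * B powr (p / 2))"
      by simp
    also have "\<dots> = 4 * (g / (p - 2)) * A * (B powr (p / 2) * A powr (- p / 2))"
    proof -
      have "\<And>c P Q. A * Q / 4 * (16 * c * P) = 4 * c * A * (P * (Q::real))" by simp
      then show ?thesis .
    qed
    also have "\<dots> = (4 * g / (p - 2)) * A * t powr (p / 2)" using \<open>t powr (p / 2) = _\<close> by simp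
    finally show ?thesis .
  qed
  moreover have "(4 * g / (p - 2)) * A * (1 + (p / 2) * (t - 1)) + 2 * A * g = 2 * g * p / (p - 2) * B"
    using A p by (simp add: t_def field_simps)
  ultimately show ?thesis unfolding B_def by linarith
qed (use A g p in simp)

section \<open>The gap and the sharp constant in terms of Beta and Gamma functions\<close>

lemma bliss_gap_Beta:
  assumes p: "2 < p"
  shows "bliss_gap p = Beta (2 / (p - 2)) (3 / 2) / (p - 2)"
proof -
  define a where "a = 1 / (p - 2)"
  have a: "a > 0" using p by (simp add: a_def)
  let ?f = "\<lambda>y. y * sqrt (1 - y powr (p - 2))"
  have contf: "continuous_on {0..1} ?f"
    using p by (intro continuous_intros continuous_on_powr') auto
  \<comment> \<open>Substitution \<open>y = s powr (1 / (p - 2))\<close>. It need not be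
    differentiable at \<open>s = 0\<close>, so this point is exempted.\<close>
  have "((\<lambda>s. (a * s powr (a - 1)) *\<^sub>R ?f (s powr a)) has_integral integral {0 powr a..1 powr a} ?f) {0..1}"
    by (rule has_integral_substitution_strong[where s = "{0}" and c = 0 and d = 1])
       (use a contf in \<open>auto intro!: continuous_intros continuous_on_powr' powr_le1
          has_field_derivative_at_within[OF has_real_derivative_powr]\<close>)
  then have "((\<lambda>s. (a * s powr (a - 1)) *\<^sub>R ?f (s powr a)) has_integral bliss_gap p) {0..1}"
    using a by (simp add: bliss_gap_def)
  moreover have "(a * s powr (a - 1)) *\<^sub>R ?f (s powr a) = a * (s powr (2 / (p - 2) - 1) * (1 - s) powr (3 / 2 - 1))"
    if "s \<in> {0..1}" for s
  proof -
    have "(s powr a) powr (p - 2) = s" using that p by (simp add: powr_powr a_def)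
    moreover have "s powr (a - 1) * s powr a = s powr (2 / (p - 2) - 1)"
      by (simp add: powr_add[symmetric] a_def)
    moreover have "(1 - s) powr (1 / 2) = sqrt (1 - s)"
      using that by (intro powr_half_sqrt) auto
    ultimately show ?thesis by simp
  qed
  ultimately have "((\<lambda>s. a * (s powr (2 / (p - 2) - 1) * (1 - s) powr (3 / 2 - 1))) has_integral bliss_gap p) {0..1}"
    by (rule has_integral_eq[rotated])
  moreover have "((\<lambda>s. a * (s powr (2 / (p - 2) - 1) * (1 - s) powr (3 / 2 - 1))) has_integral a * Beta (2 / (p - 2)) (3 / 2)) {0..1}"
    using p by (intro has_integral_mult_right has_integral_Beta_real) auto
  ultimately have "bliss_gap p = a * Beta (2 / (p - 2)) (3 / 2)" by (rule has_integral_unique)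
  then show ?thesis by (simp add: a_def)
qed

lemma Gamma_duplication_real:
  fixes x :: real
  assumes x: "x > 0"
  shows "Gamma x * Gamma (x + 1 / 2) = 2 powr (1 - 2 * x) * sqrt pi * Gamma (2 * x)"
proof -
  have pos: "complex_of_real y \<notin> \<int>\<^sub>\<le>\<^sub>0" if "y > 0" for y
    using that by (auto elim!: nonpos_Ints_cases simp: complex_eq_iff)
  have "Gamma (complex_of_real x) * Gamma (of_real x + 1 / 2) =
      exp ((1 - 2 * of_real x) * of_real (ln 2)) * of_real (sqrt pi) * Gamma (2 * of_real x)"
    using pos[of x] pos[of "x + 1/2"] x by (intro Gamma_legendre_duplication) auto
  also have "of_real x + (1 / 2 :: complex) = of_real (x + 1 / 2)" by simp
  also have "2 * of_real x = complex_of_real (2 * x)" by simp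
  also have "(1 - complex_of_real (2 * x)) * of_real (ln 2) = of_real ((1 - 2 * x) * ln 2)" by simp
  finally have "complex_of_real (Gamma x * Gamma (x + 1 / 2)) =
      complex_of_real (exp ((1 - 2 * x) * ln 2) * sqrt pi * Gamma (2 * x))"
    unfolding exp_of_real Gamma_complex_of_real by simp
  then show ?thesis by (simp only: of_real_eq_iff) (simp add: powr_def)
qed

definition sharp_constant :: "real \<Rightarrow> real"
  where "sharp_constant p = p / 2 powr (2 / p) *
      (4 * pi * (Gamma (p / (p - 2)))\<^sup>2 / ((p - 2) * Gamma (2 * p / (p - 2)))) powr ((p - 2) / p)"

text \<open>With \<open>z = 2 / (p - 2)\<close> the gap is a multiple of
  \<open>Gamma (z + 1) / Gamma (z + 3 / 2)\<close>. Legendre duplication at \<open>z + 1\<close>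
  trades \<open>Gamma (z + 3 / 2)\<close> for the \<open>Gamma (2 * (z + 1))\<close> of the sharp
  constant.\<close>

lemma bliss_gap_Gamma:
  assumes p: "2 < p"
  shows "0 < bliss_gap p"
    and "(Gamma (p / (p - 2)))\<^sup>2 / Gamma (2 * p / (p - 2)) = 2 powr (1 - 4 / (p - 2)) * bliss_gap p"
proof -
  define z where "z = 2 / (p - 2)"
  have z: "z > 0" "z * (p - 2) = 2" using p eq_divide_eq[of z 2 "p - 2"] by (simp_all only: z_def) auto
  have e: "p / (p - 2) = z + 1" "2 * p / (p - 2) = 2 * (z + 1)" "4 / (p - 2) = 2 * z"
  proof -
    show "p / (p - 2) = z + 1" using p by (simp add: z_def field_simps)
    then show "2 * p / (p - 2) = 2 * (z + 1)" by (metis times_divide_eq_right)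
    show "4 / (p - 2) = 2 * z" by (simp add: z_def)
  qed
  have G1: "Gamma (z + 1) = z * Gamma z" using z by (intro Gamma_plus1) (auto elim!: nonpos_Ints_cases)
  have G32: "Gamma (3 / 2 :: real) = sqrt pi / 2"
    using Gamma_plus1[of "1/2 :: real"] Gamma_one_half_real nonpos_Ints_nonpos[of "1/2 :: real"] by auto
  have pos: "Gamma z > 0" "Gamma (z + 1) > 0" "Gamma (z + 3 / 2) > 0" "Gamma (2 * (z + 1)) > 0"
    using z by (auto intro!: Gamma_real_pos)
  have "bliss_gap p = Gamma z * (sqrt pi / 2) / Gamma (z + 3 / 2) / (p - 2)"
    unfolding bliss_gap_Beta[OF p] z_def[symmetric] Beta_def G32 ..
  also have "\<dots> = Gamma (z + 1) * sqrt pi / (4 * Gamma (z + 3 / 2))"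
  proof -
    have "1 / d = 2 / d / 2" for d :: real by simp
    then have i: "1 / (p - 2) = z / 2" unfolding z_def .
    have e: "Gamma z * (sqrt pi / 2) / Gamma (z + 3 / 2) / (p - 2) = Gamma z * (sqrt pi / 2) / Gamma (z + 3 / 2) * (1 / (p - 2))"
      by simp
    show ?thesis unfolding e i G1 by simp
  qed
  finally have g: "bliss_gap p = Gamma (z + 1) * sqrt pi / (4 * Gamma (z + 3 / 2))" .
  then show "0 < bliss_gap p" using pos by simp
  have dup: "Gamma (z + 1) * Gamma (z + 3 / 2) = 2 powr (1 - 2 * (z + 1)) * sqrt pi * Gamma (2 * (z + 1))"
    using Gamma_duplication_real[of "z + 1"] z by (simp add: add.assoc)
  have t: "(2::real) powr (1 - 2 * z) = 4 * 2 powr (1 - 2 * (z + 1))"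
    using powr_add[of "2::real" 2 "1 - 2 * (z + 1)"] by (simp add: algebra_simps)
  have "(Gamma (z + 1))\<^sup>2 / Gamma (2 * (z + 1)) =
      Gamma (z + 1) * (Gamma (z + 1) * Gamma (z + 3 / 2)) / (Gamma (2 * (z + 1)) * Gamma (z + 3 / 2))"
    using pos by (simp add: power2_eq_square)
  also have "\<dots> = 2 powr (1 - 2 * (z + 1)) * (Gamma (z + 1) * sqrt pi / Gamma (z + 3 / 2))"
    unfolding dup using pos by simp
  also have "\<dots> = 2 powr (1 - 2 * z) * bliss_gap p"
    unfolding t g by simp
  finally show "(Gamma (p / (p - 2)))\<^sup>2 / Gamma (2 * p / (p - 2)) = 2 powr (1 - 4 / (p - 2)) * bliss_gap p"
    unfolding e .
qed

text \<open>The bracket is the minimum from \<open>weighted_am_gm_min\<close> at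
  \<open>X = 1\<close>. The factor in front comes from the area \<open>4 * pi\<close> of the unit
  sphere, which multiplies the energy once and the weighted integral under the power
  \<open>2 / p\<close>; the exponent left over is \<open>1 - 2 / p\<close>.\<close>

lemma sharp_constant_bliss_gap:
  assumes p: "2 < p"
  shows "sharp_constant p = (4 * pi) powr ((p - 2) / p) *
    (2 * bliss_gap p * p / (p - 2) * ((p - 2) / (16 * bliss_gap p)) powr (2 / p))"
proof -
  define g where "g = bliss_gap p"
  have g: "g > 0" using bliss_gap_Gamma[OF p] by (simp add: g_def)
  define e where "e = 2 / p"
  have e: "(p - 2) / p = 1 - e" "2 / p = e" using p by (auto simp: e_def field_simps)
  \<comment> \<open>The power of 2 from the duplication formula, raised to \<open>1 - 2 / p\<close>,
    has to match the powers of 2 and 16 on the two sides.\<close>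
  have "((2::real) powr (1 - 4 / (p - 2))) powr (1 - e) = 2 powr (1 - 3 * e)"
  proof -
    have "(1 - 4 / (p - 2)) * (1 - e) = 1 - 3 * e"
      using p by (simp add: e_def divide_simps)
    then show ?thesis by (simp add: powr_powr)
  qed
  also have "\<dots> = 2 * 2 powr e / (16::real) powr e"
  proof -
    have "(16::real) powr e = (2 powr 4) powr e" by simp
    also have "\<dots> = 2 powr (4 * e)" by (simp only: powr_powr)
    finally have "2 powr (1 + e) / 2 powr (4 * e) = 2 * 2 powr e / (16::real) powr e"
      by (simp add: powr_add)
    moreover have "(2::real) powr (1 - 3 * e) = 2 powr (1 + e) / 2 powr (4 * e)"
      unfolding powr_diff[symmetric] by (simp add: algebra_simps)
    ultimately show ?thesis by simp
  qed
  finally have two: "((2::real) powr (1 - 4 / (p - 2))) powr (1 - e) = 2 * 2 powr e / (16::real) powr e" .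
  have "sharp_constant p = p / 2 powr e *
      (4 * pi * ((Gamma (p / (p - 2)))\<^sup>2 / Gamma (2 * p / (p - 2))) / (p - 2)) powr (1 - e)"
    unfolding sharp_constant_def e by (simp add: mult.commute)
  also have "\<dots> = p / 2 powr e * (4 * pi * (2 powr (1 - 4 / (p - 2)) * g) / (p - 2)) powr (1 - e)"
    unfolding bliss_gap_Gamma(2)[OF p] g_def ..
  also have "\<dots> = p / 2 powr e * ((4 * pi) powr (1 - e) * ((2 * 2 powr e / 16 powr e) * (g / g powr e)) / ((p - 2) / (p - 2) powr e))"
  proof -
    have P: "(q * (a * g) / d) powr (1 - e) = q powr (1 - e) * (a powr (1 - e) * (g / g powr e)) / (d / d powr e)"
      if "q > 0" "a > 0" "d > 0" for q a d :: real
      using that g by (simp add: powr_mult powr_divide powr_diff)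
    show ?thesis by (subst P) (use p in \<open>simp_all only: two, simp_all\<close>)
  qed
  also have "\<dots> = (4 * pi) powr (1 - e) * (2 * g * p / (p - 2) * ((p - 2) / (16 * g)) powr e)"
  proof -
    have "((p - 2) / (16 * g)) powr e = (p - 2) powr e / (16 powr e * g powr e)"
      using g p by (simp add: powr_mult powr_divide)
    then show ?thesis by (simp add: mult_ac)
  qed
  finally show ?thesis by (simp only: e g_def)
qed

text \<open>\<open>bliss_max\<close> depends on the unknown maximum \<open>M\<close> of
  \<open>f * sinh r / sqrt r\<close>; its lower bound is replaced by the minimum over all
  \<open>M\<close>, taken in the variable \<open>A = M^2\<close>.\<close>

lemma bliss_inequality:
  fixes f f' :: "real \<Rightarrow> real"
  assumes p: "2 < p" and R: "0 < R"
    and der: "\<And>r. (f has_real_derivative f' r) (at r)" and cont: "continuous_on UNIV f'"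
    and f0: "\<And>r. 0 \<le> f r" and fR: "f R = 0"
  shows "integral {0..R} (\<lambda>r. (f r)\<^sup>2 * (sinh r)\<^sup>2) +
      sharp_constant p / (4 * pi) powr ((p - 2) / p) *
        integral {0..R} (\<lambda>r. f r powr p * sinh r powr ((p - 2) / 2)) powr (2 / p)
    \<le> integral {0..R} (\<lambda>r. (f' r)\<^sup>2 * (sinh r)\<^sup>2)"
proof -
  define X where "X = integral {0..R} (\<lambda>r. f r powr p * sinh r powr ((p - 2) / 2))"
  define K where "K = 2 * bliss_gap p * p / (p - 2) * ((p - 2) / (16 * bliss_gap p)) powr (2 / p)"
  have K: "sharp_constant p / (4 * pi) powr ((p - 2) / p) = K"
    unfolding sharp_constant_bliss_gap[OF p] K_def by simp
  have contf: "continuous_on A f" for A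
    using der DERIV_isCont by (blast intro: continuous_at_imp_continuous_on)
  have contf': "continuous_on A f'" for A
    using cont continuous_on_subset by blast
  have X0: "X \<ge> 0" unfolding X_def using p f0
    by (intro Henstock_Kurzweil_Integration.integral_nonneg integrable_continuous_real)
       (auto intro!: continuous_intros contf continuous_on_powr')
  have E0: "integral {0..R} (\<lambda>r. (f' r)\<^sup>2 * (sinh r)\<^sup>2) \<ge> 0"
    by (intro Henstock_Kurzweil_Integration.integral_nonneg integrable_continuous_real)
       (auto intro!: continuous_intros contf')
  have "continuous_on {0..R} (\<lambda>r. f r * (sinh r / sqrt r))"
    by (intro continuous_intros contf continuous_on_subset[OF continuous_on_sinh_div_sqrt]) auto
  then have "continuous_on {0..R} (\<lambda>r. f r * sinh r / sqrt r)" by simp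
  then obtain r0 where r0: "r0 \<in> {0..R}" "\<And>r. r \<in> {0..R} \<Longrightarrow> f r * sinh r / sqrt r \<le> f r0 * sinh r0 / sqrt r0"
    using continuous_attains_sup[of "{0..R}" "\<lambda>r. f r * sinh r / sqrt r"] R by auto
  define M where "M = f r0 * sinh r0 / sqrt r0"
  have "M \<ge> 0" using r0(1) f0[of r0] by (simp add: M_def)
  then consider "M = 0" | "M > 0" by linarith
  then show ?thesis
  proof cases
    case 1
    have z: "f r * sinh r = 0" if "r \<in> {0..R}" for r
    proof (cases "r = 0")
      case False
      have "f r * sinh r / sqrt r \<le> M" using r0(2)[OF that] unfolding M_def .
      then have "f r * sinh r / sqrt r \<le> 0" unfolding 1 .
      moreover have "f r * sinh r / sqrt r \<ge> 0" using that f0[of r] by simp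
      ultimately show ?thesis using that False by (simp add: divide_le_0_iff zero_le_divide_iff)
    qed simp
    have "integral {0..R} (\<lambda>r. (f r)\<^sup>2 * (sinh r)\<^sup>2) = integral {0..R} (\<lambda>r. 0)"
      by (rule Henstock_Kurzweil_Integration.integral_cong) (use z in auto)
    moreover have "X = integral {0..R} (\<lambda>r. 0)"
      unfolding X_def by (rule Henstock_Kurzweil_Integration.integral_cong) (use z p in auto)
    ultimately show ?thesis using E0 by (simp add: X_def[symmetric])
  next
    case 2
    have "M powr (2 - p) = (M\<^sup>2) powr (- (p - 2) / 2)"
    proof -
      have "(M\<^sup>2) powr (- (p - 2) / 2) = M powr (2 * (- (p - 2) / 2))"
        using 2 by (simp only: powr_powr powr_numeral[symmetric])
      also have "2 * (- (p - 2) / 2) = 2 - p" by (simp add: field_simps)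
      finally show ?thesis ..
    qed
    moreover have "K * X powr (2 / p) = 2 * bliss_gap p * p / (p - 2) * ((p - 2) * X / (16 * bliss_gap p)) powr (2 / p)"
      using X0 p bliss_gap_Gamma(1)[OF p] unfolding K_def by (simp add: powr_mult powr_divide)
    ultimately have "K * X powr (2 / p) \<le> M powr (2 - p) / 4 * X + 2 * (M\<^sup>2 * bliss_gap p)"
      using weighted_am_gm_min[OF p, of "M\<^sup>2" X "bliss_gap p"] 2 X0 bliss_gap_Gamma(1)[OF p] by simp
    then show ?thesis
      using bliss_max[OF p R der cont f0 fR 2 _ r0(1)] r0(2) unfolding X_def[symmetric] K M_def[symmetric]
      by auto
  qed
qed

section \<open>Hyperbolic distance and reflections\<close>

text \<open>On \<open>H3\<close> this is \<open>2 * (cosh d - 1)\<close> for the hyperbolic distance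
  \<open>d\<close>. It is rational in the coordinates and increases with \<open>d\<close>, so
  distances are compared through it and \<open>arcosh\<close> is avoided.\<close>

definition hyp_delta :: "real^3 \<Rightarrow> real^3 \<Rightarrow> real"
  where "hyp_delta x y = (dist x y)\<^sup>2 / (x $ 3 * y $ 3)"

lemma hyp_delta_nonneg: "x \<in> H3 \<Longrightarrow> y \<in> H3 \<Longrightarrow> 0 \<le> hyp_delta x y"
  by (simp add: hyp_delta_def H3_def)

lemma hyp_delta_commute: "hyp_delta x y = hyp_delta y x"
  by (simp add: hyp_delta_def dist_commute mult.commute)

lemma hyp_delta_self [simp]: "hyp_delta x x = 0"
  by (simp add: hyp_delta_def)

lemma hyp_dist_delta: "hyp_dist x y = arcosh (1 + hyp_delta x y / 2)"
  by (simp add: hyp_dist_def hyp_delta_def mult_ac)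

lemma cosh_hyp_dist: "x \<in> H3 \<Longrightarrow> y \<in> H3 \<Longrightarrow> cosh (hyp_dist x y) = 1 + hyp_delta x y / 2"
  using hyp_delta_nonneg[of x y] by (simp add: hyp_dist_delta)

lemma hyp_dist_nonneg: "x \<in> H3 \<Longrightarrow> y \<in> H3 \<Longrightarrow> 0 \<le> hyp_dist x y"
  using hyp_delta_nonneg[of x y] by (simp add: hyp_dist_delta)

lemma hyp_dist_commute: "hyp_dist x y = hyp_dist y x"
  by (simp add: hyp_dist_delta hyp_delta_commute)

lemma hyp_dist_le_iff:
  assumes "x \<in> H3" "y \<in> H3" "z \<in> H3" "w \<in> H3"
  shows "hyp_dist x y \<le> hyp_dist z w \<longleftrightarrow> hyp_delta x y \<le> hyp_delta z w"
  using cosh_real_nonneg_le_iff[of "hyp_dist x y" "hyp_dist z w"] assms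
  by (simp add: cosh_hyp_dist hyp_dist_nonneg)

lemma hyp_dist_less_iff:
  assumes "x \<in> H3" "y \<in> H3" "z \<in> H3" "w \<in> H3"
  shows "hyp_dist x y < hyp_dist z w \<longleftrightarrow> hyp_delta x y < hyp_delta z w"
  using hyp_dist_le_iff[of z w x y] assms by auto

lemma hyp_dist_less_iff_cosh:
  assumes "x \<in> H3" "y \<in> H3" "0 \<le> r"
  shows "hyp_dist x y < r \<longleftrightarrow> hyp_delta x y < 2 * (cosh r - 1)"
  using cosh_real_nonneg_less_iff[of "hyp_dist x y" r] assms
  by (auto simp: cosh_hyp_dist hyp_dist_nonneg)

lemma hyp_dist_eq_0_iff: "x \<in> H3 \<Longrightarrow> y \<in> H3 \<Longrightarrow> hyp_dist x y = 0 \<longleftrightarrow> x = y"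
  using hyp_delta_nonneg[of x y] by (auto simp: hyp_dist_delta hyp_delta_def H3_def)

lemma open_H3: "open H3"
  unfolding H3_def by (intro open_Collect_less continuous_intros)

lemma H3_borel [measurable]: "H3 \<in> sets borel"
  using open_H3 by (rule borel_open)

lemma hyp_delta_borel [measurable]: "hyp_delta b \<in> borel_measurable borel"
  unfolding hyp_delta_def by measurable

lemma hyp_dist_borel [measurable]: "hyp_dist b \<in> borel_measurable borel"
  unfolding hyp_dist_def arcosh_def by measurable

lemma sets_hyp_volume [measurable_cong, simp]: "sets hyp_volume = sets borel"
  by (simp add: hyp_volume_def)

lemma space_hyp_volume [simp]: "space hyp_volume = UNIV"
  by (simp add: hyp_volume_def)

lemma nn_integral_hyp_volume:
  assumes [measurable]: "F \<in> borel_measurable borel"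
  shows "(\<integral>\<^sup>+x. F x \<partial>hyp_volume) = (\<integral>\<^sup>+x. ennreal (indicator H3 x / (x $ 3) ^ 3) * F x \<partial>lborel)"
  unfolding hyp_volume_def by (rule nn_integral_density) auto

lemma AE_hyp_volume_H3: "AE x in hyp_volume. x \<in> H3"
  unfolding hyp_volume_def by (subst AE_density) (auto simp: indicator_def)

lemma nn_integral_inversion:
  assumes k: "k > 0" and F [measurable]: "F \<in> borel_measurable borel"
  shows "(\<integral>\<^sup>+x. F x \<partial>lborel) = (\<integral>\<^sup>+x. ennreal ((k / (norm (x - c))\<^sup>2)^3) * F (inversion c k x) \<partial>lborel)"
proof -
  have "(\<integral>\<^sup>+x. F x \<partial>lborel) = (\<integral>\<^sup>+x. F x \<partial>distr (density lborel (\<lambda>x. ennreal ((k / (norm (x - c))\<^sup>2)^3))) borel (inversion c k))"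
    by (simp only: inversion_lborel[OF k])
  also have "\<dots> = (\<integral>\<^sup>+x. F (inversion c k x) \<partial>density lborel (\<lambda>x. ennreal ((k / (norm (x - c))\<^sup>2)^3)))"
    by (rule nn_integral_distr) auto
  also have "\<dots> = (\<integral>\<^sup>+x. ennreal ((k / (norm (x - c))\<^sup>2)^3) * F (inversion c k x) \<partial>lborel)"
    by (rule nn_integral_density) auto
  finally show ?thesis .
qed

text \<open>\<open>k\<close> is the square of the radius. A hemisphere centred on the boundary plane
  is a hyperbolic plane, and the inversion in it is the hyperbolic reflection. Reflections in
  vertical planes are not of this form, which is why \<open>exists_reflection\<close> asks for
  different heights.\<close>

locale hyp_reflection =
  fixes c :: "real^3" and k :: real
  assumes c3: "c $ 3 = 0" and k: "0 < k"
begin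

abbreviation "\<sigma> \<equiv> inversion c k"

lemma neq_centre: "x \<in> H3 \<Longrightarrow> x \<noteq> c"
  using c3 by (auto simp: H3_def)

lemma reflection_nth: "\<sigma> x $ 3 = k / (norm (x - c))\<^sup>2 * x $ 3"
  using c3 by (simp add: inversion_def)

lemma reflection_H3 [simp]: "x \<in> H3 \<Longrightarrow> \<sigma> x \<in> H3"
  using k neq_centre[of x] by (simp add: H3_def reflection_nth)

lemma reflection_H3_iff: "x \<noteq> c \<Longrightarrow> \<sigma> x \<in> H3 \<longleftrightarrow> x \<in> H3"
  using k by (simp add: H3_def reflection_nth zero_less_mult_iff zero_less_divide_iff)

lemma reflection_reflection [simp]: "x \<in> H3 \<Longrightarrow> \<sigma> (\<sigma> x) = x"
  using k neq_centre by simp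

text \<open>Each of the two factors in the numerator tells on which side of the mirror its point
  lies. Isometry, half-spaces and the comparison of distances across the mirror are all read off
  from this identity.\<close>

lemma hyp_delta_reflection_diff:
  assumes x: "x \<in> H3" and y: "y \<in> H3"
  shows "hyp_delta (\<sigma> x) y - hyp_delta x y =
    ((norm (x - c))\<^sup>2 - k) * ((norm (y - c))\<^sup>2 - k) / (k * x $ 3 * y $ 3)"
proof -
  define X Y where "X = x - c" and "Y = y - c"
  define n where "n = X \<bullet> X"
  have n: "n > 0" using neq_centre[OF x] by (simp add: n_def X_def)
  have nn: "(norm (x - c))\<^sup>2 = n" by (simp add: n_def X_def power2_norm_eq_inner)
  have "\<sigma> x - y = (k / n) *\<^sub>R X - Y"
    by (simp add: inversion_def nn) (simp add: X_def Y_def)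
  then have "(dist (\<sigma> x) y)\<^sup>2 = (k / n)\<^sup>2 * n - 2 * (k / n) * (X \<bullet> Y) + Y \<bullet> Y"
    by (simp add: dist_norm power2_norm_eq_inner inner_diff n_def[symmetric] inner_commute) (simp add: power2_eq_square)
  also have "\<dots> = (k\<^sup>2 - 2 * k * (X \<bullet> Y) + n * (Y \<bullet> Y)) / n"
    using n by (simp add: field_simps power2_eq_square)
  finally have d1: "(dist (\<sigma> x) y)\<^sup>2 = (k\<^sup>2 - 2 * k * (X \<bullet> Y) + n * (Y \<bullet> Y)) / n" .
  have "x - y = X - Y" by (simp add: X_def Y_def)
  then have d2: "(dist x y)\<^sup>2 = n - 2 * (X \<bullet> Y) + Y \<bullet> Y"
    by (simp add: dist_norm power2_norm_eq_inner inner_diff n_def inner_commute)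
  have "hyp_delta (\<sigma> x) y = (k\<^sup>2 - 2 * k * (X \<bullet> Y) + n * (Y \<bullet> Y)) / (k * x $ 3 * y $ 3)"
  proof -
    have "A / n / (k / n * s * t) = A / (k * s * t)" for A s t using n k by simp
    then show ?thesis unfolding hyp_delta_def d1 reflection_nth nn .
  qed
  moreover have "hyp_delta x y = k * (n - 2 * (X \<bullet> Y) + Y \<bullet> Y) / (k * x $ 3 * y $ 3)"
    unfolding hyp_delta_def d2 using k by simp
  moreover have "(norm (y - c))\<^sup>2 = Y \<bullet> Y" by (simp add: Y_def power2_norm_eq_inner)
  ultimately show ?thesis
    unfolding nn by (simp add: diff_divide_distrib[symmetric] power2_eq_square algebra_simps)
qed

text \<open>The preceding identity is used for the pair \<open>x\<close>, \<open>\<sigma> y\<close>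
  and for the pair \<open>y\<close>, \<open>x\<close>. The two differences are opposite: the
  inversion turns the factor \<open>m - k\<close> into \<open>k * (k - m) / m\<close> and multiplies
  the height of \<open>y\<close> by \<open>k / m\<close>.\<close>

lemma hyp_delta_reflection [simp]:
  assumes x: "x \<in> H3" and y: "y \<in> H3"
  shows "hyp_delta (\<sigma> x) (\<sigma> y) = hyp_delta x y"
proof -
  define n m where "n = (norm (x - c))\<^sup>2" and "m = (norm (y - c))\<^sup>2"
  have nm: "n > 0" "m > 0" using neq_centre x y by (auto simp: n_def m_def)
  have pos: "x $ 3 > 0" "y $ 3 > 0" using x y by (auto simp: H3_def)
  have ny: "(norm (\<sigma> y - c))\<^sup>2 = k\<^sup>2 / m"
  proof -
    have "(norm (\<sigma> y - c))\<^sup>2 = (k / m)\<^sup>2 * m"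
      unfolding inversion_minus_centre m_def[symmetric] norm_scaleR power_mult_distrib by (simp add: power_divide)
    then show ?thesis using nm by (simp add: power2_eq_square)
  qed
  have "hyp_delta (\<sigma> x) (\<sigma> y) - hyp_delta x (\<sigma> y) = (n - k) * (k\<^sup>2 / m - k) / (k * x $ 3 * (k / m * y $ 3))"
    using hyp_delta_reflection_diff[OF x reflection_H3[OF y]] unfolding ny n_def m_def reflection_nth .
  also have "\<dots> = - ((m - k) * (n - k) / (k * y $ 3 * x $ 3))"
    using nm pos k by (simp add: field_simps power2_eq_square)
  also have "\<dots> = - (hyp_delta (\<sigma> y) x - hyp_delta y x)"
    using hyp_delta_reflection_diff[OF y x] unfolding n_def m_def by simp
  finally show ?thesis by (simp add: hyp_delta_commute)
qed

lemma hyp_dist_reflection [simp]: "x \<in> H3 \<Longrightarrow> y \<in> H3 \<Longrightarrow> hyp_dist (\<sigma> x) (\<sigma> y) = hyp_dist x y"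
  by (simp add: hyp_dist_delta)

lemma hyp_dist_reflection_swap: "x \<in> H3 \<Longrightarrow> y \<in> H3 \<Longrightarrow> hyp_dist (\<sigma> x) y = hyp_dist x (\<sigma> y)"
  using hyp_dist_reflection[of x "\<sigma> y"] by simp

text \<open>For \<open>b\<close> off the mirror this is the closed half-space that contains
  \<open>b\<close>.\<close>

definition near :: "real^3 \<Rightarrow> real^3 \<Rightarrow> bool"
  where "near b x \<longleftrightarrow> hyp_dist x b \<le> hyp_dist (\<sigma> x) b"

lemma near_iff:
  assumes "b \<in> H3" "x \<in> H3"
  shows "near b x \<longleftrightarrow> 0 \<le> ((norm (x - c))\<^sup>2 - k) * ((norm (b - c))\<^sup>2 - k)"
proof -
  have "near b x \<longleftrightarrow> 0 \<le> hyp_delta (\<sigma> x) b - hyp_delta x b"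
    using assms by (simp add: near_def hyp_dist_le_iff)
  moreover have "k * x $ 3 * b $ 3 > 0" using assms k by (simp add: H3_def)
  ultimately show ?thesis
    unfolding hyp_delta_reflection_diff[OF assms(2,1)] by (simp add: zero_le_divide_iff)
qed

text \<open>The side factors of \<open>x\<close> and \<open>y\<close> have opposite signs, so the
  product in \<open>hyp_delta_reflection_diff\<close> is not positive. This is the geometric fact
  behind the polarisation estimates.\<close>

lemma opposite_sides:
  assumes b: "b \<in> H3" and x: "x \<in> H3" and y: "y \<in> H3" and "near b x" "\<not> near b y"
  shows "hyp_dist x (\<sigma> y) \<le> hyp_dist x y"
proof -
  let ?A = "\<lambda>z. (norm (z - c))\<^sup>2 - k"
  have "0 \<le> ?A x * ?A b" "?A y * ?A b < 0"
    using assms by (auto simp: near_iff)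
  then have "?A y * ?A x \<le> 0"
    by (smt (verit) mult_less_0_iff zero_le_mult_iff mult_le_0_iff)
  then have "hyp_delta (\<sigma> y) x - hyp_delta y x \<le> 0"
    unfolding hyp_delta_reflection_diff[OF y x] using x y k by (simp add: divide_le_0_iff H3_def)
  then show ?thesis using x y by (simp add: hyp_dist_le_iff hyp_delta_commute)
qed

lemma near_reflection:
  assumes "b \<in> H3" "x \<in> H3" "\<not> near b x"
  shows "near b (\<sigma> x)"
  using assms by (auto simp: near_def)

text \<open>With the factor \<open>k / (norm (x - c))^2\<close>, an inversion changes Lebesgue
  measure by the cube and the height by the first power; in the hyperbolic density the two changes
  cancel.\<close>

lemma nn_integral_reflection:
  assumes F [measurable]: "F \<in> borel_measurable borel"
  shows "(\<integral>\<^sup>+x. F (\<sigma> x) \<partial>hyp_volume) = (\<integral>\<^sup>+x. F x \<partial>hyp_volume)"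
proof -
  let ?w = "\<lambda>x::real^3. ennreal (indicator H3 x / (x $ 3) ^ 3)"
  have "(\<integral>\<^sup>+x. F x \<partial>hyp_volume) = (\<integral>\<^sup>+x. ennreal ((k / (norm (x - c))\<^sup>2)^3) * (?w (\<sigma> x) * F (\<sigma> x)) \<partial>lborel)"
    unfolding nn_integral_hyp_volume[OF F] by (rule nn_integral_inversion[OF k]) measurable
  also have "\<dots> = (\<integral>\<^sup>+x. ?w x * F (\<sigma> x) \<partial>lborel)"
  proof (rule nn_integral_cong)
    fix x
    have "(k / (norm (x - c))\<^sup>2)^3 * (indicator H3 (\<sigma> x) / (\<sigma> x $ 3) ^ 3) = (indicator H3 x / (x $ 3) ^ 3 :: real)"
    proof (cases "x \<in> H3")
      case True
      then have "x \<noteq> c" "x $ 3 > 0" using neq_centre by (auto simp: H3_def)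
      then have "k / (norm (x - c))\<^sup>2 > 0" using k by simp
      moreover have "a ^ 3 * (1 / (a * b) ^ 3) = 1 / b ^ 3" if "a > 0" for a b :: real
        using that by (simp add: power_mult_distrib)
      moreover have "indicator H3 (\<sigma> x) = (1::real)" "indicator H3 x = (1::real)" using True by simp_all
      ultimately show ?thesis unfolding reflection_nth by (simp only:)
    next
      case False
      then show ?thesis using reflection_H3_iff[of x] by (cases "x = c") (auto simp: indicator_def)
    qed
    then have "ennreal ((k / (norm (x - c))\<^sup>2)^3) * ?w (\<sigma> x) = ?w x"
      using k by (subst ennreal_mult'[symmetric]) auto
    then show "ennreal ((k / (norm (x - c))\<^sup>2)^3) * (?w (\<sigma> x) * F (\<sigma> x)) = ?w x * F (\<sigma> x)"
      by (simp only: mult.assoc[symmetric])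
  qed
  also have "\<dots> = (\<integral>\<^sup>+x. F (\<sigma> x) \<partial>hyp_volume)"
    by (rule nn_integral_hyp_volume[symmetric]) measurable
  finally show ?thesis ..
qed

lemma nn_integral_symmetrise:
  assumes [measurable]: "h \<in> borel_measurable borel"
  shows "(\<integral>\<^sup>+x. h x + h (\<sigma> x) \<partial>hyp_volume) = 2 * (\<integral>\<^sup>+x. h x \<partial>hyp_volume)"
  by (subst nn_integral_add) (auto simp: nn_integral_reflection mult_2)

text \<open>Because the measure is invariant, it suffices to compare sums over the pairs
  \<open>x\<close>, \<open>\<sigma> x\<close>, on which polarisation acts.\<close>

lemma nn_integral_le_symmetrised:
  assumes [measurable]: "F \<in> borel_measurable borel" "G \<in> borel_measurable borel"
    and le: "AE x in hyp_volume. F x + F (\<sigma> x) \<le> G x + G (\<sigma> x)"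
  shows "(\<integral>\<^sup>+x. F x \<partial>hyp_volume) \<le> (\<integral>\<^sup>+x. G x \<partial>hyp_volume)"
proof -
  have "2 * (\<integral>\<^sup>+x. F x \<partial>hyp_volume) \<le> 2 * (\<integral>\<^sup>+x. G x \<partial>hyp_volume)"
    unfolding nn_integral_symmetrise[OF assms(1), symmetric] nn_integral_symmetrise[OF assms(2), symmetric]
    by (rule nn_integral_mono_AE[OF le])
  then show ?thesis
    by (simp add: ennreal_mult_le_mult_iff)
qed

end

lemma exists_reflection:
  assumes x: "x \<in> H3" and y: "y \<in> H3" and ne: "x $ 3 \<noteq> y $ 3"
  obtains c k where "hyp_reflection c k" "inversion c k x = y"
proof -
  define t where "t = y $ 3 / x $ 3"
  have t: "t > 0" "t \<noteq> 1" using x y ne by (auto simp: t_def H3_def)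
  \<comment> \<open>The centre is the point where the line through \<open>x\<close> and
    \<open>y\<close> meets the boundary plane; seen from there, \<open>y\<close> is \<open>x\<close>
    scaled by the ratio \<open>t\<close> of the heights.\<close>
  define c where "c = (1 / (1 - t)) *\<^sub>R (y - t *\<^sub>R x)"
  have yc: "y - c = t *\<^sub>R (x - c)"
  proof -
    have "(1 - t) *\<^sub>R c = y - t *\<^sub>R x" using t by (simp add: c_def)
    then show ?thesis by (simp add: algebra_simps)
  qed
  have c3: "c $ 3 = 0" using x by (simp add: c_def t_def H3_def)
  have xc: "x \<noteq> c" using x c3 by (auto simp: H3_def)
  define k where "k = t * (norm (x - c))\<^sup>2"
  have "k > 0" using t xc by (simp add: k_def)
  moreover have "inversion c k x = y"
    using xc yc by (simp add: inversion_def k_def algebra_simps)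
  ultimately show thesis using that c3 by (simp add: hyp_reflection_def)
qed

section \<open>Geodesic polar coordinates\<close>

text \<open>Integrals of functions of \<open>\<rho>\<close> are determined by the measures of the
  balls \<open>\<rho> < r\<close>. The push-forward is taken along \<open>- \<rho>\<close> because
  measures are compared on upper rays \<open>{a<..}\<close>: for \<open>- \<rho>\<close> these are
  balls of finite measure, for \<open>\<rho>\<close> they would be complements of balls.\<close>

lemma nn_integral_radius:
  fixes \<rho> :: "'a \<Rightarrow> real" and h :: "real \<Rightarrow> real"
  assumes [measurable]: "\<rho> \<in> borel_measurable M" "h \<in> borel_measurable borel" "F \<in> borel_measurable borel"
    and nonneg: "AE x in M. 0 \<le> \<rho> x"
    and em: "\<And>r. 0 < r \<Longrightarrow> emeasure M {x \<in> space M. \<rho> x < r} = (\<integral>\<^sup>+t. ennreal (h t) * indicator {0..r} t \<partial>lborel)"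
    and fin: "\<And>r. 0 < r \<Longrightarrow> emeasure M {x \<in> space M. \<rho> x < r} < \<infinity>"
  shows "(\<integral>\<^sup>+x. F (\<rho> x) \<partial>M) = (\<integral>\<^sup>+t. ennreal (h t) * indicator {0..} t * F t \<partial>lborel)"
proof -
  define M1 where "M1 = distr M borel (\<lambda>x. - \<rho> x)"
  define M2 where "M2 = density lborel (\<lambda>t. ennreal (h (- t)) * indicator {..0} t)"
  have em1: "emeasure M1 {a<..} = emeasure M {x \<in> space M. \<rho> x < - a}" for a
    unfolding M1_def by (subst emeasure_distr) (auto intro!: arg_cong[where f = "emeasure M"])
  have em0: "emeasure M {x \<in> space M. \<rho> x < - a} = 0" if "0 \<le> a" for a
  proof -
    have "AE x in M. \<not> \<rho> x < - a" using nonneg by eventually_elim (use that in auto)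
    then show ?thesis by (subst (asm) AE_iff_measurable[OF _ refl]) auto
  qed
  have em2: "emeasure M2 {a<..} = emeasure M {x \<in> space M. \<rho> x < - a}" for a
  proof -
    have "emeasure M2 {a<..} = (\<integral>\<^sup>+t. ennreal (h (- t)) * indicator {..0} t * indicator {a<..} t \<partial>lborel)"
      unfolding M2_def by (subst emeasure_density) auto
    also have "\<dots> = (\<integral>\<^sup>+t. ennreal (h t) * indicator {..0} (- t) * indicator {a<..} (- t) \<partial>lborel)"
      by (subst nn_integral_real_affine[where c = "-1" and t = 0]) auto
    also have "\<dots> = (\<integral>\<^sup>+t. ennreal (h t) * indicator {0..<- a} t \<partial>lborel)"
      by (intro nn_integral_cong) (auto simp: indicator_def)
    also have "\<dots> = emeasure M {x \<in> space M. \<rho> x < - a}"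
    proof (cases "a < 0")
      case True
      have "AE t in lborel. ennreal (h t) * indicator {0..<- a} t = ennreal (h t) * indicator {0..- a} t"
        using AE_lborel_singleton[of "- a"] by eventually_elim (auto simp: indicator_def)
      then show ?thesis using em[of "- a"] True by (simp add: nn_integral_cong_AE)
    qed (use em0[of a] in simp)
    finally show ?thesis .
  qed
  have "M1 = M2"
  proof (rule measure_eqI_lessThan)
    show "emeasure M1 {x<..} < \<infinity>" for x
      using fin[of "- x"] em0[of x] by (cases "x < 0") (auto simp: em1)
  qed (auto simp: em1 em2, auto simp: M1_def M2_def)
  have "(\<integral>\<^sup>+x. F (\<rho> x) \<partial>M) = (\<integral>\<^sup>+s. F (- s) \<partial>M1)"
    unfolding M1_def by (subst nn_integral_distr) auto
  also have "\<dots> = (\<integral>\<^sup>+t. ennreal (h (- t)) * indicator {..0} t * F (- t) \<partial>lborel)"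
    unfolding \<open>M1 = M2\<close> M2_def by (subst nn_integral_density) auto
  also have "\<dots> = (\<integral>\<^sup>+t. ennreal (h t) * indicator {..0} (- t) * F t \<partial>lborel)"
    by (subst nn_integral_real_affine[where c = "-1" and t = 0]) auto
  also have "\<dots> = (\<integral>\<^sup>+t. ennreal (h t) * indicator {0..} t * F t \<partial>lborel)"
    by (intro nn_integral_cong) (auto simp: indicator_def)
  finally show ?thesis .
qed

lemma nn_integral_norm:
  assumes [measurable]: "F \<in> borel_measurable borel"
  shows "(\<integral>\<^sup>+x. F (norm (x :: real^3)) \<partial>lborel) = (\<integral>\<^sup>+t. ennreal (4 * pi * t\<^sup>2) * indicator {0..} t * F t \<partial>lborel)"
proof (rule nn_integral_radius)
  have e: "emeasure lborel {x \<in> space lborel. norm (x :: real^3) < r} = ennreal (4 / 3 * pi * r ^ 3)" if "0 < r" for r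
  proof -
    have "{x \<in> space lborel. norm (x :: real^3) < r} = ball 0 r" by auto
    then show ?thesis using that emeasure_ball[of r "0 :: real^3"] by (simp add: unit_ball_vol_3)
  qed
  then show "emeasure lborel {x \<in> space lborel. norm (x :: real^3) < r} < \<infinity>" if "0 < r" for r
    using that by (simp add: less_top)
  show "emeasure lborel {x \<in> space lborel. norm (x :: real^3) < r} = (\<integral>\<^sup>+t. ennreal (4 * pi * t\<^sup>2) * indicator {0..r} t \<partial>lborel)"
    if "0 < r" for r
  proof -
    have "(\<integral>\<^sup>+t. ennreal (4 * pi * t\<^sup>2) * indicator {0..r} t \<partial>lborel) = ennreal (4 / 3 * pi * r ^ 3 - 4 / 3 * pi * 0 ^ 3)"
      by (rule nn_integral_FTC_Icc) (use that in \<open>auto intro!: derivative_eq_intros\<close>)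
    then show ?thesis using e[OF that] by simp
  qed
qed auto

section \<open>Polar coordinates in hyperbolic space through the ball model\<close>

abbreviation e3 :: "real^3" where "e3 \<equiv> axis 3 1"

lemma e3_H3: "e3 \<in> H3"
  by (simp add: H3_def axis_def)

lemma cayley_nth:
  assumes "y \<noteq> - e3"
  shows "inversion (- e3) 2 y $ 3 = (1 - (norm y)\<^sup>2) / (norm (y + e3))\<^sup>2"
proof -
  define n where "n = (norm (y + e3))\<^sup>2"
  have "y + e3 \<noteq> 0" using assms by (simp add: eq_neg_iff_add_eq_0)
  then have n0: "n > 0" by (simp add: n_def)
  have "n = (norm y)\<^sup>2 + 2 * y $ 3 + 1"
    by (simp add: n_def power2_norm_eq_inner inner_add inner_axis inner_axis' algebra_simps)
  moreover have "inversion (- e3) 2 y $ 3 = - 1 + 2 / n * (y $ 3 + 1)"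
    by (simp add: inversion_def n_def axis_def)
  ultimately show ?thesis unfolding n_def[symmetric] using n0 by (simp add: field_simps)
qed

lemma cayley_H3_iff: "inversion (- e3) 2 y \<in> H3 \<longleftrightarrow> norm y < 1"
proof (cases "y = - e3")
  case True
  then have "inversion (- e3) 2 y $ 3 = - 1" by (simp add: inversion_def axis_def)
  then show ?thesis by (simp add: H3_def True)
next
  case False
  then have "y + e3 \<noteq> 0" by (simp add: eq_neg_iff_add_eq_0)
  then have "inversion (- e3) 2 y \<in> H3 \<longleftrightarrow> (norm y)\<^sup>2 < 1"
    by (simp add: H3_def cayley_nth[OF False] zero_less_divide_iff)
  then show ?thesis by (simp add: abs_square_less_1)
qed

text \<open>With \<open>norm y = tanh (d / 2)\<close> the right-hand side is
  \<open>4 * (sinh (d / 2))^2\<close>, so \<open>d\<close> is the hyperbolic distance of the image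
  from \<open>e3\<close>.\<close>

lemma cayley_delta:
  assumes "norm y < 1"
  shows "hyp_delta e3 (inversion (- e3) 2 y) = 4 * (norm y)\<^sup>2 / (1 - (norm y)\<^sup>2)"
proof -
  have ne: "y \<noteq> - e3" using assms by auto
  then have "y + e3 \<noteq> 0" by (simp add: eq_neg_iff_add_eq_0)
  define n where "n = (norm (y + e3))\<^sup>2"
  have n0: "n > 0" using \<open>y + e3 \<noteq> 0\<close> by (simp add: n_def)
  have n: "n = (norm y)\<^sup>2 + 2 * y $ 3 + 1"
    by (simp add: n_def power2_norm_eq_inner inner_add inner_axis inner_axis' algebra_simps)
  have e: "e3 - inversion (- e3) 2 y = 2 *\<^sub>R e3 - (2 / n) *\<^sub>R (y + e3)"
    by (simp add: inversion_def n_def scaleR_2)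
  have "(norm (2 *\<^sub>R e3 - a *\<^sub>R Z))\<^sup>2 = 4 - 4 * a * (e3 \<bullet> Z) + a\<^sup>2 * (norm Z)\<^sup>2" for a Z
    by (simp add: power2_norm_eq_inner inner_diff inner_commute) (simp add: power2_eq_square inner_axis' axis_def)
  from this[of "2 / n" "y + e3"] have "(dist e3 (inversion (- e3) 2 y))\<^sup>2 = 4 - 8 / n * (y $ 3 + 1) + (2 / n)\<^sup>2 * n"
    unfolding dist_norm e n_def[symmetric]
    by (simp add: inner_axis')
  also have "\<dots> = 4 * (n - 2 * (y $ 3 + 1) + 1) / n"
    using n0 by (simp add: field_simps power2_eq_square)
  also have "n - 2 * (y $ 3 + 1) + 1 = (norm y)\<^sup>2" by (simp add: n)
  finally have d: "(dist e3 (inversion (- e3) 2 y))\<^sup>2 = 4 * (norm y)\<^sup>2 / n" .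
  have "A / n / (e * (B / n)) = A / B" if "e = 1" for A B e using n0 that by simp
  then show ?thesis
    unfolding hyp_delta_def d cayley_nth[OF ne] n_def[symmetric] by (simp only: axis_nth)
qed

lemma sinh_borel [measurable]: "(sinh :: real \<Rightarrow> real) \<in> borel_measurable borel"
  by (intro borel_measurable_continuous_onI continuous_intros)

text \<open>The inversion \<open>inversion (- e3) 2\<close> exchanges the half-space and the unit ball, so that hyperbolic
  balls around \<open>e3\<close> become Euclidean balls around \<open>0\<close>.\<close>

lemma hyp_ball_volume:
  assumes R: "0 < R"
  shows "emeasure hyp_volume {x \<in> H3. hyp_dist e3 x < R} = (\<integral>\<^sup>+t. ennreal (4 * pi * (sinh t)\<^sup>2) * indicator {0..R} t \<partial>lborel)"
proof -
  define T where "T = tanh (R / 2)"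
  have T: "0 < T" "T < 1" using R by (auto simp: T_def tanh_real_lt_1)
  have [measurable]: "{x \<in> H3. hyp_dist e3 x < R} \<in> sets borel" by measurable
  let ?B = "{x \<in> H3. hyp_dist e3 x < R}" and ?g = "inversion (- e3) 2"
  have iff: "?g y \<in> ?B \<longleftrightarrow> norm y < T" for y
  proof (cases "norm y < 1")
    case True
    define n where "n = (norm y)\<^sup>2"
    have n1: "n < 1" "0 \<le> n" using True by (auto simp: n_def abs_square_less_1)
    have C: "(cosh (R / 2))\<^sup>2 = 1 + (sinh (R / 2))\<^sup>2" by (simp add: cosh_square_eq)
    have "cosh R = 1 + 2 * (sinh (R / 2))\<^sup>2"
      using cosh_double[of "R / 2"] C by simp
    then have "?g y \<in> ?B \<longleftrightarrow> 4 * n / (1 - n) < 4 * (sinh (R / 2))\<^sup>2"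
      using True R hyp_dist_less_iff_cosh[OF e3_H3, of "?g y" R]
      by (simp add: cayley_H3_iff cayley_delta n_def)
    also have "\<dots> \<longleftrightarrow> n * (cosh (R / 2))\<^sup>2 < (sinh (R / 2))\<^sup>2"
    proof -
      have "4 * s * (1 - n) - 4 * n = 4 * (s - n * (1 + s))" for s :: real by (simp add: algebra_simps)
      then have "4 * n < 4 * s * (1 - n) \<longleftrightarrow> n * (1 + s) < s" for s :: real by (smt (verit))
      then show ?thesis using n1 unfolding C by (simp add: pos_divide_less_eq)
    qed
    also have "\<dots> \<longleftrightarrow> n < T\<^sup>2"
      unfolding T_def tanh_def power_divide by (simp add: pos_less_divide_eq)
    also have "\<dots> \<longleftrightarrow> norm y < T"
      unfolding n_def using T power2_less_imp_less[of "norm y" T] power_strict_mono[of "norm y" T 2] by auto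
    finally show ?thesis .
  next
    case False
    then show ?thesis using T by (simp add: cayley_H3_iff)
  qed
  have "emeasure hyp_volume ?B = (\<integral>\<^sup>+x. indicator ?B x \<partial>hyp_volume)"
    by (subst nn_integral_indicator) auto
  also have "\<dots> = (\<integral>\<^sup>+x. ennreal (indicator H3 x / (x $ 3) ^ 3) * indicator ?B x \<partial>lborel)"
    by (rule nn_integral_hyp_volume) measurable
  also have "\<dots> = (\<integral>\<^sup>+y. ennreal ((2 / (norm (y - (- e3)))\<^sup>2)^3) * (ennreal (indicator H3 (?g y) / (?g y $ 3) ^ 3) * indicator ?B (?g y)) \<partial>lborel)"
    by (rule nn_integral_inversion) auto
  \<comment> \<open>\<open>8 / (1 - (norm y)^2)^3\<close> is the volume density of the ball
    model.\<close>
  also have "\<dots> = (\<integral>\<^sup>+y. ennreal (8 / (1 - (norm (y::real^3))\<^sup>2) ^ 3) * indicator {..<T} (norm y) \<partial>lborel)"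
  proof (rule nn_integral_cong)
    fix y :: "real^3"
    show "ennreal ((2 / (norm (y - (- e3)))\<^sup>2)^3) * (ennreal (indicator H3 (?g y) / (?g y $ 3) ^ 3) * indicator ?B (?g y)) =
      ennreal (8 / (1 - (norm y)\<^sup>2) ^ 3) * indicator {..<T} (norm y)"
    proof (cases "norm y < T")
      case True
      then have y1: "norm y < 1" using T by simp
      then have ne: "y \<noteq> - e3" by auto
      then have "y + e3 \<noteq> 0" by (simp add: eq_neg_iff_add_eq_0)
      then have n0: "(norm (y + e3))\<^sup>2 > 0" by simp
      have "(2 / n) ^ 3 * (1 / (b / n) ^ 3) = 8 / b ^ 3" if "n > 0" for n b :: real
        using that by (simp add: power_divide)
      from this[OF n0, of "1 - (norm y)\<^sup>2"]
      have "(2 / (norm (y - (- e3)))\<^sup>2)^3 * (indicator H3 (?g y) / (?g y $ 3) ^ 3) = 8 / (1 - (norm y)\<^sup>2) ^ 3"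
        using y1 unfolding cayley_nth[OF ne] by (simp add: cayley_H3_iff)
      then show ?thesis
        using True iff[of y] by (simp add: ennreal_mult'[symmetric])
    qed (use iff[of y] in simp)
  qed
  also have "\<dots> = (\<integral>\<^sup>+t. ennreal (4 * pi * t\<^sup>2) * indicator {0..} t * (ennreal (8 / (1 - t\<^sup>2) ^ 3) * indicator {..<T} t) \<partial>lborel)"
    by (rule nn_integral_norm) measurable
  also have "\<dots> = (\<integral>\<^sup>+t. ennreal (32 * pi * t\<^sup>2 / (1 - t\<^sup>2) ^ 3) * indicator {tanh (0 / 2)..tanh (R / 2)} t \<partial>lborel)"
  proof (rule nn_integral_cong_AE)
    show "AE t in lborel. ennreal (4 * pi * t\<^sup>2) * indicator {0..} t * (ennreal (8 / (1 - t\<^sup>2) ^ 3) * indicator {..<T} t) =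
      ennreal (32 * pi * t\<^sup>2 / (1 - t\<^sup>2) ^ 3) * indicator {tanh (0 / 2)..tanh (R / 2)} t"
      using AE_lborel_singleton[of T]
    proof eventually_elim
      case (elim t)
      have "ennreal (4 * pi * t\<^sup>2) * ennreal (8 / (1 - t\<^sup>2) ^ 3) = ennreal (32 * pi * t\<^sup>2 / (1 - t\<^sup>2) ^ 3)"
        by (subst ennreal_mult'[symmetric]) (auto simp: mult.assoc)
      then show ?case using elim by (auto simp: indicator_def T_def)
    qed
  qed
  also have "\<dots> = (\<integral>\<^sup>+t. ennreal (32 * pi * t\<^sup>2 / (1 - t\<^sup>2) ^ 3 * indicator {tanh (0 / 2)..tanh (R / 2)} t) \<partial>lborel)"
    by (intro nn_integral_cong) (auto simp: indicator_def)
  \<comment> \<open>Substitution \<open>t = tanh (x / 2)\<close>, which relates the Euclidean radius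
    \<open>t\<close> to the hyperbolic radius \<open>x\<close>.\<close>
  also have "\<dots> = (\<integral>\<^sup>+x. ennreal (32 * pi * (tanh (x / 2))\<^sup>2 / (1 - (tanh (x / 2))\<^sup>2) ^ 3 * ((1 - (tanh (x / 2))\<^sup>2) / 2) * indicator {0..R} x) \<partial>lborel)"
  proof (rule nn_integral_substitution)
    show "set_borel_measurable borel {tanh (0 / 2)..tanh (R / 2)} (\<lambda>t. 32 * pi * t\<^sup>2 / (1 - t\<^sup>2) ^ 3)"
      unfolding set_borel_measurable_def by measurable
    show "continuous_on {0..R} (\<lambda>x. (1 - (tanh (x / 2))\<^sup>2) / 2)"
      by (intro continuous_intros) auto
    show "0 \<le> (1 - (tanh (x / 2))\<^sup>2) / 2" for x :: real
      using tanh_real_abs[of "x/2"] tanh_real_lt_1[of "x / 2"] tanh_real_gt_neg1[of "x / 2"] by (simp add: abs_square_le_1)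
  qed (use R in \<open>auto intro!: derivative_eq_intros\<close>)
  also have "\<dots> = (\<integral>\<^sup>+t. ennreal (4 * pi * (sinh t)\<^sup>2) * indicator {0..R} t \<partial>lborel)"
  proof (rule nn_integral_cong)
    fix t :: real
    define S C where "S = sinh (t / 2)" and "C = cosh (t / 2)"
    have C: "C > 0" "C\<^sup>2 - S\<^sup>2 = 1" by (auto simp: C_def S_def cosh_square_eq)
    have "sinh t = 2 * S * C" using sinh_double[of "t / 2"] by (simp add: S_def C_def)
    moreover have "1 - (S / C)\<^sup>2 = 1 / C\<^sup>2"
    proof -
      have "1 - (S / C)\<^sup>2 = (C\<^sup>2 - S\<^sup>2) / C\<^sup>2" using C(1) by (simp add: power_divide diff_divide_distrib)
      then show ?thesis unfolding C(2) .
    qed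
    ultimately have "32 * pi * (S / C)\<^sup>2 / (1 - (S / C)\<^sup>2) ^ 3 * ((1 - (S / C)\<^sup>2) / 2) = 4 * pi * (sinh t)\<^sup>2"
      using C(1) by (simp add: power_divide power_mult_distrib power2_eq_square power3_eq_cube)
    then show "ennreal (32 * pi * (tanh (t / 2))\<^sup>2 / (1 - (tanh (t / 2))\<^sup>2) ^ 3 * ((1 - (tanh (t / 2))\<^sup>2) / 2) * indicator {0..R} t) =
      ennreal (4 * pi * (sinh t)\<^sup>2) * indicator {0..R} t"
      by (auto simp: tanh_def S_def C_def indicator_def)
  qed
  finally show ?thesis .
qed

lemma nn_integral_hyp_dist_e3:
  assumes [measurable]: "F \<in> borel_measurable borel"
  shows "(\<integral>\<^sup>+x. F (hyp_dist e3 x) \<partial>hyp_volume) = (\<integral>\<^sup>+t. ennreal (4 * pi * (sinh t)\<^sup>2) * indicator {0..} t * F t \<partial>lborel)"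
proof (rule nn_integral_radius)
  have [measurable]: "{x \<in> H3. hyp_dist e3 x < r} \<in> sets borel" for r by measurable
  have eq: "emeasure hyp_volume {x \<in> space hyp_volume. hyp_dist e3 x < r} = emeasure hyp_volume {x \<in> H3. hyp_dist e3 x < r}" for r
    by (rule emeasure_eq_AE) (use AE_hyp_volume_H3 in \<open>auto elim: eventually_mono\<close>)
  show *: "emeasure hyp_volume {x \<in> space hyp_volume. hyp_dist e3 x < r} = (\<integral>\<^sup>+t. ennreal (4 * pi * (sinh t)\<^sup>2) * indicator {0..r} t \<partial>lborel)"
    if "0 < r" for r
    unfolding eq by (rule hyp_ball_volume[OF that])
  show "emeasure hyp_volume {x \<in> space hyp_volume. hyp_dist e3 x < r} < \<infinity>" if "0 < r" for r
  proof -
    have "(\<integral>\<^sup>+t. ennreal (4 * pi * (sinh t)\<^sup>2) * indicator {0..r} t \<partial>lborel) \<le> (\<integral>\<^sup>+t. ennreal (4 * pi * (sinh r)\<^sup>2) * indicator {0..r} t \<partial>lborel)"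
      by (intro nn_integral_mono) (auto simp: indicator_def intro!: ennreal_leI mult_left_mono power_mono)
    also have "\<dots> < \<infinity>" using that by (simp add: nn_integral_cmult ennreal_mult_less_top)
    finally show ?thesis unfolding *[OF that] .
  qed
  show "AE x in hyp_volume. 0 \<le> hyp_dist e3 x"
    using AE_hyp_volume_H3 by eventually_elim (auto intro: hyp_dist_nonneg e3_H3)
qed (auto, measurable)

text \<open>The similarity \<open>A\<close>, whose ratio is the height of \<open>b\<close>, is a
  hyperbolic isometry that moves \<open>e3\<close> to \<open>b\<close>.\<close>

lemma nn_integral_hyp_dist:
  assumes b: "b \<in> H3" and [measurable]: "F \<in> borel_measurable borel"
  shows "(\<integral>\<^sup>+x. F (hyp_dist b x) \<partial>hyp_volume) = (\<integral>\<^sup>+t. ennreal (4 * pi * (sinh t)\<^sup>2) * indicator {0..} t * F t \<partial>lborel)"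
proof -
  let ?w = "\<lambda>x::real^3. ennreal (indicator H3 x / (x $ 3) ^ 3)"
  define s where "s = b $ 3"
  have s: "s > 0" using b by (simp add: s_def H3_def)
  define A where "A = (\<lambda>x. (b - s *\<^sub>R e3) + s *\<^sub>R x)"
  have [measurable]: "A \<in> borel_measurable borel" unfolding A_def by measurable
  have A3: "A x $ 3 = s * x $ 3" for x by (simp add: A_def s_def axis_def)
  have dist: "hyp_dist b (A x) = hyp_dist e3 x" for x
  proof -
    have "b - A x = s *\<^sub>R (e3 - x)" by (simp add: A_def algebra_simps)
    then have "dist b (A x) = s * dist e3 x" using s by (simp add: dist_norm)
    then show ?thesis using s by (simp add: hyp_dist_delta hyp_delta_def A3 s_def[symmetric] power_mult_distrib power2_eq_square axis_def)
  qed
  have "(\<integral>\<^sup>+x. F (hyp_dist b x) \<partial>hyp_volume) = (\<integral>\<^sup>+x. ?w x * F (hyp_dist b x) \<partial>lborel)"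
    by (rule nn_integral_hyp_volume) measurable
  also have "\<dots> = (\<integral>\<^sup>+x. ?w x * F (hyp_dist b x) \<partial>density (distr lborel borel A) (\<lambda>_. ennreal (\<bar>s\<bar> ^ DIM(real^3))))"
    using lborel_affine[of s "b - s *\<^sub>R e3"] s unfolding A_def by simp
  also have "\<dots> = (\<integral>\<^sup>+x. ennreal (s ^ 3) * (?w (A x) * F (hyp_dist b (A x))) \<partial>lborel)"
    using s by (subst nn_integral_density) (auto simp: nn_integral_distr)
  also have "\<dots> = (\<integral>\<^sup>+x. ?w x * F (hyp_dist e3 x) \<partial>lborel)"
  proof (rule nn_integral_cong)
    fix x
    have "s ^ 3 * (indicator H3 (A x) / (A x $ 3) ^ 3) = (indicator H3 x / (x $ 3) ^ 3 :: real)"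
      using s by (auto simp: indicator_def H3_def A3 zero_less_mult_iff power_mult_distrib)
    then have "ennreal (s ^ 3) * ?w (A x) = ?w x"
      using s by (subst ennreal_mult'[symmetric]) auto
    then show "ennreal (s ^ 3) * (?w (A x) * F (hyp_dist b (A x))) = ?w x * F (hyp_dist e3 x)"
      by (simp only: mult.assoc[symmetric] dist)
  qed
  also have "\<dots> = (\<integral>\<^sup>+x. F (hyp_dist e3 x) \<partial>hyp_volume)"
    by (rule nn_integral_hyp_volume[symmetric]) measurable
  also have "\<dots> = (\<integral>\<^sup>+t. ennreal (4 * pi * (sinh t)\<^sup>2) * indicator {0..} t * F t \<partial>lborel)"
    by (rule nn_integral_hyp_dist_e3) measurable
  finally show ?thesis .
qed

section \<open>Polarisation and radial rearrangement\<close>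

lemma hyp_dist_self [simp]: "hyp_dist x x = 0"
  by (simp add: hyp_dist_def)

text \<open>The balls are open so that, inside \<open>H3\<close>, the set where
  \<open>ball_sup \<eta> v\<close> exceeds \<open>t\<close> is a union of open balls, hence Borel,
  however irregular the bounded function \<open>v\<close> is. The value 0 outside \<open>H3\<close>
  is a convention on a null set of \<open>hyp_volume\<close>.\<close>

definition ball_sup :: "real \<Rightarrow> (real^3 \<Rightarrow> real) \<Rightarrow> real^3 \<Rightarrow> real"
  where "ball_sup \<eta> v x = (if x \<in> H3 then SUP y\<in>{y \<in> H3. hyp_dist x y < \<eta>}. v y else 0)"

lemma ball_sup_less_iff:
  assumes "x \<in> H3" "0 < \<eta>" and bd: "\<And>y. v y \<le> B"
  shows "t < ball_sup \<eta> v x \<longleftrightarrow> (\<exists>y\<in>H3. hyp_dist x y < \<eta> \<and> t < v y)"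
proof -
  have ne: "{y \<in> H3. hyp_dist x y < \<eta>} \<noteq> {}" using assms(1,2) by auto
  have "bdd_above (v ` {y \<in> H3. hyp_dist x y < \<eta>})" using bd by (intro bdd_aboveI2[where M = B])
  from less_cSUP_iff[OF ne this, of t] show ?thesis using assms(1) by (auto simp: ball_sup_def)
qed

lemma ball_sup_upper:
  assumes "x \<in> H3" "y \<in> H3" "hyp_dist x y < \<eta>" and bd: "\<And>y. v y \<le> B"
  shows "v y \<le> ball_sup \<eta> v x"
  using assms by (auto simp: ball_sup_def intro!: cSUP_upper bdd_aboveI2[where M = B])

lemma ball_sup_least:
  assumes "x \<in> H3" "0 < \<eta>" and "\<And>y. y \<in> H3 \<Longrightarrow> hyp_dist x y < \<eta> \<Longrightarrow> v y \<le> t"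
  shows "ball_sup \<eta> v x \<le> t"
proof -
  have "x \<in> {y \<in> H3. hyp_dist x y < \<eta>}" using assms by simp
  then show ?thesis using assms by (auto simp: ball_sup_def intro!: cSUP_least)
qed

lemma ball_sup_ge:
  assumes "x \<in> H3" "0 < \<eta>" and bd: "\<And>y. v y \<le> B"
  shows "v x \<le> ball_sup \<eta> v x"
  using assms by (intro ball_sup_upper[where B = B]) auto

lemma continuous_on_hyp_delta: "y \<in> H3 \<Longrightarrow> continuous_on H3 (\<lambda>x. hyp_delta x y)"
  unfolding hyp_delta_def by (intro continuous_intros) (auto simp: H3_def)

lemma open_hyp_ball: "y \<in> H3 \<Longrightarrow> 0 < \<eta> \<Longrightarrow> open {x \<in> H3. hyp_dist x y < \<eta>}"
proof -
  assume y: "y \<in> H3" "0 < \<eta>"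
  have "open (H3 \<inter> (\<lambda>x. hyp_delta x y) -` {..<2 * (cosh \<eta> - 1)})"
    using y by (intro continuous_open_preimage continuous_on_hyp_delta open_H3) auto
  also have "H3 \<inter> (\<lambda>x. hyp_delta x y) -` {..<2 * (cosh \<eta> - 1)} = {x \<in> H3. hyp_dist x y < \<eta>}"
    using y hyp_dist_less_iff_cosh[of _ y \<eta>] by auto
  finally show ?thesis .
qed

lemma ball_sup_borel:
  assumes \<eta>: "0 < \<eta>" and bd: "\<And>y. v y \<le> B"
  shows "ball_sup \<eta> v \<in> borel_measurable borel"
  unfolding borel_measurable_iff_greater
proof
  fix t
  let ?U = "\<Union>y\<in>{y \<in> H3. t < v y}. {x \<in> H3. hyp_dist x y < \<eta>}"
  have "open ?U" using \<eta> by (intro open_UN) (auto intro!: open_hyp_ball)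
  then have U: "?U \<in> sets borel" by (rule borel_open)
  have "{w \<in> space borel. t < ball_sup \<eta> v w} = ?U \<union> (if t < 0 then - H3 else {})"
    using ball_sup_less_iff[of _ \<eta> v B t, OF _ \<eta> bd] by (auto simp: ball_sup_def[of _ _ w for w])
  then show "{w \<in> space borel. t < ball_sup \<eta> v w} \<in> sets borel"
    using U by auto
qed

text \<open>The modulus of continuity is expressed by \<open>hyp_delta\<close>, which satisfies
  \<open>sqrt (hyp_delta x y) = 2 sinh (hyp_dist x y / 2)\<close> and is therefore invariant under reflections.\<close>

definition admissible :: "real^3 \<Rightarrow> real \<Rightarrow> real \<Rightarrow> real \<Rightarrow> (real^3 \<Rightarrow> real) \<Rightarrow> bool"
  where "admissible b R B L v \<longleftrightarrow>
    (\<forall>x. x \<notin> H3 \<longrightarrow> v x = 0) \<and> (\<forall>x\<in>H3. R \<le> hyp_dist x b \<longrightarrow> v x = 0) \<and>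
    (\<forall>x. 0 \<le> v x \<and> v x \<le> B) \<and> (\<forall>x\<in>H3. \<forall>y\<in>H3. \<bar>v x - v y\<bar> \<le> L * sqrt (hyp_delta x y))"

lemma hyp_modulus_continuous_on:
  assumes v: "\<And>x y. x \<in> H3 \<Longrightarrow> y \<in> H3 \<Longrightarrow> \<bar>v x - v y\<bar> \<le> L * sqrt (hyp_delta x y)"
  shows "continuous_on H3 v"
  unfolding continuous_on_def
proof
  fix x assume x: "x \<in> H3"
  have "continuous_on H3 (\<lambda>y. L * sqrt (hyp_delta y x))"
    using x by (intro continuous_intros continuous_on_hyp_delta)
  then have "((\<lambda>y. L * sqrt (hyp_delta y x)) \<longlongrightarrow> L * sqrt (hyp_delta x x)) (at x within H3)"
    using x unfolding continuous_on_def by blast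
  then have "((\<lambda>y. L * sqrt (hyp_delta y x)) \<longlongrightarrow> 0) (at x within H3)" by simp
  then have "((\<lambda>y. v y - v x) \<longlongrightarrow> 0) (at x within H3)"
    by (rule Lim_null_comparison[rotated]) (use v x in \<open>auto simp: eventually_at_filter\<close>)
  then show "(v \<longlongrightarrow> v x) (at x within H3)" by (simp add: LIM_zero_iff)
qed

lemma admissibleD:
  assumes "admissible b R B L v"
  shows "x \<notin> H3 \<Longrightarrow> v x = 0" "x \<in> H3 \<Longrightarrow> R \<le> hyp_dist x b \<Longrightarrow> v x = 0" "0 \<le> v x" "v x \<le> B"
    "x \<in> H3 \<Longrightarrow> y \<in> H3 \<Longrightarrow> \<bar>v x - v y\<bar> \<le> L * sqrt (hyp_delta x y)"
  using assms by (auto simp: admissible_def)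

lemma admissible_borel:
  assumes "admissible b R B L v"
  shows "v \<in> borel_measurable borel"
proof -
  have "continuous_on H3 v"
    using hyp_modulus_continuous_on admissibleD(5)[OF assms] by blast
  then have "(\<lambda>x. indicator H3 x *\<^sub>R v x) \<in> borel_measurable borel"
    by (rule borel_measurable_continuous_on_indicator[OF H3_borel])
  also have "(\<lambda>x. indicator H3 x *\<^sub>R v x) = v"
    using admissibleD(1)[OF assms] by (auto simp: fun_eq_iff indicator_def)
  finally show ?thesis .
qed

text \<open>If \<open>b\<close> lay on the mirror, every point would count as near and
  \<open>polarise v\<close> would be the maximum over both sides. With \<open>b\<close> off the
  mirror only mirror points are near together with their images, so each pair of values is merely
  reordered.\<close>

locale polarisation = hyp_reflection +
  fixes b :: "real^3"
  assumes b: "b \<in> H3" and off_mirror: "(norm (b - c))\<^sup>2 \<noteq> k"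
begin

definition polarise :: "(real^3 \<Rightarrow> real) \<Rightarrow> real^3 \<Rightarrow> real"
  where "polarise v x = (if near b x then max (v x) (v (\<sigma> x)) else min (v x) (v (\<sigma> x)))"

lemma near_both:
  assumes x: "x \<in> H3" and "near b x" "near b (\<sigma> x)"
  shows "\<sigma> x = x"
proof -
  have "hyp_dist x b \<le> hyp_dist (\<sigma> x) b" "hyp_dist (\<sigma> x) b \<le> hyp_dist x b"
    using assms by (auto simp: near_def)
  then have "hyp_delta (\<sigma> x) b - hyp_delta x b = 0"
    using x b by (simp add: hyp_dist_le_iff)
  then have "(norm (x - c))\<^sup>2 = k"
    unfolding hyp_delta_reflection_diff[OF x b] using x b k off_mirror by (auto simp: H3_def)
  then show ?thesis using k by (simp add: inversion_def)
qed

lemma polarise_pair: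
  assumes x: "x \<in> H3" and n: "near b x"
  shows "polarise v x = max (v x) (v (\<sigma> x))" "polarise v (\<sigma> x) = min (v x) (v (\<sigma> x))"
proof -
  show "polarise v x = max (v x) (v (\<sigma> x))" using n by (simp add: polarise_def)
  show "polarise v (\<sigma> x) = min (v x) (v (\<sigma> x))"
    using near_both[OF x n] x by (auto simp: polarise_def min.commute)
qed

lemma symmetric_wlog:
  assumes x: "x \<in> H3" and P: "\<And>x. x \<in> H3 \<Longrightarrow> near b x \<Longrightarrow> P x (\<sigma> x)"
    and sym: "\<And>x y. P x y \<Longrightarrow> P y x"
  shows "P x (\<sigma> x)"
proof (cases "near b x")
  case False
  have "P (\<sigma> x) (\<sigma> (\<sigma> x))" using x False by (intro P near_reflection reflection_H3 b)
  then show ?thesis using x sym by simp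
qed (use assms in blast)

lemma polarise_in: "polarise v x = v x \<or> polarise v x = v (\<sigma> x)"
  by (auto simp: polarise_def max_def min_def)

lemma near_borel [measurable]: "Measurable.pred borel (near b)"
proof -
  have "near b = (\<lambda>x. hyp_dist b x \<le> hyp_dist b (\<sigma> x))"
    by (auto simp: near_def hyp_dist_commute fun_eq_iff)
  then show ?thesis by simp
qed

lemma polarise_borel [measurable]:
  assumes [measurable]: "v \<in> borel_measurable borel"
  shows "polarise v \<in> borel_measurable borel"
  unfolding polarise_def by measurable

text \<open>On one side of the mirror \<open>max\<close> and \<open>min\<close> preserve the
  modulus. If the mirror separates \<open>x\<close> from \<open>y\<close>, then \<open>x\<close> and
  \<open>\<sigma> y\<close> are no farther apart than \<open>x\<close> and \<open>y\<close>, so all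
  four differences between the values at \<open>x\<close>, \<open>\<sigma> x\<close> and those at
  \<open>y\<close>, \<open>\<sigma> y\<close> obey the bound for \<open>x\<close>,
  \<open>y\<close>.\<close>

lemma admissible_polarise:
  assumes a: "admissible b R B L v" and L: "0 \<le> L"
  shows "admissible b R B L (polarise v)"
  unfolding admissible_def
proof (intro conjI allI ballI impI)
  note d = admissibleD[OF a]
  have off: "v (\<sigma> x) = 0" if "x \<notin> H3" for x
    using that d(1) reflection_H3_iff[of x] by (cases "x = c") (auto simp: inversion_def)
  show "polarise v x = 0" if "x \<notin> H3" for x
    using that d(1)[of x] off[of x] by (simp add: polarise_def)
  show "0 \<le> polarise v x" "polarise v x \<le> B" for x
    using polarise_in[of v x] d(3,4) by auto
  show "polarise v x = 0" if x: "x \<in> H3" and R: "R \<le> hyp_dist x b" for x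
  proof (cases "near b x")
    case True
    then have "R \<le> hyp_dist (\<sigma> x) b" using R by (simp add: near_def)
    then show ?thesis using x R d(2) by (simp add: polarise_def)
  qed (use d(2)[OF x R] d(3)[of "\<sigma> x"] in \<open>simp add: polarise_def\<close>)
  have mixed: "\<bar>polarise v x - polarise v y\<bar> \<le> L * sqrt (hyp_delta x y)"
    if x: "x \<in> H3" and y: "y \<in> H3" and n: "near b x" "\<not> near b y" for x y
  proof -
    have "hyp_dist x (\<sigma> y) \<le> hyp_dist x y" by (rule opposite_sides[OF b x y n])
    then have "hyp_delta x (\<sigma> y) \<le> hyp_delta x y" using x y by (simp add: hyp_dist_le_iff)
    then have le: "L * sqrt (hyp_delta x (\<sigma> y)) \<le> L * sqrt (hyp_delta x y)"
      using L by (intro mult_left_mono) auto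
    moreover have "hyp_delta (\<sigma> x) y = hyp_delta x (\<sigma> y)"
      using hyp_delta_reflection[of x "\<sigma> y"] x y by simp
    moreover have "\<bar>v x - v y\<bar> \<le> L * sqrt (hyp_delta x y)" "\<bar>v x - v (\<sigma> y)\<bar> \<le> L * sqrt (hyp_delta x (\<sigma> y))"
      "\<bar>v (\<sigma> x) - v y\<bar> \<le> L * sqrt (hyp_delta (\<sigma> x) y)" "\<bar>v (\<sigma> x) - v (\<sigma> y)\<bar> \<le> L * sqrt (hyp_delta x y)"
      using d(5)[of x y] d(5)[of x "\<sigma> y"] d(5)[of "\<sigma> x" y] d(5)[of "\<sigma> x" "\<sigma> y"] x y by auto
    ultimately show ?thesis
      using polarise_in[of v x] polarise_in[of v y] by auto
  qed
  show "\<bar>polarise v x - polarise v y\<bar> \<le> L * sqrt (hyp_delta x y)" if x: "x \<in> H3" and y: "y \<in> H3" for x y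
  proof (cases "near b x = near b y")
    case True
    have "\<bar>v x - v y\<bar> \<le> L * sqrt (hyp_delta x y)" "\<bar>v (\<sigma> x) - v (\<sigma> y)\<bar> \<le> L * sqrt (hyp_delta x y)"
      using d(5)[of x y] d(5)[of "\<sigma> x" "\<sigma> y"] x y by auto
    then show ?thesis using True by (auto simp: polarise_def)
  next
    case False
    then show ?thesis
      using mixed[OF x y] mixed[OF y x] by (auto simp: abs_minus_commute hyp_delta_commute)
  qed
qed

text \<open>The critical case is a near point \<open>y\<close> in the ball around a far point
  \<open>x\<close>. By \<open>opposite_sides\<close> the balls around \<open>x\<close> and around
  \<open>\<sigma> x\<close> then both contain \<open>y\<close> and \<open>\<sigma> y\<close>, so
  even the larger of the two values is at most the smaller supremum.\<close>

lemma ball_sup_polarise_le: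
  assumes x: "x \<in> H3" and \<eta>: "0 < \<eta>" and bd: "\<And>y. v y \<le> B"
  shows "ball_sup \<eta> (polarise v) x \<le> polarise (ball_sup \<eta> v) x"
proof (rule ball_sup_least[OF x \<eta>])
  fix y assume y: "y \<in> H3" and xy: "hyp_dist x y < \<eta>"
  have up: "v y \<le> ball_sup \<eta> v x" "v (\<sigma> y) \<le> ball_sup \<eta> v (\<sigma> x)"
    using ball_sup_upper[of x y \<eta> v B, OF x y xy bd] ball_sup_upper[of "\<sigma> x" "\<sigma> y" \<eta> v B] x y xy bd by auto
  show "polarise v y \<le> polarise (ball_sup \<eta> v) x"
  proof (cases "near b x")
    case True
    then show ?thesis using up polarise_in[of v y] by (auto simp: polarise_def[of "ball_sup \<eta> v"])
  next
    case nx: False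
    show ?thesis
    proof (cases "near b y")
      case True
      have "hyp_dist y (\<sigma> x) \<le> hyp_dist y x" by (rule opposite_sides[OF b y x True nx])
      then have "hyp_dist (\<sigma> x) y < \<eta>" "hyp_dist x (\<sigma> y) < \<eta>"
        using xy x y hyp_dist_reflection_swap[of x y] by (auto simp: hyp_dist_commute)
      then have "v y \<le> ball_sup \<eta> v (\<sigma> x)" "v (\<sigma> y) \<le> ball_sup \<eta> v x"
        using ball_sup_upper[of "\<sigma> x" y \<eta> v B] ball_sup_upper[of x "\<sigma> y" \<eta> v B] x y bd by auto
      then show ?thesis using up nx polarise_in[of v y] by (auto simp: polarise_def[of "ball_sup \<eta> v"])
    next
      case False
      then show ?thesis using up nx by (auto simp: polarise_def)
    qed
  qed
qed

text \<open>On a pair \<open>x\<close>, \<open>\<sigma> x\<close> the polarised values are the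
  sorted \<open>a\<close>, \<open>a'\<close>, and by \<open>ball_sup_polarise_le\<close> the
  polarised suprema are at most the sorted \<open>S\<close>, \<open>S'\<close>. Pairing suprema and
  values in the same order minimises the sum of the squared differences.\<close>

lemma ball_sup_energy_polarise:
  assumes \<eta>: "0 < \<eta>" and v [measurable]: "v \<in> borel_measurable borel" and bd: "\<And>y. 0 \<le> v y \<and> v y \<le> B"
  shows "(\<integral>\<^sup>+x. ennreal ((ball_sup \<eta> (polarise v) x - polarise v x)\<^sup>2) \<partial>hyp_volume)
       \<le> (\<integral>\<^sup>+x. ennreal ((ball_sup \<eta> v x - v x)\<^sup>2) \<partial>hyp_volume)"
proof (rule nn_integral_le_symmetrised)
  have bdP: "polarise v y \<le> B" for y using polarise_in[of v y] bd by auto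
  have [measurable]: "ball_sup \<eta> v \<in> borel_measurable borel" "ball_sup \<eta> (polarise v) \<in> borel_measurable borel"
    using bd bdP by (auto intro!: ball_sup_borel[OF \<eta>, where B = B])
  show "(\<lambda>x. ennreal ((ball_sup \<eta> (polarise v) x - polarise v x)\<^sup>2)) \<in> borel_measurable borel"
    "(\<lambda>x. ennreal ((ball_sup \<eta> v x - v x)\<^sup>2)) \<in> borel_measurable borel" by measurable
  let ?D = "\<lambda>x. (ball_sup \<eta> (polarise v) x - polarise v x)\<^sup>2" and ?E = "\<lambda>x. (ball_sup \<eta> v x - v x)\<^sup>2"
  have "?D x + ?D (\<sigma> x) \<le> ?E x + ?E (\<sigma> x)" if "x \<in> H3" for x
  proof (rule symmetric_wlog[OF that])
    fix x assume x: "x \<in> H3" and n: "near b x"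
    define S S' where "S = ball_sup \<eta> v x" and "S' = ball_sup \<eta> v (\<sigma> x)"
    define a a' where "a = v x" and "a' = v (\<sigma> x)"
    define T T' where "T = ball_sup \<eta> (polarise v) x" and "T' = ball_sup \<eta> (polarise v) (\<sigma> x)"
    have aS: "a \<le> S" "a' \<le> S'"
      unfolding a_def a'_def S_def S'_def using x bd by (auto intro!: ball_sup_ge[OF _ \<eta>, where B = B])
    have p: "polarise v x = max a a'" "polarise v (\<sigma> x) = min a a'"
      unfolding a_def a'_def by (rule polarise_pair[OF x n])+
    have "max a a' \<le> T" "min a a' \<le> T'"
      unfolding p[symmetric] T_def T'_def using x bdP by (auto intro!: ball_sup_ge[OF _ \<eta>, where B = B])
    moreover have "T \<le> max S S'" "T' \<le> min S S'"
      using ball_sup_polarise_le[OF x \<eta>, of v B] ball_sup_polarise_le[OF reflection_H3[OF x] \<eta>, of v B] bd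
      unfolding polarise_pair[OF x n] T_def T'_def S_def S'_def by auto
    ultimately have "(T - max a a')\<^sup>2 \<le> (max S S' - max a a')\<^sup>2" "(T' - min a a')\<^sup>2 \<le> (min S S' - min a a')\<^sup>2"
      by (auto intro!: power_mono)
    moreover have "(max S S' - max a a')\<^sup>2 + (min S S' - min a a')\<^sup>2 \<le> (S - a)\<^sup>2 + (S' - a')\<^sup>2"
    proof -
      \<comment> \<open>Exchanging \<open>a\<close> and \<open>a'\<close> changes the sum by
        \<open>2 * ((S - S') * (a - a'))\<close>, which decides the best pairing.\<close>
      have "(S - a')\<^sup>2 + (S' - a)\<^sup>2 = (S - a)\<^sup>2 + (S' - a')\<^sup>2 + 2 * ((S - S') * (a - a'))"
        by (simp add: power2_eq_square algebra_simps)
      moreover have "(S - S') * (a - a') \<le> 0" if "S \<le> S' \<and> a' \<le> a \<or> S' \<le> S \<and> a \<le> a'"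
        using that by (auto simp: mult_le_0_iff)
      ultimately show ?thesis by (cases "S \<le> S'"; cases "a \<le> a'") (auto simp: max_def min_def)
    qed
    ultimately show "?D x + ?D (\<sigma> x) \<le> ?E x + ?E (\<sigma> x)"
      unfolding p S_def[symmetric] S'_def[symmetric] a_def[symmetric] a'_def[symmetric] T_def[symmetric] T'_def[symmetric] by linarith
  qed (simp add: add.commute)
  then show "AE x in hyp_volume. ennreal (?D x) + ennreal (?D (\<sigma> x)) \<le> ennreal (?E x) + ennreal (?E (\<sigma> x))"
    using AE_hyp_volume_H3 by (auto elim!: eventually_mono simp flip: ennreal_plus intro!: ennreal_leI)
qed

lemma AE_hyp_volume_neq: "AE x in hyp_volume. x \<noteq> a"
  unfolding hyp_volume_def by (subst AE_density) (use AE_lborel_singleton[of a] in \<open>auto elim: eventually_mono\<close>)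

text \<open>Polarisation puts the larger of two values at the nearer point, where the weight is
  larger. The point \<open>b\<close> is exempted from the monotonicity of \<open>g\<close> because
  \<open>0 powr a = 0\<close>: the weight of the theorem has the value 0 at \<open>b\<close>,
  although for \<open>p < 6\<close> it is unbounded nearby.\<close>

lemma weighted_polarise_le:
  fixes g :: "real^3 \<Rightarrow> real" and \<phi> :: "real \<Rightarrow> real"
  assumes [measurable]: "v \<in> borel_measurable borel" "g \<in> borel_measurable borel" "\<phi> \<in> borel_measurable borel"
    and v0: "\<And>x. 0 \<le> v x" and g0: "\<And>x. 0 \<le> g x" and \<phi>: "\<And>s t. 0 \<le> s \<Longrightarrow> s \<le> t \<Longrightarrow> \<phi> s \<le> \<phi> t" "0 \<le> \<phi> 0"
    and g: "\<And>x y. x \<in> H3 \<Longrightarrow> y \<in> H3 \<Longrightarrow> x \<noteq> b \<Longrightarrow> hyp_dist x b \<le> hyp_dist y b \<Longrightarrow> g y \<le> g x"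
  shows "(\<integral>\<^sup>+x. ennreal (g x * \<phi> (v x)) \<partial>hyp_volume) \<le> (\<integral>\<^sup>+x. ennreal (g x * \<phi> (polarise v x)) \<partial>hyp_volume)"
proof (rule nn_integral_le_symmetrised)
  let ?D = "\<lambda>x. g x * \<phi> (v x)" and ?E = "\<lambda>x. g x * \<phi> (polarise v x)"
  have *: "x \<noteq> b \<longrightarrow> \<sigma> x \<noteq> b \<longrightarrow> ?D x + ?D (\<sigma> x) \<le> ?E x + ?E (\<sigma> x)" if "x \<in> H3" for x
  proof (rule symmetric_wlog[OF that])
    fix x assume x: "x \<in> H3" and n: "near b x"
    show "x \<noteq> b \<longrightarrow> \<sigma> x \<noteq> b \<longrightarrow> ?D x + ?D (\<sigma> x) \<le> ?E x + ?E (\<sigma> x)"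
    proof (intro impI)
      assume "x \<noteq> b"
      then have gg: "g (\<sigma> x) \<le> g x" using n x by (intro g) (auto simp: near_def)
      show "?D x + ?D (\<sigma> x) \<le> ?E x + ?E (\<sigma> x)"
      proof (cases "v x \<le> v (\<sigma> x)")
        case True
        then have "\<phi> (v x) \<le> \<phi> (v (\<sigma> x))" using v0 by (intro \<phi>)
        then have "0 \<le> (g x - g (\<sigma> x)) * (\<phi> (v (\<sigma> x)) - \<phi> (v x))" using gg by simp
        then show ?thesis unfolding polarise_pair[OF x n] using True by (simp add: algebra_simps)
      qed (simp add: polarise_pair[OF x n])
    qed
  qed auto
  have pos: "0 \<le> \<phi> t" if "0 \<le> t" for t using \<phi>(1)[of 0 t] \<phi>(2) that by simp
  have P0: "0 \<le> polarise v x" for x using polarise_in[of v x] v0 by auto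
  have "x = \<sigma> b" if "\<sigma> x = b" "x \<in> H3" for x using that by (metis reflection_reflection)
  then have "?D x + ?D (\<sigma> x) \<le> ?E x + ?E (\<sigma> x)" if "x \<in> H3" "x \<noteq> b" "x \<noteq> \<sigma> b" for x
    using * that by blast
  note le = this
  show "AE x in hyp_volume. ennreal (?D x) + ennreal (?D (\<sigma> x)) \<le> ennreal (?E x) + ennreal (?E (\<sigma> x))"
    using AE_hyp_volume_H3 AE_hyp_volume_neq[of b] AE_hyp_volume_neq[of "\<sigma> b"]
  proof eventually_elim
    case (elim x)
    then have "?D x + ?D (\<sigma> x) \<le> ?E x + ?E (\<sigma> x)" by (rule le)
    moreover have "0 \<le> ?D x" "0 \<le> ?D (\<sigma> x)" "0 \<le> ?E x" "0 \<le> ?E (\<sigma> x)"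
      by (intro mult_nonneg_nonneg pos g0 v0 P0)+
    ultimately show ?case by (simp only: ennreal_plus[symmetric] ennreal_leI)
  qed
qed measurable

end

text \<open>A hyperbolic ball is a Euclidean ball: the condition becomes
  \<open>(dist x b)^2 \<le> q * x $ 3\<close>. It keeps away from the boundary plane by itself,
  since a point with \<open>x $ 3 = 0\<close> would have to be \<open>b\<close>.\<close>

lemma compact_hyp_cball:
  assumes b: "b \<in> H3" and R: "0 < R"
  shows "compact {x \<in> H3. hyp_dist x b \<le> R}"
proof -
  define q where "q = 2 * (cosh R - 1) * b $ 3"
  have c: "1 < cosh R" using R cosh_real_nonneg_less_iff[of 0 R] by simp
  have b3: "b $ 3 > 0" using b by (simp add: H3_def)
  have q: "q > 0" using c b3 by (simp add: q_def)
  have eq: "{x \<in> H3. hyp_dist x b \<le> R} = {x. (dist x b)\<^sup>2 \<le> q * x $ 3}" (is "_ = ?S")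
  proof (intro equalityI subsetI)
    fix x assume "x \<in> {x \<in> H3. hyp_dist x b \<le> R}"
    then have x: "x \<in> H3" "hyp_dist x b \<le> R" by auto
    then have "cosh (hyp_dist x b) \<le> cosh R"
      using b R by (simp add: cosh_real_nonneg_le_iff hyp_dist_nonneg)
    then have "hyp_delta x b \<le> 2 * (cosh R - 1)" using x b by (simp add: cosh_hyp_dist)
    then show "x \<in> ?S"
      using x(1) b3 by (simp add: hyp_delta_def pos_divide_le_eq H3_def q_def mult_ac)
  next
    fix x assume x: "x \<in> ?S"
    then have "0 \<le> q * x $ 3" using zero_le_power2 order_trans by blast
    then have "0 \<le> x $ 3" using q by (simp add: zero_le_mult_iff)
    moreover have "x $ 3 \<noteq> 0"
    proof
      assume "x $ 3 = 0"
      then have "(dist x b)\<^sup>2 \<le> 0" using x by simp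
      then show False using \<open>x $ 3 = 0\<close> b3 by simp
    qed
    ultimately have xH: "x \<in> H3" by (simp add: H3_def)
    then have "hyp_delta x b \<le> 2 * (cosh R - 1)"
      using x b3 by (simp add: hyp_delta_def pos_divide_le_eq H3_def q_def mult_ac)
    then have "cosh (hyp_dist x b) \<le> cosh R" using xH b by (simp add: cosh_hyp_dist)
    then show "x \<in> {x \<in> H3. hyp_dist x b \<le> R}"
      using b R xH by (simp add: cosh_real_nonneg_le_iff hyp_dist_nonneg)
  qed
  have "closed ?S" by (intro closed_Collect_le continuous_intros)
  moreover have "bounded ?S"
  proof (rule boundedI)
    fix x assume "x \<in> ?S"
    then have le: "(dist x b)\<^sup>2 \<le> q * x $ 3" by simp
    have "x $ 3 \<le> dist x b + b $ 3"
      using component_le_norm_cart[of "x - b" 3] by (simp add: dist_norm)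
    then have "(dist x b)\<^sup>2 \<le> q * (dist x b + b $ 3)" using le q by (smt (verit) mult_left_mono)
    have "dist x b \<le> q + b $ 3"
    proof (rule ccontr)
      assume "\<not> dist x b \<le> q + b $ 3"
      then have d: "dist x b > q + b $ 3" by simp
      then have "(q + b $ 3) * dist x b < (dist x b)\<^sup>2"
        using q b3 unfolding power2_eq_square by (intro mult_strict_right_mono) auto
      moreover have "q * b $ 3 \<le> b $ 3 * dist x b" using d b3 q by (simp add: mult.commute)
      ultimately show False using \<open>(dist x b)\<^sup>2 \<le> q * (dist x b + b $ 3)\<close> by (simp add: algebra_simps)
    qed
    then show "norm x \<le> q + b $ 3 + norm b"
      using norm_triangle_ineq2[of x b] by (simp add: dist_norm)
  qed
  ultimately show ?thesis unfolding eq by (simp add: compact_eq_bounded_closed)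
qed

text \<open>Supplies the integrable majorants: a weight that is singular at \<open>b\<close> is
  compensated by the factor \<open>(sinh t)^2\<close> of polar coordinates.\<close>

lemma nn_integral_radial_finite:
  assumes b: "b \<in> H3" and R: "0 < R" and [measurable]: "G \<in> borel_measurable borel"
    and bd: "\<And>t. 0 \<le> t \<Longrightarrow> t \<le> R \<Longrightarrow> (sinh t)\<^sup>2 * G t \<le> a" and a: "0 \<le> a"
  shows "(\<integral>\<^sup>+x. ennreal (G (hyp_dist b x)) * indicator {..R} (hyp_dist b x) \<partial>hyp_volume) < \<infinity>"
proof -
  have "(\<integral>\<^sup>+x. ennreal (G (hyp_dist b x)) * indicator {..R} (hyp_dist b x) \<partial>hyp_volume) =
    (\<integral>\<^sup>+t. ennreal (4 * pi * (sinh t)\<^sup>2) * indicator {0..} t * (ennreal (G t) * indicator {..R} t) \<partial>lborel)"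
    by (rule nn_integral_hyp_dist[OF b]) measurable
  also have "\<dots> \<le> (\<integral>\<^sup>+t. ennreal (4 * pi * a) * indicator {0..R} t \<partial>lborel)"
  proof (intro nn_integral_mono)
    fix t :: real
    have "ennreal (4 * pi * (sinh t)\<^sup>2) * ennreal (G t) \<le> ennreal (4 * pi * a)" if "0 \<le> t" "t \<le> R"
    proof -
      have "4 * pi * ((sinh t)\<^sup>2 * G t) \<le> 4 * pi * a" using bd[OF that] by (intro mult_left_mono) auto
      then show ?thesis by (subst ennreal_mult'[symmetric]) (auto intro!: ennreal_leI simp: mult.assoc)
    qed
    then show "ennreal (4 * pi * (sinh t)\<^sup>2) * indicator {0..} t * (ennreal (G t) * indicator {..R} t) \<le> ennreal (4 * pi * a) * indicator {0..R} t"
      by (auto simp: indicator_def)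
  qed
  also have "\<dots> < \<infinity>" using R by (simp add: nn_integral_cmult ennreal_mult_less_top)
  finally show ?thesis .
qed

lemma ennreal_indicator_mult: "ennreal (a * indicator A x) = ennreal a * indicator A x"
  by (simp add: indicator_def)

lemma nn_integral_ge_limit:
  fixes u :: "nat \<Rightarrow> 'a \<Rightarrow> ennreal"
  assumes "\<And>i. u i \<in> borel_measurable M" "u' \<in> borel_measurable M" "w \<in> borel_measurable M"
    and "\<And>j. AE x in M. u j x \<le> w x" "(\<integral>\<^sup>+x. w x \<partial>M) < \<infinity>" "AE x in M. (\<lambda>i. u i x) \<longlonglongrightarrow> u' x"
    and "\<And>i. C \<le> (\<integral>\<^sup>+x. u i x \<partial>M)"
  shows "C \<le> (\<integral>\<^sup>+x. u' x \<partial>M)"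
  by (rule LIMSEQ_le_const[OF nn_integral_dominated_convergence[OF assms(1-6)]]) (use assms(7) in auto)

lemma ball_sup_uniform_limit:
  assumes \<eta>: "0 < \<eta>" and x: "x \<in> H3" and bd: "\<And>n y. u n y \<le> B" "\<And>y. v y \<le> B"
    and unif: "\<And>e. 0 < e \<Longrightarrow> \<exists>N. \<forall>n\<ge>N. \<forall>y. \<bar>u n y - v y\<bar> < e"
  shows "(\<lambda>n. ball_sup \<eta> (u n) x) \<longlonglongrightarrow> ball_sup \<eta> v x"
proof (rule LIMSEQ_I)
  fix e :: real assume "0 < e"
  then obtain N where N: "\<And>n y. n \<ge> N \<Longrightarrow> \<bar>u n y - v y\<bar> < e / 2"
    using unif[of "e / 2"] by auto
  have "norm (ball_sup \<eta> (u n) x - ball_sup \<eta> v x) < e" if "n \<ge> N" for n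
  proof -
    have "ball_sup \<eta> (u n) x \<le> ball_sup \<eta> v x + e / 2"
    proof (rule ball_sup_least[OF x \<eta>])
      fix y assume "y \<in> H3" "hyp_dist x y < \<eta>"
      then have "v y \<le> ball_sup \<eta> v x" by (rule ball_sup_upper[OF x _ _ bd(2)])
      then show "u n y \<le> ball_sup \<eta> v x + e / 2" using N[OF that, of y] by linarith
    qed
    moreover have "ball_sup \<eta> v x \<le> ball_sup \<eta> (u n) x + e / 2"
    proof (rule ball_sup_least[OF x \<eta>])
      fix y assume "y \<in> H3" "hyp_dist x y < \<eta>"
      then have "u n y \<le> ball_sup \<eta> (u n) x" by (rule ball_sup_upper[OF x _ _ bd(1)])
      then show "v y \<le> ball_sup \<eta> (u n) x + e / 2" using N[OF that, of y] by linarith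
    qed
    ultimately show ?thesis using \<open>0 < e\<close> by (simp add: abs_less_iff)
  qed
  then show "\<exists>N. \<forall>n\<ge>N. norm (ball_sup \<eta> (u n) x - ball_sup \<eta> v x) < e" by blast
qed

lemma open_less_H3:
  fixes f g :: "real^3 \<Rightarrow> real"
  assumes "continuous_on H3 f" "continuous_on H3 g"
  shows "open {x \<in> H3. f x < g x}"
proof -
  have "open (H3 \<inter> (\<lambda>x. g x - f x) -` {0<..})"
    by (intro continuous_open_preimage continuous_intros assms open_H3)
  also have "H3 \<inter> (\<lambda>x. g x - f x) -` {0<..} = {x \<in> H3. f x < g x}" by auto
  finally show ?thesis .
qed

lemma not_AE_hyp_volume_open:
  assumes U: "open U" "U \<subseteq> H3" "x \<in> U"
  shows "\<not> (AE z in hyp_volume. z \<notin> U)"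
proof
  assume "AE z in hyp_volume. z \<notin> U"
  then have "AE z in lborel. 0 < ennreal (indicator H3 z / (z $ 3) ^ 3) \<longrightarrow> z \<notin> U"
    unfolding hyp_volume_def by (subst (asm) AE_density) simp_all
  then have "AE z in lborel. z \<notin> U"
    by eventually_elim (use U(2) in \<open>auto simp: H3_def indicator_def\<close>)
  then have "U \<in> null_sets lborel"
    using U(1) by (simp add: AE_iff_null_sets borel_open)
  then have "negligible U" using negligible_iff_null_sets null_sets_completionI by blast
  then show False using open_not_negligible[OF U(1)] U(3) by auto
qed

context hyp_reflection
begin

lemma continuous_on_reflection: "continuous_on H3 \<sigma>"
  unfolding inversion_def using neq_centre by (intro continuous_intros) auto

end

text \<open>The reflection is chosen to exchange the nearer point \<open>x\<close> with a farther
  point where \<open>v\<close> is larger. Polarisation then swaps the values around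
  \<open>x\<close>, on an open set, and the weight \<open>exp (- hyp_delta b z)\<close> is strictly
  decreasing in the distance; both are needed for the strict inequality.\<close>

lemma polarisation_increases:
  assumes b: "b \<in> H3" and a: "admissible b R B L v"
    and x: "x \<in> H3" and y: "y \<in> H3" and d: "hyp_dist x b < hyp_dist y b" and lt: "v x < v y"
    and fin: "(\<integral>\<^sup>+z. ennreal (exp (- hyp_delta b z) * v z) \<partial>hyp_volume) < \<infinity>"
  obtains c k where "polarisation c k b"
    "(\<integral>\<^sup>+z. ennreal (exp (- hyp_delta b z) * v z) \<partial>hyp_volume) <
     (\<integral>\<^sup>+z. ennreal (exp (- hyp_delta b z) * polarisation.polarise c k b v z) \<partial>hyp_volume)"
proof -
  have cv: "continuous_on H3 v"
    using hyp_modulus_continuous_on admissibleD(5)[OF a] by blast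
  have cd: "continuous_on H3 (\<lambda>z. hyp_delta z b)" by (rule continuous_on_hyp_delta[OF b])
  \<comment> \<open>Both strict inequalities are open conditions, so \<open>y\<close> may be raised
    a little when it has the same height as \<open>x\<close>, as \<open>exists_reflection\<close>
    requires.\<close>
  define U where "U = {z \<in> H3. hyp_delta x b < hyp_delta z b} \<inter> {z \<in> H3. v x < v z}"
  have "open U" unfolding U_def by (intro open_Int open_less_H3 continuous_intros cv cd)
  moreover have "y \<in> U" using x y d lt b by (simp add: U_def hyp_dist_less_iff)
  ultimately obtain e where e: "0 < e" "ball y e \<subseteq> U" by (meson open_contains_ball_eq)
  define y' where "y' = (if y $ 3 = x $ 3 then y + (e / 2) *\<^sub>R axis 3 1 else y)"
  have "y' \<in> ball y e" using e by (auto simp: y'_def dist_norm)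
  then have y'U: "y' \<in> U" using e by blast
  have ne: "x $ 3 \<noteq> y' $ 3" using e by (auto simp: y'_def axis_def)
  have y': "y' \<in> H3" "hyp_delta x b < hyp_delta y' b" "v x < v y'" using y'U by (auto simp: U_def)
  obtain c k where ck: "hyp_reflection c k" and xy: "inversion c k x = y'"
    using exists_reflection[OF x y'(1) ne] by blast
  interpret hyp_reflection c k by (rule ck)
  \<comment> \<open>The distances of \<open>x\<close> and of its image from \<open>b\<close> differ,
    so \<open>b\<close> is off the mirror.\<close>
  have "hyp_delta (\<sigma> x) b - hyp_delta x b \<noteq> 0" using y' by (simp add: xy)
  then have "(norm (b - c))\<^sup>2 \<noteq> k" unfolding hyp_delta_reflection_diff[OF x b] by auto
  then interpret polarisation c k b using b by unfold_locales
  define W where "W = {z \<in> H3. hyp_delta z b < hyp_delta (\<sigma> z) b} \<inter> {z \<in> H3. v z < v (\<sigma> z)}"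
  have cs: "continuous_on H3 (\<lambda>z. v (\<sigma> z))" "continuous_on H3 (\<lambda>z. hyp_delta (\<sigma> z) b)"
    by (rule continuous_on_compose2[OF cv continuous_on_reflection], force,
        rule continuous_on_compose2[OF cd continuous_on_reflection], force)
  have "open W" unfolding W_def by (intro open_Int open_less_H3 cv cd cs)
  have W: "W \<subseteq> H3" "x \<in> W" using x y' by (auto simp: W_def xy)
  have [measurable]: "v \<in> borel_measurable borel" by (rule admissible_borel[OF a])
  let ?g = "\<lambda>z. exp (- hyp_delta b z)"
  let ?F = "\<lambda>z. ennreal (?g z * v z)" and ?G = "\<lambda>z. ennreal (?g z * polarise v z)"
  have v0: "0 \<le> v z" for z using admissibleD(3)[OF a] .
  have p0: "0 \<le> polarise v z" for z using polarise_in[of v z] v0 by auto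
  have sum: "?F z + ?F (\<sigma> z) = ennreal (?g z * v z + ?g (\<sigma> z) * v (\<sigma> z))"
    "?G z + ?G (\<sigma> z) = ennreal (?g z * polarise v z + ?g (\<sigma> z) * polarise v (\<sigma> z))" for z
    using v0 p0 by (auto simp: ennreal_plus[symmetric] simp del: ennreal_plus)
  have le: "?g z * v z + ?g (\<sigma> z) * v (\<sigma> z) \<le> ?g z * polarise v z + ?g (\<sigma> z) * polarise v (\<sigma> z)"
    if "z \<in> H3" for z
  proof (rule symmetric_wlog[OF that])
    fix x assume x: "x \<in> H3" and n: "near b x"
    then have "hyp_delta x b \<le> hyp_delta (\<sigma> x) b" using b by (simp add: near_def hyp_dist_le_iff)
    then have g: "?g (\<sigma> x) \<le> ?g x" by (simp add: hyp_delta_commute)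
    show "?g x * v x + ?g (\<sigma> x) * v (\<sigma> x) \<le> ?g x * polarise v x + ?g (\<sigma> x) * polarise v (\<sigma> x)"
    proof (cases "v x \<le> v (\<sigma> x)")
      case True
      then have "0 \<le> (?g x - ?g (\<sigma> x)) * (v (\<sigma> x) - v x)" using g by simp
      then show ?thesis unfolding polarise_pair[OF x n] using True by (simp add: algebra_simps)
    qed (simp add: polarise_pair[OF x n])
  qed auto
  have lt: "?g z * v z + ?g (\<sigma> z) * v (\<sigma> z) < ?g z * polarise v z + ?g (\<sigma> z) * polarise v (\<sigma> z)"
    if z: "z \<in> W" for z
  proof -
    have zH: "z \<in> H3" and zd: "hyp_delta z b < hyp_delta (\<sigma> z) b" "v z < v (\<sigma> z)" using z by (auto simp: W_def)
    then have n: "near b z" using b by (simp add: near_def hyp_dist_le_iff)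
    have "0 < (?g z - ?g (\<sigma> z)) * (v (\<sigma> z) - v z)" using zd by (intro mult_pos_pos) (auto simp: hyp_delta_commute)
    then show ?thesis unfolding polarise_pair[OF zH n] using zd by (simp add: algebra_simps)
  qed
  have "(\<integral>\<^sup>+z. ?F z + ?F (\<sigma> z) \<partial>hyp_volume) < (\<integral>\<^sup>+z. ?G z + ?G (\<sigma> z) \<partial>hyp_volume)"
  proof (rule nn_integral_less)
    show "(\<integral>\<^sup>+z. ?F z + ?F (\<sigma> z) \<partial>hyp_volume) \<noteq> \<infinity>"
      by (subst nn_integral_symmetrise) (use fin in \<open>auto simp: ennreal_mult_eq_top_iff\<close>)
    show "AE z in hyp_volume. ?F z + ?F (\<sigma> z) \<le> ?G z + ?G (\<sigma> z)"
      unfolding sum using AE_hyp_volume_H3 by eventually_elim (auto intro!: ennreal_leI le)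
    show "\<not> (AE z in hyp_volume. ?G z + ?G (\<sigma> z) \<le> ?F z + ?F (\<sigma> z))"
    proof
      assume "AE z in hyp_volume. ?G z + ?G (\<sigma> z) \<le> ?F z + ?F (\<sigma> z)"
      then have "AE z in hyp_volume. z \<notin> W"
      proof eventually_elim
        case (elim z)
        show ?case
        proof
          assume "z \<in> W"
          have "0 \<le> ?g z * v z + ?g (\<sigma> z) * v (\<sigma> z)" using v0 by simp
          then show False using lt[OF \<open>z \<in> W\<close>] elim unfolding sum by (simp add: ennreal_le_iff)
        qed
      qed
      then show False using not_AE_hyp_volume_open[OF \<open>open W\<close> W] by blast
    qed
  qed measurable
  then have "2 * (\<integral>\<^sup>+z. ?F z \<partial>hyp_volume) < 2 * (\<integral>\<^sup>+z. ?G z \<partial>hyp_volume)"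
    by (subst (asm) (1 2) nn_integral_symmetrise) auto
  then have "(\<integral>\<^sup>+z. ?F z \<partial>hyp_volume) < (\<integral>\<^sup>+z. ?G z \<partial>hyp_volume)"
    using mult_left_mono[of "integral\<^sup>N hyp_volume ?G" "integral\<^sup>N hyp_volume ?F" 2] by (simp add: not_le[symmetric]) blast
  then show thesis using that polarisation_axioms by blast
qed

text \<open>The class \<open>C\<close> records the comparisons with \<open>v0\<close> as
  inequalities. In this form they survive both polarisation and uniform limits, and the maximiser
  inherits them simply by belonging to \<open>C\<close>.\<close>

lemma radial_rearrangement:
  assumes b: "b \<in> H3" and \<eta>: "0 < \<eta>" and p: "2 < p" "p \<le> 6" and R: "0 < R" and L: "0 \<le> L"
    and a0: "admissible b R B L v0"
  obtains v where "admissible b R B L v"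
    "(\<integral>\<^sup>+x. ennreal ((v0 x)\<^sup>2) \<partial>hyp_volume) \<le> (\<integral>\<^sup>+x. ennreal ((v x)\<^sup>2) \<partial>hyp_volume)"
    "(\<integral>\<^sup>+x. ennreal (sinh (hyp_dist b x) powr ((p - 6) / 2) * v0 x powr p) \<partial>hyp_volume) \<le>
     (\<integral>\<^sup>+x. ennreal (sinh (hyp_dist b x) powr ((p - 6) / 2) * v x powr p) \<partial>hyp_volume)"
    "(\<integral>\<^sup>+x. ennreal ((ball_sup \<eta> v x - v x)\<^sup>2) \<partial>hyp_volume) \<le>
     (\<integral>\<^sup>+x. ennreal ((ball_sup \<eta> v0 x - v0 x)\<^sup>2) \<partial>hyp_volume)"
    "\<And>x y. x \<in> H3 \<Longrightarrow> y \<in> H3 \<Longrightarrow> hyp_dist x b < hyp_dist y b \<Longrightarrow> v y \<le> v x"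
proof -
  define sq where "sq = (\<lambda>v. \<integral>\<^sup>+x. ennreal ((v x)\<^sup>2) \<partial>hyp_volume)"
  define wt where "wt = (\<lambda>v. \<integral>\<^sup>+x. ennreal (sinh (hyp_dist b x) powr ((p - 6) / 2) * v x powr p) \<partial>hyp_volume)"
  define en where "en = (\<lambda>v. \<integral>\<^sup>+x. ennreal ((ball_sup \<eta> v x - v x)\<^sup>2) \<partial>hyp_volume)"
  define J where "J = (\<lambda>v. \<integral>\<^sup>+x. ennreal (exp (- hyp_delta b x) * v x) \<partial>hyp_volume)"
  define C where "C = {v. admissible b R B L v \<and> sq v0 \<le> sq v \<and> wt v0 \<le> wt v \<and> en v \<le> en v0}"
  have v0C: "v0 \<in> C" using a0 by (simp add: C_def)
  have B: "0 \<le> B" using admissibleD(3,4)[OF a0] order_trans by blast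
  define K where "K = {x \<in> H3. hyp_dist x b \<le> R}"
  have K: "compact K" unfolding K_def by (rule compact_hyp_cball[OF b R])
  have offK: "v x = 0" if "admissible b R B L v" "x \<notin> K" for v x
    using admissibleD(1,2)[OF that(1), of x] that(2) by (cases "x \<in> H3") (auto simp: K_def)
  \<comment> \<open>A majorant common to all admissible functions, which share the bound
    \<open>B\<close> and the ball of radius \<open>R\<close> that carries them.\<close>
  have bound: "g (hyp_dist b x) * f (v x) \<le> g (hyp_dist b x) * f B * indicator {..R} (hyp_dist b x)"
    if v: "admissible b R B L v" and "\<And>t. 0 \<le> g t" "f 0 = 0" "\<And>s t. 0 \<le> s \<Longrightarrow> s \<le> t \<Longrightarrow> f s \<le> (f t :: real)"
    for v x f and g :: "real \<Rightarrow> real"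
  proof (cases "x \<in> K")
    case True
    then have "hyp_dist b x \<le> R" by (simp add: K_def hyp_dist_commute)
    moreover have "f (v x) \<le> f B" using admissibleD(3,4)[OF v] that(4) by blast
    ultimately show ?thesis using that(2) by (simp add: mult_left_mono)
  next
    case False
    have "0 \<le> f B" using that(3) that(4)[of 0 B] B by simp
    then show ?thesis using offK[OF v False] that(2,3) by (simp add: indicator_def)
  qed
  obtain f where f: "incseq f" "range f \<subseteq> J ` C" "Sup (J ` C) = (SUP i. f i)"
    using ennreal_Sup_countable_SUP[of "J ` C"] v0C by blast
  have "\<forall>i. \<exists>u\<in>C. J u = f i" using f(2) by (metis image_iff rangeI subsetD)
  then obtain u where u: "\<And>i. u i \<in> C" "\<And>i. J (u i) = f i" by metis
  have ua: "admissible b R B L (u i)" for i using u(1)[of i] by (simp add: C_def)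
  obtain g k where gk: "continuous_on K g" "strict_mono (k :: nat \<Rightarrow> nat)"
    "\<And>e. 0 < e \<Longrightarrow> \<exists>N. \<forall>n x. n \<ge> N \<and> x \<in> K \<longrightarrow> norm (u (k n) x - g x) < e"
  proof (rule Arzela_Ascoli[OF K, of u B])
    show "norm (u n x) \<le> B" for n x using admissibleD(3,4)[OF ua[of n], of x] by simp
    fix x and e :: real assume x: "x \<in> K" and e: "0 < e"
    have xH: "x \<in> H3" using x by (simp add: K_def)
    have "continuous_on H3 (\<lambda>y. L * sqrt (hyp_delta y x))"
      by (intro continuous_intros continuous_on_hyp_delta xH)
    then have "\<exists>d>0. \<forall>y\<in>H3. dist y x < d \<longrightarrow> dist (L * sqrt (hyp_delta y x)) (L * sqrt (hyp_delta x x)) < e"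
      using xH e unfolding continuous_on_iff by blast
    then obtain d where d: "d > 0" "\<And>y. y \<in> H3 \<Longrightarrow> dist y x < d \<Longrightarrow> \<bar>L * sqrt (hyp_delta y x)\<bar> < e"
      by (auto simp: dist_real_def)
    show "\<exists>d>0. \<forall>n y. y \<in> K \<and> norm (x - y) < d \<longrightarrow> norm (u n x - u n y) < e"
    proof (intro exI[of _ d] conjI allI impI d(1))
      fix n y assume "y \<in> K \<and> norm (x - y) < d"
      then have y: "y \<in> H3" "dist y x < d" by (auto simp: K_def dist_norm norm_minus_commute)
      have "\<bar>u n y - u n x\<bar> \<le> L * sqrt (hyp_delta y x)" by (rule admissibleD(5)[OF ua y(1) xH])
      then show "norm (u n x - u n y) < e" using d(2)[OF y] by (simp add: abs_minus_commute)
    qed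
  qed blast
  define v where "v = (\<lambda>x. if x \<in> K then g x else 0)"
  have unif: "\<exists>N. \<forall>n\<ge>N. \<forall>x. \<bar>u (k n) x - v x\<bar> < e" if e: "0 < e" for e
  proof -
    obtain N where N: "\<And>n x. n \<ge> N \<Longrightarrow> x \<in> K \<Longrightarrow> norm (u (k n) x - g x) < e" using gk(3)[OF e] by blast
    have "\<bar>u (k n) x - v x\<bar> < e" if "n \<ge> N" for n x
      using N[OF that, of x] offK[OF ua] e by (simp add: v_def)
    then show ?thesis by blast
  qed
  have lim: "(\<lambda>n. u (k n) x) \<longlonglongrightarrow> v x" for x
    by (rule LIMSEQ_I) (use unif in \<open>simp, blast\<close>)
  have va: "admissible b R B L v"
    unfolding admissible_def
  proof (intro conjI allI ballI impI)
    show "v x = 0" if "x \<notin> H3" for x using that by (simp add: v_def K_def)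
    show "0 \<le> v x" for x by (rule LIMSEQ_le_const[OF lim]) (use admissibleD(3)[OF ua] in auto)
    show "v x \<le> B" for x by (rule LIMSEQ_le_const2[OF lim]) (use admissibleD(4)[OF ua] in auto)
    show "v x = 0" if "x \<in> H3" "R \<le> hyp_dist x b" for x
      using LIMSEQ_unique[OF lim[of x]] admissibleD(2)[OF ua that] by simp
    show "\<bar>v x - v y\<bar> \<le> L * sqrt (hyp_delta x y)" if "x \<in> H3" "y \<in> H3" for x y
      by (rule LIMSEQ_le_const2[OF tendsto_rabs[OF tendsto_diff[OF lim lim]]])
         (use admissibleD(5)[OF ua that] in auto)
  qed
  have [measurable]: "u i \<in> borel_measurable borel" for i by (rule admissible_borel[OF ua])
  have [measurable]: "v \<in> borel_measurable borel" by (rule admissible_borel[OF va])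
  have fin1: "(\<integral>\<^sup>+x. ennreal (1 * a * indicator {..R} (hyp_dist b x)) \<partial>hyp_volume) < \<infinity>" for a
  proof -
    have "(\<integral>\<^sup>+x. ennreal ((\<lambda>_. max 0 a) (hyp_dist b x)) * indicator {..R} (hyp_dist b x) \<partial>hyp_volume) < \<infinity>"
      by (rule nn_integral_radial_finite[OF b R, where a = "(sinh R)\<^sup>2 * max 0 a"])
         (auto intro!: mult_right_mono power_mono)
    moreover have "(\<integral>\<^sup>+x. ennreal (1 * a * indicator {..R} (hyp_dist b x)) \<partial>hyp_volume) \<le>
      (\<integral>\<^sup>+x. ennreal ((\<lambda>_. max 0 a) (hyp_dist b x)) * indicator {..R} (hyp_dist b x) \<partial>hyp_volume)"
      by (intro nn_integral_mono) (auto simp: indicator_def intro!: ennreal_leI)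
    ultimately show ?thesis by simp
  qed
  have sqv: "sq v0 \<le> sq v"
    unfolding sq_def
  proof (rule nn_integral_ge_limit[where u = "\<lambda>n x. ennreal ((u (k n) x)\<^sup>2)" and w = "\<lambda>x. ennreal (1 * B\<^sup>2 * indicator {..R} (hyp_dist b x))"])
    show "AE x in hyp_volume. ennreal ((u (k n) x)\<^sup>2) \<le> ennreal (1 * B\<^sup>2 * indicator {..R} (hyp_dist b x))" for n
      using bound[OF ua, of "\<lambda>_. 1" "\<lambda>t. t\<^sup>2"] by (auto intro!: AE_I2 ennreal_leI power_mono)
    show "AE x in hyp_volume. (\<lambda>n. ennreal ((u (k n) x)\<^sup>2)) \<longlonglongrightarrow> ennreal ((v x)\<^sup>2)"
      by (intro AE_I2 tendsto_ennrealI tendsto_intros lim)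
    show "(\<integral>\<^sup>+x. ennreal ((v0 x)\<^sup>2) \<partial>hyp_volume) \<le> (\<integral>\<^sup>+x. ennreal ((u (k n) x)\<^sup>2) \<partial>hyp_volume)" for n
      using u(1)[of "k n"] by (simp add: C_def sq_def)
  qed (use fin1 in auto)
  have wtv: "wt v0 \<le> wt v"
    unfolding wt_def
  proof (rule nn_integral_ge_limit[where u = "\<lambda>n x. ennreal (sinh (hyp_dist b x) powr ((p - 6) / 2) * u (k n) x powr p)"
        and w = "\<lambda>x. ennreal (sinh (hyp_dist b x) powr ((p - 6) / 2) * B powr p) * indicator {..R} (hyp_dist b x)"])
    show "AE x in hyp_volume. ennreal (sinh (hyp_dist b x) powr ((p - 6) / 2) * u (k n) x powr p) \<le>
      ennreal (sinh (hyp_dist b x) powr ((p - 6) / 2) * B powr p) * indicator {..R} (hyp_dist b x)" for n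
    proof (intro AE_I2)
      fix x
      have "ennreal (sinh (hyp_dist b x) powr ((p - 6) / 2) * u (k n) x powr p) \<le>
        ennreal (sinh (hyp_dist b x) powr ((p - 6) / 2) * B powr p * indicator {..R} (hyp_dist b x))"
        using p by (intro ennreal_leI bound[OF ua, where g = "\<lambda>t. sinh t powr ((p - 6) / 2)" and f = "\<lambda>t. t powr p"])
          (auto intro!: powr_mono2)
      then show "ennreal (sinh (hyp_dist b x) powr ((p - 6) / 2) * u (k n) x powr p) \<le>
        ennreal (sinh (hyp_dist b x) powr ((p - 6) / 2) * B powr p) * indicator {..R} (hyp_dist b x)"
        by (simp only: ennreal_indicator_mult)
    qed
    show "AE x in hyp_volume. (\<lambda>n. ennreal (sinh (hyp_dist b x) powr ((p - 6) / 2) * u (k n) x powr p)) \<longlonglongrightarrow>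
      ennreal (sinh (hyp_dist b x) powr ((p - 6) / 2) * v x powr p)"
      using p admissibleD(3)[OF ua]
      by (intro AE_I2 tendsto_ennrealI tendsto_mult tendsto_const tendsto_powr' lim) auto
    show "(\<integral>\<^sup>+x. ennreal (sinh (hyp_dist b x) powr ((p - 6) / 2) * v0 x powr p) \<partial>hyp_volume) \<le>
      (\<integral>\<^sup>+x. ennreal (sinh (hyp_dist b x) powr ((p - 6) / 2) * u (k n) x powr p) \<partial>hyp_volume)" for n
      using u(1)[of "k n"] by (simp add: C_def wt_def)
    \<comment> \<open>The factor \<open>(sinh t)^2\<close> turns the exponent
      \<open>(p - 6) / 2\<close> into the positive exponent \<open>(p - 2) / 2\<close>.\<close>
    have bd: "(sinh t)\<^sup>2 * (sinh t powr ((p - 6) / 2) * B powr p) \<le> sinh R powr ((p - 2) / 2) * B powr p" if "0 \<le> t" "t \<le> R" for t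
    proof (cases "t = 0")
      case False
      then have "(sinh t)\<^sup>2 * sinh t powr ((p - 6) / 2) = sinh t powr (2 + (p - 6) / 2)"
        using that by (simp add: powr_add)
      also have "2 + (p - 6) / 2 = (p - 2) / 2" by (simp add: field_simps)
      also have "sinh t powr ((p - 2) / 2) \<le> sinh R powr ((p - 2) / 2)"
        using that p by (intro powr_mono2) auto
      finally show ?thesis by (simp only: mult.assoc[symmetric]) (intro mult_right_mono, auto)
    qed simp
    show "(\<integral>\<^sup>+x. ennreal (sinh (hyp_dist b x) powr ((p - 6) / 2) * B powr p) * indicator {..R} (hyp_dist b x) \<partial>hyp_volume) < \<infinity>"
      by (rule nn_integral_radial_finite[OF b R, where G = "\<lambda>t. sinh t powr ((p - 6) / 2) * B powr p", OF _ bd]) auto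
  qed measurable
  have Jv: "J v = Sup (J ` C)"
  proof -
    have "(\<lambda>n. J (u (k n))) \<longlonglongrightarrow> J v"
      unfolding J_def
    proof (rule nn_integral_dominated_convergence[where w = "\<lambda>x. ennreal (1 * B * indicator {..R} (hyp_dist b x))"])
      show "AE x in hyp_volume. ennreal (exp (- hyp_delta b x) * u (k n) x) \<le> ennreal (1 * B * indicator {..R} (hyp_dist b x))" for n
        using AE_hyp_volume_H3
      proof eventually_elim
        case (elim x)
        have "exp (- hyp_delta b x) * u (k n) x \<le> 1 * u (k n) x"
          using hyp_delta_nonneg[OF b elim] admissibleD(3)[OF ua] by (intro mult_right_mono) auto
        also have "\<dots> \<le> 1 * B * indicator {..R} (hyp_dist b x)"
          using bound[OF ua, of "\<lambda>_. 1" "\<lambda>t. t"] by auto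
        finally show ?case by (rule ennreal_leI)
      qed
      show "AE x in hyp_volume. (\<lambda>n. ennreal (exp (- hyp_delta b x) * u (k n) x)) \<longlonglongrightarrow> ennreal (exp (- hyp_delta b x) * v x)"
        by (intro AE_I2 tendsto_ennrealI tendsto_intros lim)
    qed (use fin1 in auto)
    moreover have "(\<lambda>n. J (u (k n))) \<longlonglongrightarrow> (SUP i. f i)"
      using LIMSEQ_subseq_LIMSEQ[OF LIMSEQ_SUP[OF f(1)] gk(2)] by (simp add: u(2) o_def)
    ultimately show ?thesis using f(3) LIMSEQ_unique by simp
  qed
  have fin: "J v < \<infinity>"
  proof -
    have "J v \<le> (\<integral>\<^sup>+x. ennreal (1 * B * indicator {..R} (hyp_dist b x)) \<partial>hyp_volume)"
      unfolding J_def
    proof (rule nn_integral_mono_AE)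
      show "AE x in hyp_volume. ennreal (exp (- hyp_delta b x) * v x) \<le> ennreal (1 * B * indicator {..R} (hyp_dist b x))"
        using AE_hyp_volume_H3
      proof eventually_elim
        case (elim x)
        have "exp (- hyp_delta b x) * v x \<le> 1 * v x"
          using hyp_delta_nonneg[OF b elim] admissibleD(3)[OF va] by (intro mult_right_mono) auto
        also have "\<dots> \<le> 1 * B * indicator {..R} (hyp_dist b x)"
          using bound[OF va, of "\<lambda>_. 1" "\<lambda>t. t"] by auto
        finally show ?case by (rule ennreal_leI)
      qed
    qed
    then show ?thesis using fin1[of B] by (rule order_le_less_trans)
  qed
  have bmeas: "ball_sup \<eta> w \<in> borel_measurable borel" if "admissible b R B L w" for w
    by (rule ball_sup_borel[OF \<eta>]) (use admissibleD(4)[OF that] in blast)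
  have [measurable]: "ball_sup \<eta> (u i) \<in> borel_measurable borel" for i by (rule bmeas[OF ua])
  have env: "en v \<le> en v0"
  proof -
    \<comment> \<open>The energy has to be bounded from above only, so lower semicontinuity by
      Fatou's lemma takes the place of dominated convergence.\<close>
    have "en v \<le> (\<integral>\<^sup>+x. liminf (\<lambda>n. ennreal ((ball_sup \<eta> (u (k n)) x - u (k n) x)\<^sup>2)) \<partial>hyp_volume)"
      unfolding en_def
    proof (rule nn_integral_mono_AE)
      show "AE x in hyp_volume. ennreal ((ball_sup \<eta> v x - v x)\<^sup>2) \<le> liminf (\<lambda>n. ennreal ((ball_sup \<eta> (u (k n)) x - u (k n) x)\<^sup>2))"
        using AE_hyp_volume_H3
      proof eventually_elim
        case (elim x)
        have "(\<lambda>n. ball_sup \<eta> (u (k n)) x) \<longlonglongrightarrow> ball_sup \<eta> v x"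
          by (rule ball_sup_uniform_limit[OF \<eta> elim _ _ unif]) (use admissibleD(4)[OF ua] admissibleD(4)[OF va] in auto)
        then have "(\<lambda>n. ennreal ((ball_sup \<eta> (u (k n)) x - u (k n) x)\<^sup>2)) \<longlonglongrightarrow> ennreal ((ball_sup \<eta> v x - v x)\<^sup>2)"
          by (intro tendsto_ennrealI tendsto_intros lim)
        then show ?case by (intro eq_refl lim_imp_Liminf[symmetric]) auto
      qed
    qed
    also have "\<dots> \<le> liminf (\<lambda>n. en (u (k n)))"
      unfolding en_def by (rule nn_integral_liminf) measurable
    also have "\<dots> \<le> liminf (\<lambda>n. en v0)"
      by (rule Liminf_mono) (use u(1) in \<open>auto simp: C_def\<close>)
    finally show ?thesis by (simp add: Liminf_const)
  qed
  have vC: "v \<in> C" using va sqv wtv env by (simp add: C_def)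
  have rad: "v y \<le> v x" if x: "x \<in> H3" and y: "y \<in> H3" and d: "hyp_dist x b < hyp_dist y b" for x y
  proof (rule ccontr)
    assume "\<not> v y \<le> v x"
    then have lt: "v x < v y" by simp
    obtain c k where pk: "polarisation c k b" and Jlt: "J v < J (polarisation.polarise c k b v)"
      using polarisation_increases[OF b va x y d lt] fin unfolding J_def by blast
    interpret polarisation c k b by (rule pk)
    note v0 = admissibleD(3)[OF va]
    have "admissible b R B L (polarise v)" by (rule admissible_polarise[OF va L])
    moreover have "sq v \<le> sq (polarise v)"
      using weighted_polarise_le[of v "\<lambda>_. 1" "\<lambda>t. t\<^sup>2"] v0 by (simp add: sq_def)
    moreover have "wt v \<le> wt (polarise v)"
      unfolding wt_def
    proof (rule weighted_polarise_le)
      fix x y assume xy: "x \<in> H3" "y \<in> H3" "x \<noteq> b" "hyp_dist x b \<le> hyp_dist y b"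
      \<comment> \<open>Here \<open>p \<le> 6\<close> enters: the exponent is nonpositive, and since
        \<open>x\<close> is not \<open>b\<close> the base of the power is positive, so the weight
        decreases with the distance.\<close>
      have "0 < hyp_dist b x"
        using hyp_dist_nonneg[OF b xy(1)] hyp_dist_eq_0_iff[OF b xy(1)] xy(3) by (metis order_le_less)
      then show "sinh (hyp_dist b y) powr ((p - 6) / 2) \<le> sinh (hyp_dist b x) powr ((p - 6) / 2)"
        using xy p by (intro powr_mono2') (auto simp: hyp_dist_commute)
    qed (use v0 p in \<open>auto intro!: powr_mono2\<close>)
    moreover have "en (polarise v) \<le> en v"
      unfolding en_def by (rule ball_sup_energy_polarise[OF \<eta>]) (use admissibleD(3,4)[OF va] in auto)
    ultimately have "polarise v \<in> C" using vC by (auto simp: C_def)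
    then have "J (polarise v) \<le> J v" unfolding Jv by (simp add: SUP_upper)
    then show False using Jlt by simp
  qed
  show thesis
    using that[OF va sqv[unfolded sq_def] wtv[unfolded wt_def] env[unfolded en_def] rad] .
qed

section \<open>Radial functions\<close>

text \<open>In the hyperboloid model the point at distance \<open>\<epsilon>\<close> from
  \<open>x\<close> on the segment to \<open>b\<close> is the linear combination of \<open>b\<close>
  and \<open>x\<close> with coefficients \<open>\<alpha> = sinh \<epsilon> / sinh \<rho>\<close> and
  \<open>\<beta> = sinh (\<rho> - \<epsilon>) / sinh \<rho>\<close>. The reciprocal height and the
  horizontal coordinates divided by the height are linear coordinates of that model, which gives the
  formula for \<open>y\<close>.\<close>

lemma hyp_geodesic_point:
  assumes x: "x \<in> H3" and b: "b \<in> H3" and e: "0 \<le> \<epsilon>" "\<epsilon> \<le> hyp_dist x b" and ne: "x \<noteq> b"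
  obtains y where "y \<in> H3" "hyp_dist x y = \<epsilon>" "hyp_dist y b = hyp_dist x b - \<epsilon>"
proof -
  define \<rho> where "\<rho> = hyp_dist x b"
  have \<rho>: "\<rho> > 0" using hyp_dist_nonneg[OF x b] hyp_dist_eq_0_iff[OF x b] ne by (simp add: \<rho>_def order_le_less)
  define u v where "u = \<epsilon>" and "v = \<rho> - \<epsilon>"
  have uv: "0 \<le> u" "0 \<le> v" "u + v = \<rho>" using e by (auto simp: u_def v_def \<rho>_def)
  have sh: "sinh \<rho> > 0" using \<rho> by simp
  define \<alpha> \<beta> where "\<alpha> = sinh u / sinh \<rho>" and "\<beta> = sinh v / sinh \<rho>"
  have ab: "\<alpha> \<ge> 0" "\<beta> \<ge> 0" using uv sh by (auto simp: \<alpha>_def \<beta>_def)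
  have add: "sinh \<rho> = sinh u * cosh v + cosh u * sinh v" "cosh \<rho> = cosh u * cosh v + sinh u * sinh v"
    using sinh_add[of u v] cosh_add[of u v] uv(3) by auto
  have cs: "(cosh t)\<^sup>2 = 1 + (sinh t)\<^sup>2" for t :: real by (simp add: cosh_square_eq)
  \<comment> \<open>The combination has Lorentz norm 1, so it lies on the hyperboloid again.\<close>
  have n1: "\<alpha>\<^sup>2 + \<beta>\<^sup>2 + 2 * \<alpha> * \<beta> * cosh \<rho> = 1"
  proof -
    have "(sinh u)\<^sup>2 + (sinh v)\<^sup>2 + 2 * sinh u * sinh v * cosh \<rho> =
        (sinh u)\<^sup>2 * (1 + (sinh v)\<^sup>2) + (1 + (sinh u)\<^sup>2) * (sinh v)\<^sup>2 + 2 * sinh u * cosh v * cosh u * sinh v"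
      unfolding add by (simp add: algebra_simps power2_eq_square)
    also have "\<dots> = (sinh \<rho>)\<^sup>2"
      unfolding cs[symmetric] add by (simp add: algebra_simps power2_eq_square)
    finally have "((sinh u)\<^sup>2 + (sinh v)\<^sup>2 + 2 * sinh u * sinh v * cosh \<rho>) / (sinh \<rho>)\<^sup>2 = 1"
      using sh by simp
    then show ?thesis
      by (simp add: \<alpha>_def \<beta>_def power_divide add_divide_distrib power2_eq_square)
  qed
  \<comment> \<open>The Lorentz products of the new point with \<open>b\<close> and with
    \<open>x\<close>, that is, the hyperbolic cosines of its distances from them.\<close>
  have conv: "\<beta> * cosh \<rho> + \<alpha> = cosh v" "\<alpha> * cosh \<rho> + \<beta> = cosh u"
  proof -
    have "sinh v * cosh \<rho> + sinh u = sinh u * (1 + (sinh v)\<^sup>2) + sinh v * cosh u * cosh v"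
      unfolding add by (simp add: algebra_simps power2_eq_square)
    also have "\<dots> = cosh v * sinh \<rho>"
      unfolding cs[symmetric] add by (simp add: algebra_simps power2_eq_square)
    finally show "\<beta> * cosh \<rho> + \<alpha> = cosh v"
      using sh by (simp add: \<alpha>_def \<beta>_def field_simps)
    have "sinh u * cosh \<rho> + sinh v = sinh v * (1 + (sinh u)\<^sup>2) + sinh u * cosh u * cosh v"
      unfolding add by (simp add: algebra_simps power2_eq_square)
    also have "\<dots> = cosh u * sinh \<rho>"
      unfolding cs[symmetric] add by (simp add: algebra_simps power2_eq_square)
    finally show "\<alpha> * cosh \<rho> + \<beta> = cosh u"
      using sh by (simp add: \<alpha>_def \<beta>_def field_simps)
  qed
  define X B where "X = x $ 3" and "B = b $ 3"
  have XB: "X > 0" "B > 0" using x b by (auto simp: X_def B_def H3_def)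
  define p q where "p = \<alpha> / B" and "q = \<beta> / X"
  have pq: "p \<ge> 0" "q \<ge> 0" "p * B = \<alpha>" "q * X = \<beta>" using ab XB by (auto simp: p_def q_def)
  have "\<alpha> \<noteq> 0 \<or> \<beta> \<noteq> 0" using n1 by auto
  then have "p > 0 \<or> q > 0" using ab XB by (auto simp: p_def q_def)
  define l where "l = p + q"
  have l: "l > 0" using pq \<open>p > 0 \<or> q > 0\<close> by (auto simp: l_def)
  define h where "h = (x $ 1 - b $ 1)\<^sup>2 + (x $ 2 - b $ 2)\<^sup>2"
  define y :: "real^3" where "y = (\<chi> i. if i = 3 then 1 / l else (p * b $ i + q * x $ i) / l)"
  have y3: "y $ 3 = 1 / l" by (simp add: y_def)
  have yH: "y \<in> H3" using l by (simp add: H3_def y3)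
  have sq: "(dist z w)\<^sup>2 = (z $ 1 - w $ 1)\<^sup>2 + (z $ 2 - w $ 2)\<^sup>2 + (z $ 3 - w $ 3)\<^sup>2" for z w :: "real^3"
    by (simp add: dist_norm power2_norm_eq_inner inner_vec_def sum_3) (simp add: power2_eq_square)
  have ch: "2 * (z $ 3) * (w $ 3) * cosh (hyp_dist z w) = (z $ 1 - w $ 1)\<^sup>2 + (z $ 2 - w $ 2)\<^sup>2 + (z $ 3)\<^sup>2 + (w $ 3)\<^sup>2"
    if "z \<in> H3" "w \<in> H3" for z w
  proof -
    have "2 * (z $ 3) * (w $ 3) * cosh (hyp_dist z w) = (dist z w)\<^sup>2 + 2 * (z $ 3) * (w $ 3)"
      using that by (simp add: cosh_hyp_dist hyp_delta_def H3_def field_simps)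
    then show ?thesis unfolding sq by (simp add: power2_diff)
  qed
  have cxb: "2 * X * B * cosh \<rho> = h + X\<^sup>2 + B\<^sup>2" using ch[OF x b] by (simp add: X_def B_def h_def \<rho>_def)
  \<comment> \<open>The normalisation \<open>n1\<close> in half-space coordinates.\<close>
  have n2: "l * (p * B\<^sup>2 + q * X\<^sup>2) + p * q * h = 1"
  proof -
    have "\<alpha>\<^sup>2 + \<beta>\<^sup>2 + 2 * \<alpha> * \<beta> * cosh \<rho> = p\<^sup>2 * B\<^sup>2 + q\<^sup>2 * X\<^sup>2 + p * q * (2 * X * B * cosh \<rho>)"
      unfolding pq(3,4)[symmetric] by (simp add: power2_eq_square)
    then show ?thesis unfolding n1 cxb by (simp add: l_def power2_eq_square algebra_simps)
  qed
  \<comment> \<open>The computation is symmetric in the two end points. \<open>z\<close>, of height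
    \<open>Z\<close>, is the one to which the distance is measured, and \<open>W\<close> is the
    height of the other one.\<close>
  have key: "cosh (hyp_dist y z) = r * cosh \<rho> + s"
    if z: "z \<in> H3" and yz: "(y $ 1 - z $ 1)\<^sup>2 + (y $ 2 - z $ 2)\<^sup>2 = f\<^sup>2 * h / l\<^sup>2"
      and lf: "l = f + g" and fg: "f * g = p * q" and Z: "z $ 3 = Z" "Z > 0" and W: "W > 0"
      and n: "l * (g * Z\<^sup>2 + f * W\<^sup>2) + f * g * h = 1" and c: "2 * W * Z * cosh \<rho> = h + W\<^sup>2 + Z\<^sup>2"
      and rs: "r = f * W" "s = g * Z" for z f g Z W r s
  proof -
    have "2 * (1 / l) * Z * cosh (hyp_dist y z) = f\<^sup>2 * h / l\<^sup>2 + (1 / l)\<^sup>2 + Z\<^sup>2"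
      using ch[OF yH z] yz by (simp add: y3 Z)
    then have "2 * l * Z * cosh (hyp_dist y z) = f\<^sup>2 * h + 1 + l\<^sup>2 * Z\<^sup>2"
      using l by (simp add: field_simps power2_eq_square)
    also have "\<dots> = l * (f * (h + W\<^sup>2 + Z\<^sup>2) + 2 * g * Z\<^sup>2)"
      unfolding n[symmetric] lf by (simp add: power2_eq_square algebra_simps)
    also have "\<dots> = 2 * l * Z * (r * cosh \<rho> + s)"
      unfolding c[symmetric] rs by (simp add: power2_eq_square algebra_simps)
    finally show ?thesis using l Z by simp
  qed
  have yb: "(y $ 1 - b $ 1)\<^sup>2 + (y $ 2 - b $ 2)\<^sup>2 = q\<^sup>2 * h / l\<^sup>2"
  proof -
    have "y $ i - b $ i = q * (x $ i - b $ i) / l" if "i = 1 \<or> i = 2" for i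
    proof -
      have "y $ i - b $ i = (p * b $ i + q * x $ i - l * b $ i) / l"
        using that l by (auto simp: y_def diff_divide_distrib)
      then show ?thesis by (simp add: l_def algebra_simps)
    qed
    then show ?thesis by (simp add: h_def power_divide power_mult_distrib add_divide_distrib distrib_left)
  qed
  have yx: "(y $ 1 - x $ 1)\<^sup>2 + (y $ 2 - x $ 2)\<^sup>2 = p\<^sup>2 * h / l\<^sup>2"
  proof -
    have "y $ i - x $ i = - (p * (x $ i - b $ i) / l)" if "i = 1 \<or> i = 2" for i
    proof -
      have "y $ i - x $ i = (p * b $ i + q * x $ i - l * x $ i) / l"
        using that l by (auto simp: y_def diff_divide_distrib)
      also have "p * b $ i + q * x $ i - l * x $ i = - (p * (x $ i - b $ i))" by (simp add: l_def algebra_simps)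
      finally show ?thesis by simp
    qed
    then show ?thesis by (simp add: h_def power_divide power_mult_distrib add_divide_distrib distrib_left)
  qed
  have "cosh (hyp_dist y b) = \<beta> * cosh \<rho> + \<alpha>"
    by (rule key[OF b yb, where g = p and Z = B and W = X])
       (use n2 cxb pq XB in \<open>auto simp: l_def B_def mult_ac add_ac\<close>)
  then have "hyp_dist y b = v" unfolding conv using uv hyp_dist_nonneg[OF yH b]
    by (metis arcosh_cosh_real)
  moreover have "cosh (hyp_dist y x) = \<alpha> * cosh \<rho> + \<beta>"
    by (rule key[OF x yx, where g = q and Z = X and W = B])
       (use n2 cxb pq XB in \<open>auto simp: l_def X_def mult_ac add_ac\<close>)
  then have "hyp_dist y x = u" unfolding conv using uv hyp_dist_nonneg[OF yH x]
    by (metis arcosh_cosh_real)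
  ultimately show thesis using that[OF yH] by (simp add: u_def v_def \<rho>_def hyp_dist_commute)
qed

text \<open>Monotonicity is given for different distances only. That \<open>v\<close> is constant on
  spheres around \<open>b\<close> follows from continuity, by comparison with the vertical geodesic
  \<open>q\<close> at slightly smaller and slightly larger radii.\<close>

lemma radial_profile:
  assumes b: "b \<in> H3" and \<eta>: "0 < \<eta>" and R: "0 < R" and a: "admissible b R B L v"
    and rad: "\<And>x y. x \<in> H3 \<Longrightarrow> y \<in> H3 \<Longrightarrow> hyp_dist x b < hyp_dist y b \<Longrightarrow> v y \<le> v x"
  obtains f :: "real \<Rightarrow> real" where "continuous_on UNIV f" "\<And>r. 0 \<le> f r" "\<And>r. R \<le> r \<Longrightarrow> f r = 0"
    "\<And>r s. r \<le> s \<Longrightarrow> f s \<le> f r" "\<And>x. x \<in> H3 \<Longrightarrow> v x = f (hyp_dist b x)"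
    "\<And>x. x \<in> H3 \<Longrightarrow> f (hyp_dist b x - \<eta>) \<le> ball_sup \<eta> v x"
proof -
  note d = admissibleD[OF a]
  have cv: "continuous_on H3 v" using hyp_modulus_continuous_on d(5) by blast
  define B3 where "B3 = b $ 3"
  have B3: "B3 > 0" using b by (simp add: B3_def H3_def)
  \<comment> \<open>The vertical geodesic starting at \<open>b\<close>, parametrised by arc
    length.\<close>
  define q where "q = (\<lambda>r. b + (B3 * (exp r - 1)) *\<^sub>R axis 3 1)"
  have q3: "q r $ 3 = B3 * exp r" for r by (simp add: q_def B3_def axis_def algebra_simps)
  have qH: "q r \<in> H3" for r using B3 by (simp add: H3_def q3)
  have dq: "hyp_dist (q r) b = r" if "0 \<le> r" for r
  proof -
    have "dist (q r) b = B3 * (exp r - 1)" using that B3 by (simp add: q_def dist_norm)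
    then have "hyp_delta (q r) b = (exp r - 1)\<^sup>2 / exp r"
      using B3 by (simp add: hyp_delta_def q3 B3_def[symmetric] power_mult_distrib power2_eq_square)
    also have "\<dots> = exp r + exp (- r) - 2"
      by (simp add: power2_eq_square field_simps exp_minus)
    finally have d: "hyp_delta (q r) b = exp r + exp (- r) - 2" .
    have "1 + (A - 2) / 2 = A / 2" for A :: real by (simp add: field_simps)
    then have "1 + hyp_delta (q r) b / 2 = (exp r + exp (- r)) / 2" unfolding d .
    then have "cosh (hyp_dist (q r) b) = cosh r"
      unfolding cosh_hyp_dist[OF qH b] cosh_field_def[of r] .
    then show ?thesis using that hyp_dist_nonneg[OF qH b] by (metis arcosh_cosh_real)
  qed
  \<comment> \<open>Constant for negative radii, so that \<open>f (r - \<eta>)\<close> is the value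
    at \<open>b\<close> when the ball around a point at distance \<open>r\<close> contains
    \<open>b\<close>.\<close>
  define f where "f = (\<lambda>r. v (q (max r 0)))"
  have f1: "continuous_on UNIV f"
    unfolding f_def by (rule continuous_on_compose2[OF cv]) (use qH in \<open>auto simp: q_def[abs_def] intro!: continuous_intros\<close>)
  have f2: "0 \<le> f r" for r by (simp add: f_def d(3))
  have f3: "f r = 0" if "R \<le> r" for r
    unfolding f_def using R that by (intro d(2) qH) (simp add: dq)
  have f4: "f s \<le> f r" if "r \<le> s" for r s
  proof (cases "max r 0 = max s 0")
    case False
    then have "hyp_dist (q (max r 0)) b < hyp_dist (q (max s 0)) b" using that by (auto simp: dq max_def split: if_splits)
    then show ?thesis unfolding f_def by (rule rad[OF qH qH])
  qed (simp add: f_def)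
  have f5: "v x = f (hyp_dist b x)" if x: "x \<in> H3" for x
  proof -
    define \<rho> where "\<rho> = hyp_dist x b"
    have \<rho>0: "\<rho> \<ge> 0" using hyp_dist_nonneg[OF x b] by (simp add: \<rho>_def)
    show ?thesis
    proof (cases "\<rho> = 0")
      case True
      then have "x = b" using hyp_dist_eq_0_iff[OF x b] by (simp add: \<rho>_def)
      then show ?thesis by (simp add: f_def q_def)
    next
      case False
      then have \<rho>: "\<rho> > 0" using \<rho>0 by simp
      have cf: "isCont f \<rho>" using f1 by (simp add: continuous_on_eq_continuous_at)
      have "v x \<le> f \<rho>"
      proof (rule tendsto_lowerbound[OF cf[unfolded isCont_def, THEN tendsto_within_subset, of "{..<\<rho>}"]])
        show "\<forall>\<^sub>F r in at \<rho> within {..<\<rho>}. v x \<le> f r"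
          using eventually_at_left_real[OF \<rho>]
        proof eventually_elim
          case (elim r)
          then have "hyp_dist (q (max r 0)) b < hyp_dist x b" by (simp add: dq \<rho>_def)
          then show ?case unfolding f_def by (rule rad[OF qH x])
        qed
      qed auto
      moreover have "f \<rho> \<le> v x"
      proof (rule tendsto_upperbound[OF cf[unfolded isCont_def, THEN tendsto_within_subset, of "{\<rho><..}"]])
        show "\<forall>\<^sub>F r in at \<rho> within {\<rho><..}. f r \<le> v x"
          using eventually_at_right_less[of \<rho>]
        proof eventually_elim
          case (elim r)
          then have "hyp_dist x b < hyp_dist (q (max r 0)) b" using \<rho> by (simp add: dq \<rho>_def[symmetric])
          then show ?case unfolding f_def by (rule rad[OF x qH])
        qed
      qed auto
      ultimately show ?thesis by (simp add: \<rho>_def hyp_dist_commute)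
    qed
  qed
  \<comment> \<open>Being open, the ball around \<open>x\<close> reaches the radii above
    \<open>\<rho> - \<eta>\<close> but not this radius itself; continuity of \<open>f\<close> covers
    the end point.\<close>
  have f6: "f (hyp_dist b x - \<eta>) \<le> ball_sup \<eta> v x" if x: "x \<in> H3" for x
  proof -
    define \<rho> where "\<rho> = hyp_dist x b"
    have \<rho>0: "\<rho> \<ge> 0" using hyp_dist_nonneg[OF x b] by (simp add: \<rho>_def)
    have up: "v y \<le> ball_sup \<eta> v x" if "y \<in> H3" "hyp_dist x y < \<eta>" for y
      using ball_sup_upper[OF x that] d(4) by blast
    show ?thesis
    proof (cases "\<rho> < \<eta>")
      case True
      have "f (\<rho> - \<eta>) = v b" using True by (simp add: f_def q_def)
      then show ?thesis using up[OF b] True by (simp add: \<rho>_def hyp_dist_commute)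
    next
      case False
      then have ne: "x \<noteq> b" using \<eta> by (auto simp: \<rho>_def)
      have cf: "isCont f (\<rho> - \<eta>)" using f1 by (simp add: continuous_on_eq_continuous_at)
      have "f (\<rho> - \<eta>) \<le> ball_sup \<eta> v x"
      proof (rule tendsto_upperbound[OF cf[unfolded isCont_def, THEN tendsto_within_subset, of "{\<rho> - \<eta><..}"]])
        have "\<forall>\<^sub>F r in at (\<rho> - \<eta>) within {\<rho> - \<eta><..}. r \<in> {\<rho> - \<eta><..<\<rho>}"
          using \<eta> by (intro eventually_at_right_real) auto
        then show "\<forall>\<^sub>F r in at (\<rho> - \<eta>) within {\<rho> - \<eta><..}. f r \<le> ball_sup \<eta> v x"
        proof eventually_elim
          case (elim r)
          have "0 \<le> \<rho> - r" "\<rho> - r \<le> hyp_dist x b" using elim False by (auto simp: \<rho>_def)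
          then obtain y where y: "y \<in> H3" "hyp_dist x y = \<rho> - r" "hyp_dist y b = hyp_dist x b - (\<rho> - r)"
            using hyp_geodesic_point[OF x b _ _ ne] by blast
          then have "v y \<le> ball_sup \<eta> v x" using elim by (intro up) auto
          then show ?case using f5[OF y(1)] y(3) by (simp add: hyp_dist_commute \<rho>_def)
        qed
      qed auto
      then show ?thesis by (simp add: \<rho>_def hyp_dist_commute)
    qed
  qed
  show thesis using that[OF f1 f2 f3 f4 f5 f6] .
qed

lemma nn_integral_Icc_continuous:
  fixes g :: "real \<Rightarrow> real"
  assumes "continuous_on {a..b} g" "\<And>t. t \<in> {a..b} \<Longrightarrow> 0 \<le> g t"
  shows "(\<integral>\<^sup>+t. ennreal (g t) * indicator {a..b} t \<partial>lborel) = ennreal (integral {a..b} g)"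
  by (rule nn_integral_has_integral_lebesgue') (use assms in \<open>auto intro!: integrable_integral integrable_continuous_real\<close>)

text \<open>The numbers \<open>n\<close> and \<open>w\<close> are the integrals of a moving average
  of the profile, not of the profile. They are only upper bounds for the integrals of
  \<open>v\<close>, which is the direction needed, and for this reason no error in
  \<open>\<eta>\<close> arises.\<close>

lemma radial_energy_bound:
  assumes b: "b \<in> H3" and \<eta>: "0 < \<eta>" and p: "2 < p" and R: "0 < R" and a: "admissible b R B L v"
    and rad: "\<And>x y. x \<in> H3 \<Longrightarrow> y \<in> H3 \<Longrightarrow> hyp_dist x b < hyp_dist y b \<Longrightarrow> v y \<le> v x"
  obtains n w where "0 \<le> n" "0 \<le> w"
    "(\<integral>\<^sup>+x. ennreal ((v x)\<^sup>2) \<partial>hyp_volume) \<le> ennreal n"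
    "(\<integral>\<^sup>+x. ennreal (sinh (hyp_dist b x) powr ((p - 6) / 2) * v x powr p) \<partial>hyp_volume) \<le> ennreal w"
    "ennreal (\<eta>\<^sup>2 * (n + sharp_constant p * w powr (2 / p))) \<le> (\<integral>\<^sup>+x. ennreal ((ball_sup \<eta> v x - v x)\<^sup>2) \<partial>hyp_volume)"
proof -
  obtain f where f: "continuous_on UNIV f" "\<And>r. 0 \<le> f r" "\<And>r. R \<le> r \<Longrightarrow> f r = 0"
    "\<And>r s. r \<le> s \<Longrightarrow> f s \<le> f r" "\<And>x. x \<in> H3 \<Longrightarrow> v x = f (hyp_dist b x)"
    "\<And>x. x \<in> H3 \<Longrightarrow> f (hyp_dist b x - \<eta>) \<le> ball_sup \<eta> v x"
    using radial_profile[OF b \<eta> R a rad] by blast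
  have [measurable]: "f \<in> borel_measurable borel" using f(1) by (rule borel_measurable_continuous_onI)
  obtain G where "\<And>r. (G has_vector_derivative f r) (at r)"
    using einterval_antiderivative[of "-\<infinity>" "\<infinity>" f] f(1) by (auto simp: continuous_on_eq_continuous_at)
  then have G: "(G has_real_derivative f r) (at r)" for r
    by (simp add: has_real_derivative_iff_has_vector_derivative)
  \<comment> \<open>The moving average of \<open>f\<close> dominates \<open>f\<close>, is differentiable, and its slope is exactly the
    increment of \<open>f\<close> over the distance \<open>\<eta>\<close>.\<close>
  define F where "F = (\<lambda>r. (G r - G (r - \<eta>)) / \<eta>)"
  define F' where "F' = (\<lambda>r. (f r - f (r - \<eta>)) / \<eta>)"
  have F': "(F has_real_derivative F' r) (at r)" for r
    unfolding F_def F'_def using \<eta> DERIV_shift[of G "f (r - \<eta>)" r "- \<eta>"] G[of "r - \<eta>"]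
    by (auto intro!: derivative_eq_intros G)
  have cF': "continuous_on A F'" for A
    unfolding F'_def using \<eta>
    by (intro continuous_intros continuous_on_subset[OF f(1)] continuous_on_compose2[OF f(1)]) auto
  have cF: "continuous_on A F" for A
    using F' DERIV_isCont by (blast intro: continuous_at_imp_continuous_on)
  have mvt: "\<exists>z>r - \<eta>. z < r \<and> F r = f z" for r
  proof -
    obtain z where "r - \<eta> < z" "z < r" "G r - G (r - \<eta>) = (r - (r - \<eta>)) * f z"
      using MVT2[of "r - \<eta>" r G f] G \<eta> by auto
    then show ?thesis using \<eta> by (intro exI[of _ z]) (simp add: F_def)
  qed
  have F0: "0 \<le> F r" for r using mvt[of r] f(2) by auto
  have Ff: "f r \<le> F r" for r using mvt[of r] f(4) by (metis less_imp_le)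
  \<comment> \<open>The average at \<open>r\<close> reaches back to \<open>r - \<eta>\<close>, so it
    is known to vanish at \<open>R + \<eta>\<close> rather than at \<open>R\<close>.\<close>
  define R' where "R' = R + \<eta>"
  have R': "0 < R'" using R \<eta> by (simp add: R'_def)
  have FR': "F R' = 0" using mvt[of R'] f(3) by (auto simp: R'_def)
  have fR': "f t = 0" if "t \<notin> {0..R'}" "0 \<le> t" for t using that \<eta> by (intro f(3)) (auto simp: R'_def)
  define N where "N = integral {0..R'} (\<lambda>r. (F r)\<^sup>2 * (sinh r)\<^sup>2)"
  define X where "X = integral {0..R'} (\<lambda>r. F r powr p * sinh r powr ((p - 2) / 2))"
  define E where "E = integral {0..R'} (\<lambda>r. (F' r)\<^sup>2 * (sinh r)\<^sup>2)"
  have cN: "continuous_on {0..R'} (\<lambda>r. (F r)\<^sup>2 * (sinh r)\<^sup>2)"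
    and cX: "continuous_on {0..R'} (\<lambda>r. F r powr p * sinh r powr ((p - 2) / 2))"
    and cE: "continuous_on {0..R'} (\<lambda>r. (F' r)\<^sup>2 * (sinh r)\<^sup>2)"
    using p F0 by (auto intro!: continuous_intros cF cF' continuous_on_powr')
  have N0: "0 \<le> N" and X0: "0 \<le> X"
    unfolding N_def X_def
    by (intro Henstock_Kurzweil_Integration.integral_nonneg integrable_continuous_real cN cX; simp)+
  have bl: "N + sharp_constant p / (4 * pi) powr ((p - 2) / p) * X powr (2 / p) \<le> E"
    unfolding N_def X_def E_def by (rule bliss_inequality[OF p R' F' cF' F0 FR'])
  have four_pi: "(\<integral>\<^sup>+t. ennreal (4 * pi * g t) * indicator {0..R'} t \<partial>lborel) = ennreal (4 * pi * integral {0..R'} g)"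
    if "continuous_on {0..R'} g" "\<And>t. 0 \<le> g t" for g
    using nn_integral_Icc_continuous[of 0 R' "\<lambda>t. 4 * pi * g t", OF continuous_on_mult[OF continuous_on_const that(1)]] that(2)
    by simp
  have polar: "(\<integral>\<^sup>+x. ennreal (h x) \<partial>hyp_volume) = (\<integral>\<^sup>+t. ennreal (4 * pi * ((sinh t)\<^sup>2 * g t)) * indicator {0..} t \<partial>lborel)"
    if [measurable]: "g \<in> borel_measurable borel" and "\<And>x. x \<in> H3 \<Longrightarrow> h x = g (hyp_dist b x)" for g h
  proof -
    have "(\<integral>\<^sup>+x. ennreal (h x) \<partial>hyp_volume) = (\<integral>\<^sup>+x. ennreal (g (hyp_dist b x)) \<partial>hyp_volume)"
      by (rule nn_integral_cong_AE) (use AE_hyp_volume_H3 that in \<open>auto elim!: eventually_mono\<close>)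
    also have "\<dots> = (\<integral>\<^sup>+t. ennreal (4 * pi * (sinh t)\<^sup>2) * indicator {0..} t * ennreal (g t) \<partial>lborel)"
      by (rule nn_integral_hyp_dist[OF b]) measurable
    also have "\<dots> = (\<integral>\<^sup>+t. ennreal (4 * pi * ((sinh t)\<^sup>2 * g t)) * indicator {0..} t \<partial>lborel)"
      by (intro nn_integral_cong) (auto simp: indicator_def ennreal_mult'[symmetric] mult.assoc)
    finally show ?thesis .
  qed
  have le: "ennreal (4 * pi * g t) * indicator {0..} t \<le> ennreal (4 * pi * h t) * indicator {0..R'} t"
    if "\<And>t. 0 \<le> t \<Longrightarrow> t \<le> R' \<Longrightarrow> g t \<le> h t" "\<And>t. t \<notin> {0..R'} \<Longrightarrow> 0 \<le> t \<Longrightarrow> g t = 0" for g h t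
    using that[of t] by (auto simp: indicator_def intro!: ennreal_leI)
  have n: "(\<integral>\<^sup>+x. ennreal ((v x)\<^sup>2) \<partial>hyp_volume) \<le> ennreal (4 * pi * N)"
  proof -
    have "(\<integral>\<^sup>+x. ennreal ((v x)\<^sup>2) \<partial>hyp_volume) = (\<integral>\<^sup>+t. ennreal (4 * pi * ((sinh t)\<^sup>2 * (f t)\<^sup>2)) * indicator {0..} t \<partial>lborel)"
      by (rule polar) (auto simp: f(5))
    also have "\<dots> \<le> (\<integral>\<^sup>+t. ennreal (4 * pi * ((F t)\<^sup>2 * (sinh t)\<^sup>2)) * indicator {0..R'} t \<partial>lborel)"
      using Ff f(2) fR' by (intro nn_integral_mono le) (auto intro!: mult_right_mono power_mono simp: mult.commute[of "(sinh _)\<^sup>2"])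
    also have "\<dots> = ennreal (4 * pi * N)" unfolding N_def by (rule four_pi[OF cN]) simp
    finally show ?thesis .
  qed
  have w: "(\<integral>\<^sup>+x. ennreal (sinh (hyp_dist b x) powr ((p - 6) / 2) * v x powr p) \<partial>hyp_volume) \<le> ennreal (4 * pi * X)"
  proof -
    have "(\<integral>\<^sup>+x. ennreal (sinh (hyp_dist b x) powr ((p - 6) / 2) * v x powr p) \<partial>hyp_volume) =
      (\<integral>\<^sup>+t. ennreal (4 * pi * ((sinh t)\<^sup>2 * (sinh t powr ((p - 6) / 2) * f t powr p))) * indicator {0..} t \<partial>lborel)"
      by (rule polar) (auto simp: f(5))
    also have "\<dots> \<le> (\<integral>\<^sup>+t. ennreal (4 * pi * (F t powr p * sinh t powr ((p - 2) / 2))) * indicator {0..R'} t \<partial>lborel)"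
    proof (intro nn_integral_mono le)
      fix t :: real assume t: "0 \<le> t" "t \<le> R'"
      have "(sinh t)\<^sup>2 * sinh t powr ((p - 6) / 2) = sinh t powr ((p - 2) / 2)"
      proof (cases "t = 0")
        case False
        then have "(sinh t)\<^sup>2 * sinh t powr ((p - 6) / 2) = sinh t powr (2 + (p - 6) / 2)"
          using t by (simp add: powr_add)
        also have "2 + (p - 6) / 2 = (p - 2) / 2" by (simp add: field_simps)
        finally show ?thesis .
      qed simp
      then have "(sinh t)\<^sup>2 * (sinh t powr ((p - 6) / 2) * f t powr p) = f t powr p * sinh t powr ((p - 2) / 2)"
        by (metis mult.assoc mult.commute)
      also have "\<dots> \<le> F t powr p * sinh t powr ((p - 2) / 2)"
        using p Ff f(2) by (intro mult_right_mono powr_mono2) auto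
      finally show "(sinh t)\<^sup>2 * (sinh t powr ((p - 6) / 2) * f t powr p) \<le> F t powr p * sinh t powr ((p - 2) / 2)" .
    qed (use fR' p in auto)
    also have "\<dots> = ennreal (4 * pi * X)" unfolding X_def by (rule four_pi[OF cX]) simp
    finally show ?thesis .
  qed
  have e: "ennreal (\<eta>\<^sup>2 * (4 * pi * E)) \<le> (\<integral>\<^sup>+x. ennreal ((ball_sup \<eta> v x - v x)\<^sup>2) \<partial>hyp_volume)"
  proof -
    have "ennreal (\<eta>\<^sup>2 * (4 * pi * E)) = ennreal (4 * pi * integral {0..R'} (\<lambda>r. \<eta>\<^sup>2 * ((F' r)\<^sup>2 * (sinh r)\<^sup>2)))"
      unfolding E_def by (simp add: mult_ac)
    also have "\<dots> = (\<integral>\<^sup>+t. ennreal (4 * pi * (\<eta>\<^sup>2 * ((F' t)\<^sup>2 * (sinh t)\<^sup>2))) * indicator {0..R'} t \<partial>lborel)"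
      by (rule four_pi[symmetric]) (auto intro!: continuous_intros cE)
    also have "\<dots> \<le> (\<integral>\<^sup>+t. ennreal (4 * pi * ((sinh t)\<^sup>2 * (f (t - \<eta>) - f t)\<^sup>2)) * indicator {0..} t \<partial>lborel)"
    proof (intro nn_integral_mono)
      fix t
      have eq: "\<eta>\<^sup>2 * ((F' t)\<^sup>2 * (sinh t)\<^sup>2) = (sinh t)\<^sup>2 * (f (t - \<eta>) - f t)\<^sup>2"
        using \<eta> by (simp add: F'_def power_divide power2_commute)
      show "ennreal (4 * pi * (\<eta>\<^sup>2 * ((F' t)\<^sup>2 * (sinh t)\<^sup>2))) * indicator {0..R'} t \<le>
        ennreal (4 * pi * ((sinh t)\<^sup>2 * (f (t - \<eta>) - f t)\<^sup>2)) * indicator {0..} t"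
        unfolding eq by (auto simp: indicator_def)
    qed
    also have "\<dots> = (\<integral>\<^sup>+x. ennreal ((f (hyp_dist b x - \<eta>) - f (hyp_dist b x))\<^sup>2) \<partial>hyp_volume)"
      by (rule polar[symmetric]) auto
    also have "\<dots> \<le> (\<integral>\<^sup>+x. ennreal ((ball_sup \<eta> v x - v x)\<^sup>2) \<partial>hyp_volume)"
    proof (rule nn_integral_mono_AE)
      show "AE x in hyp_volume. ennreal ((f (hyp_dist b x - \<eta>) - f (hyp_dist b x))\<^sup>2) \<le> ennreal ((ball_sup \<eta> v x - v x)\<^sup>2)"
        using AE_hyp_volume_H3
      proof eventually_elim
        case (elim x)
        have "f (hyp_dist b x) \<le> f (hyp_dist b x - \<eta>)" using \<eta> by (intro f(4)) auto
        then show ?case using f(5,6)[OF elim] by (intro ennreal_leI power_mono) auto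
      qed
    qed
    finally show ?thesis .
  qed
  have "4 * pi * N + sharp_constant p * (4 * pi * X) powr (2 / p) \<le> 4 * pi * E"
  proof -
    \<comment> \<open>The power of \<open>4 * pi\<close> split off in
      \<open>sharp_constant_bliss_gap\<close> is absorbed here: the energy carries
      \<open>4 * pi\<close> once, the weighted integral under the power
      \<open>2 / p\<close>.\<close>
    have "(4 * pi) powr (2 / p) = 4 * pi / (4 * pi) powr ((p - 2) / p)"
    proof -
      have "2 / p = 1 - (p - 2) / p" using p by (simp add: field_simps)
      then show ?thesis by (simp add: powr_diff)
    qed
    then have "sharp_constant p * (4 * pi * X) powr (2 / p) = 4 * pi * (sharp_constant p / (4 * pi) powr ((p - 2) / p) * X powr (2 / p))"
      using X0 by (simp add: powr_mult)
    then have "4 * pi * N + sharp_constant p * (4 * pi * X) powr (2 / p) =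
        4 * pi * (N + sharp_constant p / (4 * pi) powr ((p - 2) / p) * X powr (2 / p))"
      by (simp add: distrib_left)
    also have "\<dots> \<le> 4 * pi * E" using bl by (intro mult_left_mono) auto
    finally show ?thesis .
  qed
  then have "ennreal (\<eta>\<^sup>2 * (4 * pi * N + sharp_constant p * (4 * pi * X) powr (2 / p))) \<le> ennreal (\<eta>\<^sup>2 * (4 * pi * E))"
    by (intro ennreal_leI mult_left_mono) auto
  then show thesis using that[OF _ _ n w] e N0 X0 order_trans by fastforce
qed

section \<open>The hyperbolic inequality\<close>

lemma test_function_grad:
  assumes u: "u \<in> test_functions U"
  shows "(u has_derivative (\<lambda>w. grad u x \<bullet> w)) (at x)" and "continuous_on UNIV (grad u)"
    and "continuous_on UNIV u"
proof -
  have sm: "smooth u" using u by (simp add: test_functions_def)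
  have cd: "continuously_differentiable (Suc 0) u" using sm unfolding smooth_def by blast
  then have d: "u differentiable (at x)" for x by simp
  show "(u has_derivative (\<lambda>w. grad u x \<bullet> w)) (at x)"
    using d[of x, unfolded frechet_derivative_works] unfolding grad_inner[OF d] .
  show "continuous_on UNIV u"
    using d by (simp add: continuous_on_eq_continuous_at differentiable_imp_continuous_within)
  have "continuous_on UNIV (\<lambda>x. frechet_derivative u (at x) w)" for w using cd by simp
  then show "continuous_on UNIV (grad u)"
    unfolding grad_def[abs_def] by (intro continuous_on_vec_lambda)
qed

lemma test_function_support:
  assumes u: "u \<in> test_functions U"
  obtains S where "compact S" "S \<subseteq> U" "\<And>x. x \<notin> S \<Longrightarrow> u x = 0" "\<And>x. x \<notin> S \<Longrightarrow> grad u x = 0"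
proof -
  define S where "S = closure {x. u x \<noteq> 0}"
  have S: "compact S" "S \<subseteq> U" using u by (auto simp: test_functions_def S_def)
  have z: "u x = 0" if "x \<notin> S" for x
    using that closure_subset[of "{x. u x \<noteq> 0}"] unfolding S_def by blast
  have g: "grad u x = 0" if x: "x \<notin> S" for x
  proof -
    have "((\<lambda>_. 0::real) has_derivative (\<lambda>_. 0)) (at x)" by (rule has_derivative_const)
    then have "(u has_derivative (\<lambda>_. 0)) (at x)"
    proof (rule has_derivative_transform_within_open)
      show "open (- S)" using compact_imp_closed[OF S(1)] by (simp add: open_Compl)
    qed (use x z in simp_all)
    with test_function_grad(1)[OF u] have "(\<lambda>w. grad u x \<bullet> w) = (\<lambda>_. 0)"
      by (rule has_derivative_unique)
    from fun_cong[OF this, of "grad u x"] show ?thesis by simp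
  qed
  show thesis by (rule that[OF S z g])
qed

lemma test_function_bounded:
  assumes u: "u \<in> test_functions U"
  obtains M where "0 < M" "\<And>x. \<bar>u x\<bar> \<le> M" "\<And>x. norm (grad u x) \<le> M"
proof -
  obtain S where S: "compact S" "S \<subseteq> U" "\<And>x. x \<notin> S \<Longrightarrow> u x = 0" "\<And>x. x \<notin> S \<Longrightarrow> grad u x = 0"
    by (rule test_function_support[OF u]) (rule that; assumption)
  have "compact (u ` S)" "compact (grad u ` S)"
    by (rule compact_continuous_image[OF continuous_on_subset[OF test_function_grad(3)[OF u]] S(1)], simp,
        rule compact_continuous_image[OF continuous_on_subset[OF test_function_grad(2)[OF u]] S(1)], simp)
  then have b: "bounded (u ` S)" "bounded (grad u ` S)" by (simp_all add: compact_imp_bounded)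
  obtain M1 where M1: "\<forall>x\<in>u ` S. norm x \<le> M1" using b(1) unfolding bounded_iff by blast
  obtain M2 where M2: "\<forall>x\<in>grad u ` S. norm x \<le> M2" using b(2) unfolding bounded_iff by blast
  have M: "\<bar>u x\<bar> \<le> M1" "norm (grad u x) \<le> M2" if "x \<in> S" for x
    using M1 M2 that by auto
  have "\<bar>u x\<bar> \<le> max 1 (max M1 M2)" for x using M(1)[of x] S(3)[of x] by (cases "x \<in> S") auto
  moreover have "norm (grad u x) \<le> max 1 (max M1 M2)" for x using M(2)[of x] S(4)[of x] by (cases "x \<in> S") auto
  ultimately show thesis using that[of "max 1 (max M1 M2)"] by auto
qed

lemma test_function_increment:
  assumes u: "u \<in> test_functions U" and C: "convex C" and x: "x \<in> C" and y: "y \<in> C"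
    and B: "\<And>z. z \<in> C \<Longrightarrow> norm (grad u z) \<le> B"
  shows "\<bar>u y - u x\<bar> \<le> B * norm (y - x)"
proof -
  have "norm (u y - u x) \<le> B * norm (y - x)"
  proof (rule differentiable_bound[OF C])
    show "(u has_derivative (\<lambda>w. grad u z \<bullet> w)) (at z within C)" for z
      using test_function_grad(1)[OF u] by (rule has_derivative_at_withinI)
    show "onorm (\<lambda>w. grad u z \<bullet> w) \<le> B" if "z \<in> C" for z
    proof (rule onorm_le)
      fix w
      have "norm (grad u z \<bullet> w) \<le> norm (grad u z) * norm w" using Cauchy_Schwarz_ineq2 by simp
      also have "\<dots> \<le> B * norm w" using B[OF that] by (intro mult_right_mono) auto
      finally show "norm (grad u z \<bullet> w) \<le> B * norm w" .
    qed
  qed (use x y in auto)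
  then show ?thesis by simp
qed

text \<open>The point is that \<open>d\<close> does not depend on \<open>x\<close>. The gradient
  vanishes outside a compact set, hence oscillates by at most \<open>e\<close> on all balls of one
  small radius, and the mean value estimate is applied on such a ball.\<close>

lemma test_function_local_increment:
  assumes u: "u \<in> test_functions U" and e: "0 < e"
  obtains d where "0 < d" "\<And>x y. norm (y - x) < d \<Longrightarrow> \<bar>u y - u x\<bar> \<le> (norm (grad u x) + e) * norm (y - x)"
proof -
  obtain S where S: "compact S" "S \<subseteq> U" "\<And>x. x \<notin> S \<Longrightarrow> u x = 0" "\<And>x. x \<notin> S \<Longrightarrow> grad u x = 0"
    by (rule test_function_support[OF u]) (rule that; assumption)
  obtain r where r: "\<And>x. x \<in> S \<Longrightarrow> norm x \<le> r"
    using compact_imp_bounded[OF S(1)] unfolding bounded_iff by blast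
  have uc: "uniformly_continuous_on (cball 0 (r + 1)) (grad u)"
    by (rule compact_uniformly_continuous[OF continuous_on_subset[OF test_function_grad(2)[OF u]]]) auto
  obtain d where d: "d > 0" "\<And>x y. x \<in> cball 0 (r + 1) \<Longrightarrow> y \<in> cball 0 (r + 1) \<Longrightarrow> dist y x < d \<Longrightarrow> dist (grad u y) (grad u x) < e"
    using uc[unfolded uniformly_continuous_on_def, rule_format, OF e] by blast
  have g: "norm (grad u z) \<le> norm (grad u x) + e" if zx: "norm (z - x) < min d 1" for z x
  proof (cases "z \<in> S")
    case True
    have "norm x \<le> norm z + norm (z - x)" using norm_triangle_sub[of x z] by (simp add: norm_minus_commute)
    then have "x \<in> cball 0 (r + 1)" "z \<in> cball 0 (r + 1)" using r[OF True] zx by auto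
    then have "dist (grad u z) (grad u x) < e" using zx by (intro d(2)) (auto simp: dist_norm)
    then show ?thesis using norm_triangle_sub[of "grad u z" "grad u x"] by (simp add: dist_norm)
  qed (use S(4) e in simp)
  show thesis
  proof (rule that[of "min d 1"])
    fix x y :: "real^3" assume "norm (y - x) < min d 1"
    then show "\<bar>u y - u x\<bar> \<le> (norm (grad u x) + e) * norm (y - x)"
      using d(1) by (intro test_function_increment[OF u convex_ball[of x "min d 1"]] g)
         (auto simp: dist_norm norm_minus_commute)
  qed (use d in auto)
qed

lemma compact_H3_height:
  assumes S: "compact S" "S \<subseteq> H3"
  obtains a where "0 < a" "\<And>x. x \<in> S \<Longrightarrow> a \<le> x $ 3" "\<And>x. x \<in> S \<Longrightarrow> norm x \<le> 1 / a"
proof (cases "S = {}")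
  case False
  have "continuous_on S (\<lambda>x. x $ 3)" by (intro continuous_intros)
  then obtain z where z: "z \<in> S" "\<And>x. x \<in> S \<Longrightarrow> z $ 3 \<le> x $ 3"
    using continuous_attains_inf[OF S(1) False] by blast
  have z3: "z $ 3 > 0" using z(1) S(2) by (auto simp: H3_def)
  obtain r where r: "\<And>x. x \<in> S \<Longrightarrow> norm x \<le> r" "r > 0"
    using compact_imp_bounded[OF S(1)] unfolding bounded_pos by blast
  define a where "a = min (z $ 3) (1 / r)"
  have "a > 0" using z3 r by (simp add: a_def)
  moreover have "r \<le> 1 / a"
  proof -
    have "a \<le> 1 / r" by (simp add: a_def)
    then have "a * r \<le> 1" using r(2) by (simp add: pos_le_divide_eq)
    then show ?thesis using \<open>a > 0\<close> by (simp add: pos_le_divide_eq mult.commute)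
  qed
  moreover have "a \<le> z $ 3" by (simp add: a_def)
  ultimately show thesis using that[of a] z(2) r(1) order_trans by blast
qed (use that[of 1] in auto)

lemma emeasure_hyp_volume_compact:
  assumes S: "compact S" "S \<subseteq> H3"
  shows "emeasure hyp_volume S < \<infinity>"
proof -
  obtain a where a: "0 < a" "\<And>x. x \<in> S \<Longrightarrow> a \<le> x $ 3" "\<And>x. x \<in> S \<Longrightarrow> norm x \<le> 1 / a"
    by (rule compact_H3_height[OF S]) (rule that; assumption)
  have Sb [measurable]: "S \<in> sets borel" using S(1) by (simp add: borel_compact)
  have "emeasure hyp_volume S = (\<integral>\<^sup>+x. ennreal (indicator H3 x / (x $ 3) ^ 3) * indicator S x \<partial>lborel)"
    unfolding hyp_volume_def by (rule emeasure_density) auto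
  also have "\<dots> \<le> (\<integral>\<^sup>+x. ennreal (1 / a ^ 3) * indicator S x \<partial>lborel)"
  proof (intro nn_integral_mono)
    fix x
    have "indicator H3 x / (x $ 3) ^ 3 \<le> 1 / a ^ 3" if "x \<in> S"
    proof -
      have "a ^ 3 \<le> (x $ 3) ^ 3" using a that by (intro power_mono) auto
      then show ?thesis using a(1) by (intro frac_le) (auto simp: indicator_def)
    qed
    then show "ennreal (indicator H3 x / (x $ 3) ^ 3) * indicator S x \<le> ennreal (1 / a ^ 3) * indicator S x"
      by (auto simp: indicator_def intro!: ennreal_leI)
  qed
  also have "\<dots> = ennreal (1 / a ^ 3) * emeasure lborel S" by (simp add: nn_integral_cmult_indicator)
  also have "\<dots> < \<infinity>"
    using emeasure_compact_finite[OF S(1)] by (simp add: ennreal_mult_less_top)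
  finally show ?thesis .
qed

lemma integrable_hyp_volume_compact_support:
  fixes f :: "real^3 \<Rightarrow> real"
  assumes S: "compact S" "S \<subseteq> H3" and f: "f \<in> borel_measurable borel"
    and bd: "\<And>x. \<bar>f x\<bar> \<le> M" and off: "\<And>x. x \<notin> S \<Longrightarrow> f x = 0"
  shows "integrable hyp_volume f"
proof -
  have "integrable hyp_volume (\<lambda>x. indicator S x *\<^sub>R f x)"
    by (rule integrableI_bounded_set_indicator[where B = M])
       (use S f bd emeasure_hyp_volume_compact[OF S] in \<open>auto simp: borel_compact\<close>)
  moreover have "(\<lambda>x. indicator S x *\<^sub>R f x) = f" using off by (auto simp: indicator_def fun_eq_iff)
  ultimately show ?thesis by simp
qed

lemma hyp_metric_hyp_grad_self:
  "x \<in> H3 \<Longrightarrow> hyp_metric x (hyp_grad u x) (hyp_grad u x) = (x $ 3)\<^sup>2 * (norm (grad u x))\<^sup>2"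
  by (simp add: hyp_metric_def hyp_grad_def H3_def power2_norm_eq_inner) (simp add: power2_eq_square power4_eq_xxxx)

text \<open>For bounded heights the identity
  \<open>dist x y = sqrt (hyp_delta x y) * sqrt (x $ 3 * y $ 3)\<close> turns the Euclidean
  Lipschitz bound into the required modulus. If \<open>x\<close> is in the support and
  \<open>y\<close> lies above twice its maximal height bound \<open>h\<close>, then
  \<open>hyp_delta x y \<ge> 1 / 4\<close> and the boundedness of \<open>u\<close> is
  enough.\<close>

lemma admissible_test_function:
  assumes b: "b \<in> H3" and u: "u \<in> test_functions H3"
  obtains R B L where "0 < R" "0 \<le> L" "admissible b R B L (\<lambda>x. \<bar>u x\<bar>)"
proof -
  obtain S where S: "compact S" "S \<subseteq> H3" "\<And>x. x \<notin> S \<Longrightarrow> u x = 0" "\<And>x. x \<notin> S \<Longrightarrow> grad u x = 0"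
    by (rule test_function_support[OF u]) (rule that; assumption)
  obtain M where M: "0 < M" "\<And>x. \<bar>u x\<bar> \<le> M" "\<And>x. norm (grad u x) \<le> M"
    by (rule test_function_bounded[OF u]) (rule that; assumption)
  obtain a where a: "0 < a" "\<And>x. x \<in> S \<Longrightarrow> a \<le> x $ 3" "\<And>x. x \<in> S \<Longrightarrow> norm x \<le> 1 / a"
    by (rule compact_H3_height[OF S(1,2)]) (rule that; assumption)
  define h where "h = 1 / a"
  have h: "0 < h" "\<And>x. x \<in> S \<Longrightarrow> x $ 3 \<le> h"
  proof -
    show "0 < h" using a by (simp add: h_def)
    show "x $ 3 \<le> h" if "x \<in> S" for x
      using a(3)[OF that] component_le_norm_cart[of x 3] by (simp add: h_def)
  qed
  have "bounded ((\<lambda>x. hyp_delta x b) ` S)"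
    by (intro compact_imp_bounded compact_continuous_image S(1) continuous_on_subset[OF continuous_on_hyp_delta[OF b]] S(2))
  then obtain D where D: "\<And>x. x \<in> S \<Longrightarrow> \<bar>hyp_delta x b\<bar> \<le> D" "D > 0"
    unfolding bounded_pos by auto
  define R where "R = arcosh (1 + D)"
  have R: "R > 0" using D by (simp add: R_def)
  have out: "u x = 0" if "x \<in> H3" "R \<le> hyp_dist x b" for x
  proof (rule ccontr)
    assume "u x \<noteq> 0"
    then have "x \<in> S" using S(3) by blast
    then have "hyp_delta x b \<le> D" using D(1) by fastforce
    moreover have "1 + D \<le> cosh (hyp_dist x b)"
      using cosh_real_nonneg_le_iff[of R "hyp_dist x b"] that R hyp_dist_nonneg[OF that(1) b] D
      by (simp add: R_def)
    ultimately show False using D cosh_hyp_dist[OF that(1) b] by simp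
  qed
  \<comment> \<open>Serves both cases of \<open>main\<close>: \<open>2 * (h + 1)\<close> bounds
    \<open>sqrt (x $ 3 * y $ 3)\<close>, and \<open>2 * M\<close> is enough when
    \<open>sqrt (hyp_delta x y) \<ge> 1 / 2\<close>.\<close>
  define L where "L = 2 * M * (h + 1)"
  have main: "\<bar>u x - u y\<bar> \<le> L * sqrt (hyp_delta x y)" if x: "x \<in> S" and y: "y \<in> H3" for x y
  proof -
    have xH: "x \<in> H3" using x S(2) by blast
    then have pos: "x $ 3 > 0" "y $ 3 > 0" using y by (auto simp: H3_def)
    have sq: "dist x y = sqrt (hyp_delta x y) * sqrt (x $ 3 * y $ 3)"
      using pos by (simp add: hyp_delta_def real_sqrt_divide)
    have lip: "\<bar>u x - u y\<bar> \<le> M * dist x y"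
      using test_function_increment[OF u convex_UNIV, of y x M] M(3) by (simp add: dist_norm)
    show ?thesis
    proof (cases "y $ 3 \<le> 2 * h")
      case True
      have "x $ 3 * y $ 3 \<le> h * (2 * h)" using h x True pos by (intro mult_mono) auto
      also have "\<dots> \<le> (2 * (h + 1))\<^sup>2" using h by (simp add: power2_eq_square algebra_simps)
      finally have "sqrt (x $ 3 * y $ 3) \<le> 2 * (h + 1)" using h by (simp add: real_le_lsqrt)
      then have "M * dist x y \<le> M * (sqrt (hyp_delta x y) * (2 * (h + 1)))"
        unfolding sq using M hyp_delta_nonneg[OF xH y] by (intro mult_left_mono) auto
      then show ?thesis using lip by (simp add: L_def mult_ac)
    next
      case False
      have "y $ 3 - x $ 3 \<le> dist x y"
        using component_le_norm_cart[of "y - x" 3] by (simp add: dist_norm norm_minus_commute)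
      moreover have "y $ 3 / 2 \<le> y $ 3 - x $ 3" using False h(2)[OF x] by simp
      ultimately have "(y $ 3 / 2)\<^sup>2 \<le> (dist x y)\<^sup>2" using pos by (intro power_mono) auto
      then have "(y $ 3 / 2)\<^sup>2 / (x $ 3 * y $ 3) \<le> hyp_delta x y"
        unfolding hyp_delta_def using pos by (intro divide_right_mono) auto
      moreover have "(y $ 3 / 2)\<^sup>2 / (x $ 3 * y $ 3) = y $ 3 / x $ 3 / 4"
        using pos by (simp add: power2_eq_square)
      moreover have "1 \<le> y $ 3 / x $ 3" using False h(2)[OF x] pos by (simp add: pos_le_divide_eq)
      ultimately have "y $ 3 / x $ 3 / 4 \<le> hyp_delta x y" "1 / 4 \<le> y $ 3 / x $ 3 / 4" by simp_all
      then have "1 / 4 \<le> hyp_delta x y" by (rule order_trans[rotated])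
      then have "sqrt (1 / 4) \<le> sqrt (hyp_delta x y)" by (rule real_sqrt_le_mono)
      then have s: "1 / 2 \<le> sqrt (hyp_delta x y)" by (simp add: real_sqrt_divide)
      have "u y = 0"
      proof (rule S(3))
        show "y \<notin> S" using False h(1) h(2)[of y] by auto
      qed
      then have "\<bar>u x - u y\<bar> \<le> 2 * M * (1 / 2)" using M by simp
      also have "\<dots> \<le> 2 * M * sqrt (hyp_delta x y)" using s M by (intro mult_left_mono) auto
      also have "\<dots> \<le> L * sqrt (hyp_delta x y)"
        unfolding L_def using M h s hyp_delta_nonneg[OF xH y] by (intro mult_right_mono) (auto simp: mult_le_cancel_left1)
      finally show ?thesis .
    qed
  qed
  have mod: "\<bar>u x - u y\<bar> \<le> L * sqrt (hyp_delta x y)" if x: "x \<in> H3" and y: "y \<in> H3" for x y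
  proof (cases "x \<in> S \<or> y \<in> S")
    case True
    then show ?thesis
      using main[of x y] main[of y x] x y abs_minus_commute[of "u x" "u y"] hyp_delta_commute[of x y] by auto
  next
    case False
    then have "u x = 0" "u y = 0" using S(3) by auto
    then show ?thesis using M h hyp_delta_nonneg[OF x y] by (simp add: L_def)
  qed
  have "admissible b R M L (\<lambda>x. \<bar>u x\<bar>)"
    unfolding admissible_def
  proof (intro conjI allI ballI impI)
    show "\<bar>u x\<bar> = 0" if "x \<notin> H3" for x using that S by auto
    show "\<bar>\<bar>u x\<bar> - \<bar>u y\<bar>\<bar> \<le> L * sqrt (hyp_delta x y)" if "x \<in> H3" "y \<in> H3" for x y
      using mod[OF that] by linarith
  qed (use out M in auto)
  moreover have "0 \<le> L" using M h by (simp add: L_def)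
  ultimately show thesis using that R by blast
qed

text \<open>The Euclidean distance from the centre is largest at the top of the hyperbolic ball, at
  height \<open>x $ 3 * exp \<eta>\<close>. With \<open>t = dist x y / x $ 3\<close> the height of
  \<open>y\<close> is at most \<open>x $ 3 * (1 + t)\<close>, so
  \<open>t^2 / (1 + t) \<le> hyp_delta x y\<close>; the function \<open>t^2 / (1 + t)\<close> is
  increasing and equals \<open>2 * (cosh \<eta> - 1)\<close> at
  \<open>t = exp \<eta> - 1\<close>.\<close>

lemma hyp_ball_euclidean_radius:
  assumes x: "x \<in> H3" and y: "y \<in> H3" and \<eta>: "0 < \<eta>" and d: "hyp_dist x y < \<eta>"
  shows "dist x y < x $ 3 * (exp \<eta> - 1)"
proof -
  define t where "t = dist x y / x $ 3"
  define q where "q = exp \<eta> - 1"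
  have pos: "x $ 3 > 0" "y $ 3 > 0" using x y by (auto simp: H3_def)
  have q: "q > 0" using \<eta> by (simp add: q_def)
  have "hyp_delta x y < 2 * (cosh \<eta> - 1)" using d hyp_dist_less_iff_cosh[OF x y] \<eta> by simp
  also have "2 * (cosh \<eta> - 1) = q\<^sup>2 / (1 + q)"
    by (simp add: cosh_field_def q_def exp_minus field_simps power2_eq_square)
  finally have h: "hyp_delta x y < q\<^sup>2 / (1 + q)" .
  have "y $ 3 \<le> x $ 3 + dist x y"
    using component_le_norm_cart[of "y - x" 3] by (simp add: dist_norm norm_minus_commute)
  moreover have "x $ 3 * (1 + t) = x $ 3 + dist x y" using pos by (simp add: t_def distrib_left)
  ultimately have y3: "y $ 3 \<le> x $ 3 * (1 + t)" by simp
  have t0: "t \<ge> 0" using pos by (simp add: t_def)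
  have "t\<^sup>2 / (1 + t) \<le> hyp_delta x y"
  proof -
    have "t\<^sup>2 / (1 + t) = (dist x y)\<^sup>2 / (x $ 3 * (x $ 3 * (1 + t)))"
      using pos by (simp add: t_def power2_eq_square)
    also have "\<dots> \<le> (dist x y)\<^sup>2 / (x $ 3 * y $ 3)"
      using y3 pos t0 by (intro divide_left_mono mult_left_mono) auto
    finally show ?thesis by (simp add: hyp_delta_def)
  qed
  then have lt: "t\<^sup>2 / (1 + t) < q\<^sup>2 / (1 + q)" using h by simp
  have "t < q"
  proof (rule ccontr)
    assume "\<not> t < q"
    then have tq: "q \<le> t" by simp
    have "q\<^sup>2 * (1 + t) \<le> t\<^sup>2 * (1 + q)"
    proof -
      have "t\<^sup>2 * (1 + q) - q\<^sup>2 * (1 + t) = (t - q) * (t + q + t * q)"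
        by (simp add: power2_eq_square algebra_simps)
      moreover have "0 \<le> (t - q) * (t + q + t * q)" using tq q t0 by simp
      ultimately show ?thesis by linarith
    qed
    then have "q\<^sup>2 / (1 + q) \<le> t\<^sup>2 / (1 + t)" using q t0 by (simp add: pos_divide_le_eq pos_le_divide_eq)
    then show False using lt by simp
  qed
  then show ?thesis using pos by (simp add: t_def q_def pos_divide_less_eq mult.commute)
qed

text \<open>Near the support the supremum exceeds the value by at most
  \<open>(norm (grad u x) + e') * (x $ 3 * q)\<close> with \<open>q = exp \<eta> - 1\<close>. The
  square of this is \<open>q^2\<close> times the hyperbolic energy density, up to an error carried
  by the compact set \<open>K\<close>, whose hyperbolic volume is finite.\<close>

lemma ball_sup_energy_upper:
  assumes u: "u \<in> test_functions H3" and e: "0 < e"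
  shows "\<forall>\<^sub>F \<eta> in at_right 0. (\<integral>\<^sup>+x. ennreal ((ball_sup \<eta> (\<lambda>x. \<bar>u x\<bar>) x - \<bar>u x\<bar>)\<^sup>2) \<partial>hyp_volume)
    \<le> ennreal ((exp \<eta> - 1)\<^sup>2 * ((LINT x|hyp_volume. hyp_metric x (hyp_grad u x) (hyp_grad u x)) + e))"
proof -
  obtain S where S: "compact S" "S \<subseteq> H3" "\<And>x. x \<notin> S \<Longrightarrow> u x = 0" "\<And>x. x \<notin> S \<Longrightarrow> grad u x = 0"
    by (rule test_function_support[OF u]) (rule that; assumption)
  obtain M where M: "0 < M" "\<And>x. \<bar>u x\<bar> \<le> M" "\<And>x. norm (grad u x) \<le> M"
    by (rule test_function_bounded[OF u]) (rule that; assumption)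
  obtain a where a: "0 < a" "\<And>x. x \<in> S \<Longrightarrow> a \<le> x $ 3" "\<And>x. x \<in> S \<Longrightarrow> norm x \<le> 1 / a"
    by (rule compact_H3_height[OF S(1,2)]) (rule that; assumption)
  define h where "h = 1 / a"
  have h: "h > 0" using a by (simp add: h_def)
  have Sh: "x $ 3 \<le> h" if "x \<in> S" for x
    using a(3)[OF that] component_le_norm_cart[of x 3] by (simp add: h_def)
  \<comment> \<open>A compact neighbourhood of the support, independent of \<open>\<eta>\<close>:
    for \<open>q < 1 / 2\<close> every ball that meets the support has its centre in
    \<open>K\<close>.\<close>
  define K where "K = {x :: real^3. a / 2 \<le> x $ 3 \<and> x $ 3 \<le> 2 * h \<and> norm x \<le> 2 * h}"
  have "closed K" unfolding K_def by (intro closed_Collect_conj closed_Collect_le continuous_intros)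
  moreover have "bounded K" by (rule boundedI[of _ "2 * h"]) (simp add: K_def)
  ultimately have K: "compact K" by (simp add: compact_eq_bounded_closed)
  have KH: "K \<subseteq> H3" using a by (auto simp: K_def H3_def)
  have SK: "S \<subseteq> K" using a Sh h by (force simp: K_def h_def)
  have Kb [measurable]: "K \<in> sets borel" using K by (simp add: borel_compact)
  have Kfin: "emeasure hyp_volume K < \<infinity>" by (rule emeasure_hyp_volume_compact[OF K KH])
  define V where "V = measure hyp_volume K"
  have V: "emeasure hyp_volume K = ennreal V" "0 \<le> V"
    using Kfin by (auto simp: V_def emeasure_eq_ennreal_measure)
  define Q where "Q = (\<lambda>x. (x $ 3)\<^sup>2 * (norm (grad u x))\<^sup>2)"
  have gb [measurable]: "grad u \<in> borel_measurable borel"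
    by (rule borel_measurable_continuous_onI[OF test_function_grad(2)[OF u]])
  have Qb [measurable]: "Q \<in> borel_measurable borel" unfolding Q_def by measurable
  have Q0: "0 \<le> Q x" for x by (simp add: Q_def)
  have Qint: "integrable hyp_volume Q"
  proof (rule integrable_hyp_volume_compact_support[OF S(1,2) Qb])
    show "\<bar>Q x\<bar> \<le> h\<^sup>2 * M\<^sup>2" for x
    proof (cases "x \<in> S")
      case True
      then have "(x $ 3)\<^sup>2 \<le> h\<^sup>2" using a(1) a(2)[OF True] Sh[OF True] by (intro power_mono) auto
      moreover have "(norm (grad u x))\<^sup>2 \<le> M\<^sup>2" using M(3) by (intro power_mono) auto
      ultimately show ?thesis by (simp add: Q_def mult_mono)
    qed (use S(4) in \<open>simp add: Q_def\<close>)
    show "Q x = 0" if "x \<notin> S" for x using S(4)[OF that] by (simp add: Q_def)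
  qed
  define E where "E = (LINT x|hyp_volume. hyp_metric x (hyp_grad u x) (hyp_grad u x))"
  have EQ: "E = integral\<^sup>L hyp_volume Q"
  proof -
    have "(\<lambda>x. hyp_metric x (hyp_grad u x) (hyp_grad u x)) \<in> borel_measurable borel"
      unfolding hyp_metric_def hyp_grad_def by measurable
    then show ?thesis
      unfolding E_def Q_def
      by (intro integral_cong_AE) (use AE_hyp_volume_H3 Qb[unfolded Q_def] in \<open>auto elim!: eventually_mono simp: hyp_metric_hyp_grad_self\<close>)
  qed
  \<comment> \<open>\<open>(2 * M + 1) * e'\<close> bounds the cross term and the square of
    \<open>e'\<close>, and \<open>4 * h^2\<close> the square of the height on \<open>K\<close>. Then
    \<open>e'\<close> is made so small that the total error \<open>k * e' * V\<close> stays below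
    \<open>e\<close>.\<close>
  define k where "k = (2 * M + 1) * (4 * h\<^sup>2)"
  have k: "k > 0" using M h by (simp add: k_def)
  define e' where "e' = min 1 (e / (k * (V + 1)))"
  have e': "0 < e'" "e' \<le> 1" "k * e' * V \<le> e"
  proof -
    show "0 < e'" "e' \<le> 1" using e k V by (auto simp: e'_def)
    have "e' \<le> e / (k * (V + 1))" by (simp add: e'_def)
    then have "e' * (k * (V + 1)) \<le> e" using k V by (simp add: pos_le_divide_eq)
    moreover have "k * e' * V \<le> e' * (k * (V + 1))" using k \<open>0 < e'\<close> V by (simp add: algebra_simps)
    ultimately show "k * e' * V \<le> e" by simp
  qed
  obtain d where d: "0 < d" "\<And>x y. norm (y - x) < d \<Longrightarrow> \<bar>u y - u x\<bar> \<le> (norm (grad u x) + e') * norm (y - x)"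
    by (rule test_function_local_increment[OF u e'(1)]) (rule that; assumption)
  have "((\<lambda>\<eta>::real. exp \<eta> - 1) \<longlongrightarrow> exp 0 - 1) (at_right 0)"
    by (intro tendsto_intros)
  then have "\<forall>\<^sub>F \<eta>::real in at_right 0. exp \<eta> - 1 < min (1 / 2) (d / (2 * h))"
    using d h by (intro order_tendstoD(2)) auto
  moreover have "\<forall>\<^sub>F \<eta>::real in at_right 0. 0 < \<eta>" by (simp add: eventually_at_right_less)
  ultimately show ?thesis
  proof eventually_elim
    case (elim \<eta>)
    define q where "q = exp \<eta> - 1"
    have q: "0 < q" "q < 1 / 2" "2 * h * q < d"
      using elim h by (auto simp: q_def pos_less_divide_eq mult.commute)
    have pw: "(ball_sup \<eta> (\<lambda>x. \<bar>u x\<bar>) x - \<bar>u x\<bar>)\<^sup>2 \<le> q\<^sup>2 * (Q x + k * e' * indicator K x)" if x: "x \<in> H3" for x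
    proof -
      have x3: "x $ 3 > 0" using x by (simp add: H3_def)
      have ge: "\<bar>u x\<bar> \<le> ball_sup \<eta> (\<lambda>x. \<bar>u x\<bar>) x"
        by (rule ball_sup_ge[OF x elim(2), where B = M]) (rule M(2))
      have rad: "norm (y - x) < x $ 3 * q" if "y \<in> H3" "hyp_dist x y < \<eta>" for y
        using hyp_ball_euclidean_radius[OF x that(1) elim(2) that(2)] by (simp add: q_def dist_norm norm_minus_commute)
      show ?thesis
      proof (cases "x \<in> K")
        case True
        have x2h: "x $ 3 \<le> 2 * h" using True by (simp add: K_def)
        have "ball_sup \<eta> (\<lambda>x. \<bar>u x\<bar>) x \<le> \<bar>u x\<bar> + (norm (grad u x) + e') * (x $ 3 * q)"
        proof (rule ball_sup_least[OF x elim(2)])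
          fix y assume y: "y \<in> H3" "hyp_dist x y < \<eta>"
          have "x $ 3 * q \<le> 2 * h * q" using x2h q by (intro mult_right_mono) auto
          then have "norm (y - x) < d" using rad[OF y] q by linarith
          then have "\<bar>u y - u x\<bar> \<le> (norm (grad u x) + e') * norm (y - x)" by (rule d(2))
          also have "\<dots> \<le> (norm (grad u x) + e') * (x $ 3 * q)"
            using rad[OF y] e' by (intro mult_left_mono) auto
          finally show "\<bar>u y\<bar> \<le> \<bar>u x\<bar> + (norm (grad u x) + e') * (x $ 3 * q)" by linarith
        qed
        then have "(ball_sup \<eta> (\<lambda>x. \<bar>u x\<bar>) x - \<bar>u x\<bar>)\<^sup>2 \<le> ((norm (grad u x) + e') * (x $ 3 * q))\<^sup>2"
          using ge by (intro power_mono) auto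
        also have "\<dots> = q\<^sup>2 * (Q x + (2 * norm (grad u x) * e' + e' * e') * (x $ 3)\<^sup>2)"
          by (simp add: Q_def power2_eq_square algebra_simps)
        also have "\<dots> \<le> q\<^sup>2 * (Q x + k * e')"
        proof (intro mult_left_mono add_left_mono)
          have "2 * norm (grad u x) * e' + e' * e' \<le> 2 * M * e' + 1 * e'"
            using M(3)[of x] e' by (intro add_mono mult_right_mono) auto
          moreover have "(x $ 3)\<^sup>2 \<le> (2 * h)\<^sup>2" using x2h x3 by (intro power_mono) auto
          ultimately have "(2 * norm (grad u x) * e' + e' * e') * (x $ 3)\<^sup>2 \<le> (2 * M * e' + 1 * e') * (2 * h)\<^sup>2"
            using e' M by (intro mult_mono) auto
          also have "\<dots> = k * e'" by (simp add: k_def power2_eq_square algebra_simps)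
          finally show "(2 * norm (grad u x) * e' + e' * e') * (x $ 3)\<^sup>2 \<le> k * e'" .
        qed simp
        finally show ?thesis using True by simp
      next
        case False
        have "y \<notin> S" if y: "y \<in> H3" "hyp_dist x y < \<eta>" for y
        proof
          assume yS: "y \<in> S"
          have n: "norm (y - x) < x $ 3 * q" by (rule rad[OF y])
          have "x $ 3 * q \<le> x $ 3 * (1 / 2)" using q x3 by (intro mult_left_mono) auto
          then have n2: "norm (y - x) < x $ 3 / 2" using n by simp
          have c: "\<bar>y $ 3 - x $ 3\<bar> \<le> norm (y - x)" using component_le_norm_cart[of "y - x" 3] by simp
          have "x $ 3 \<le> 2 * h" using c n2 Sh[OF yS] by linarith
          moreover have "a / 2 \<le> x $ 3" using c n2 a(2)[OF yS] x3 by linarith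
          moreover have "norm x \<le> 2 * h"
          proof -
            have "norm x \<le> norm y + norm (y - x)" using norm_triangle_sub[of x y] by (simp add: norm_minus_commute)
            moreover have "norm y \<le> h" using a(3)[OF yS] by (simp add: h_def)
            ultimately show ?thesis using n2 \<open>x $ 3 \<le> 2 * h\<close> by linarith
          qed
          ultimately show False using False by (simp add: K_def)
        qed
        then have "ball_sup \<eta> (\<lambda>x. \<bar>u x\<bar>) x \<le> 0"
          by (intro ball_sup_least[OF x elim(2)]) (use S(3) in auto)
        then have "ball_sup \<eta> (\<lambda>x. \<bar>u x\<bar>) x - \<bar>u x\<bar> = 0" using ge by linarith
        then show ?thesis using Q0[of x] False by simp
      qed
    qed
    have int: "integrable hyp_volume (\<lambda>x. q\<^sup>2 * (Q x + k * e' * indicator K x))"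
      using Qint Kfin by (intro integrable_mult_right integrable_add integrable_real_indicator) auto
    have "(\<integral>\<^sup>+x. ennreal ((ball_sup \<eta> (\<lambda>x. \<bar>u x\<bar>) x - \<bar>u x\<bar>)\<^sup>2) \<partial>hyp_volume) \<le>
        (\<integral>\<^sup>+x. ennreal (q\<^sup>2 * (Q x + k * e' * indicator K x)) \<partial>hyp_volume)"
      by (rule nn_integral_mono_AE) (use AE_hyp_volume_H3 pw in \<open>auto elim!: eventually_mono intro!: ennreal_leI\<close>)
    also have "\<dots> = ennreal (LINT x|hyp_volume. q\<^sup>2 * (Q x + k * e' * indicator K x))"
      using Q0 k e' by (intro nn_integral_eq_integral int AE_I2 mult_nonneg_nonneg add_nonneg_nonneg) auto
    also have "(LINT x|hyp_volume. q\<^sup>2 * (Q x + k * e' * indicator K x)) = q\<^sup>2 * (E + k * e' * V)"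
      using Qint Kfin by (simp add: EQ V_def integral_add)
    also have "ennreal (q\<^sup>2 * (E + k * e' * V)) \<le> ennreal (q\<^sup>2 * (E + e))"
      using e' by (intro ennreal_leI mult_left_mono) auto
    finally show ?case by (simp add: q_def E_def)
  qed
qed

lemma sharp_constant_nonneg: "2 < p \<Longrightarrow> 0 \<le> sharp_constant p"
  by (simp add: sharp_constant_def)

text \<open>Valid at every single \<open>\<eta>\<close>: rearrangement does not raise the energy and
  does not lower the two integrals, and the radial function satisfies the bound exactly.\<close>

lemma ball_sup_energy_lower:
  assumes b: "b \<in> H3" and p: "2 < p" "p \<le> 6" and u: "u \<in> test_functions H3" and \<eta>: "0 < \<eta>"
  shows "ennreal (\<eta>\<^sup>2 * ((LINT x|hyp_volume. (u x)\<^sup>2) + sharp_constant p *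
      (LINT x|hyp_volume. sinh (hyp_dist b x) powr ((p - 6) / 2) * \<bar>u x\<bar> powr p) powr (2 / p)))
    \<le> (\<integral>\<^sup>+x. ennreal ((ball_sup \<eta> (\<lambda>x. \<bar>u x\<bar>) x - \<bar>u x\<bar>)\<^sup>2) \<partial>hyp_volume)"
proof -
  define v0 where "v0 = (\<lambda>x. \<bar>u x\<bar>)"
  obtain R B L where RL: "0 < R" "0 \<le> L" and a0: "admissible b R B L v0"
    by (rule admissible_test_function[OF b u, folded v0_def]) (rule that; assumption)
  have [measurable]: "v0 \<in> borel_measurable borel" by (rule admissible_borel[OF a0])
  obtain v where v: "admissible b R B L v"
    "(\<integral>\<^sup>+x. ennreal ((v0 x)\<^sup>2) \<partial>hyp_volume) \<le> (\<integral>\<^sup>+x. ennreal ((v x)\<^sup>2) \<partial>hyp_volume)"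
    "(\<integral>\<^sup>+x. ennreal (sinh (hyp_dist b x) powr ((p - 6) / 2) * v0 x powr p) \<partial>hyp_volume) \<le>
     (\<integral>\<^sup>+x. ennreal (sinh (hyp_dist b x) powr ((p - 6) / 2) * v x powr p) \<partial>hyp_volume)"
    "(\<integral>\<^sup>+x. ennreal ((ball_sup \<eta> v x - v x)\<^sup>2) \<partial>hyp_volume) \<le>
     (\<integral>\<^sup>+x. ennreal ((ball_sup \<eta> v0 x - v0 x)\<^sup>2) \<partial>hyp_volume)"
    "\<And>x y. x \<in> H3 \<Longrightarrow> y \<in> H3 \<Longrightarrow> hyp_dist x b < hyp_dist y b \<Longrightarrow> v y \<le> v x"
    by (rule radial_rearrangement[OF b \<eta> p RL a0]) (rule that; assumption)
  obtain n w where nw: "0 \<le> n" "0 \<le> w"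
    "(\<integral>\<^sup>+x. ennreal ((v x)\<^sup>2) \<partial>hyp_volume) \<le> ennreal n"
    "(\<integral>\<^sup>+x. ennreal (sinh (hyp_dist b x) powr ((p - 6) / 2) * v x powr p) \<partial>hyp_volume) \<le> ennreal w"
    "ennreal (\<eta>\<^sup>2 * (n + sharp_constant p * w powr (2 / p))) \<le> (\<integral>\<^sup>+x. ennreal ((ball_sup \<eta> v x - v x)\<^sup>2) \<partial>hyp_volume)"
  proof (rule radial_energy_bound[OF b \<eta> p(1) RL(1) v(1)])
    show "v y \<le> v x" if "x \<in> H3" "y \<in> H3" "hyp_dist x b < hyp_dist y b" for x y
      using that by (rule v(5))
  qed (rule that; assumption)
  define N W where "N = (LINT x|hyp_volume. (v0 x)\<^sup>2)"
    and "W = (LINT x|hyp_volume. sinh (hyp_dist b x) powr ((p - 6) / 2) * v0 x powr p)"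
  have "N = enn2real (\<integral>\<^sup>+x. ennreal ((v0 x)\<^sup>2) \<partial>hyp_volume)"
    unfolding N_def by (rule integral_eq_nn_integral) auto
  also have "\<dots> \<le> n" using order_trans[OF v(2) nw(3)] nw(1) by (intro enn2real_leI)
  finally have Nn: "N \<le> n" .
  have "W = enn2real (\<integral>\<^sup>+x. ennreal (sinh (hyp_dist b x) powr ((p - 6) / 2) * v0 x powr p) \<partial>hyp_volume)"
    unfolding W_def by (rule integral_eq_nn_integral) auto
  also have "\<dots> \<le> w" using order_trans[OF v(3) nw(4)] nw(2) by (intro enn2real_leI)
  finally have Ww: "W \<le> w" .
  have W0: "0 \<le> W" unfolding W_def by (rule Bochner_Integration.integral_nonneg) auto
  have "\<eta>\<^sup>2 * (N + sharp_constant p * W powr (2 / p)) \<le> \<eta>\<^sup>2 * (n + sharp_constant p * w powr (2 / p))"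
    using Nn Ww W0 p sharp_constant_nonneg[OF p(1)] by (intro mult_left_mono add_mono powr_mono2) auto
  then have "ennreal (\<eta>\<^sup>2 * (N + sharp_constant p * W powr (2 / p))) \<le> (\<integral>\<^sup>+x. ennreal ((ball_sup \<eta> v0 x - v0 x)\<^sup>2) \<partial>hyp_volume)"
    by (rule order_trans[OF ennreal_leI order_trans[OF nw(5) v(4)]])
  then show ?thesis unfolding N_def W_def v0_def by simp
qed

text \<open>For small \<open>\<eta>\<close> the two bounds on the energy of suprema give
  \<open>\<eta>^2 * T \<le> (exp \<eta> - 1)^2 * (E + e)\<close>, and
  \<open>(exp \<eta> - 1) / \<eta>\<close> tends to 1.\<close>

lemma hyperbolic_inequality_sharp_constant:
  assumes b: "b \<in> H3" and p: "2 < p" "p \<le> 6"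
  shows "hyperbolic_inequality b p (sharp_constant p)"
  unfolding hyperbolic_inequality_def
proof
  fix u assume u: "u \<in> test_functions H3"
  define E where "E = (LINT x|hyp_volume. hyp_metric x (hyp_grad u x) (hyp_grad u x))"
  define T where "T = (LINT x|hyp_volume. (u x)\<^sup>2) + sharp_constant p *
      (LINT x|hyp_volume. sinh (hyp_dist b x) powr ((p - 6) / 2) * \<bar>u x\<bar> powr p) powr (2 / p)"
  have E0: "0 \<le> E" unfolding E_def
    by (intro integral_nonneg_AE AE_I2) (auto simp: hyp_metric_def)
  have T0: "0 \<le> T" unfolding T_def
    by (intro add_nonneg_nonneg mult_nonneg_nonneg sharp_constant_nonneg p) auto
  have "T \<le> E + e" if e: "0 < e" for e
  proof -
    have "((\<lambda>\<eta>::real. ((exp (0 + \<eta>) - exp 0) / \<eta>)) \<longlongrightarrow> exp 0) (at 0)"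
      by (rule DERIV_D) (auto intro!: derivative_eq_intros)
    then have "((\<lambda>\<eta>::real. ((exp \<eta> - 1) / \<eta>)) \<longlongrightarrow> 1) (at_right 0)"
      by (auto intro: tendsto_within_subset)
    then have lim: "((\<lambda>\<eta>::real. ((exp \<eta> - 1) / \<eta>)\<^sup>2 * (E + e)) \<longlongrightarrow> 1\<^sup>2 * (E + e)) (at_right 0)"
      by (intro tendsto_intros)
    have "\<forall>\<^sub>F \<eta>::real in at_right 0. 0 < \<eta>" by (simp add: eventually_at_right_less)
    with ball_sup_energy_upper[OF u e] have "\<forall>\<^sub>F \<eta> in at_right 0. T \<le> ((exp \<eta> - 1) / \<eta>)\<^sup>2 * (E + e)"
    proof eventually_elim
      case (elim \<eta>)
      have "ennreal (\<eta>\<^sup>2 * T) \<le> ennreal ((exp \<eta> - 1)\<^sup>2 * (E + e))"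
        using ball_sup_energy_lower[OF b p u elim(2)] elim(1) unfolding T_def E_def by (rule order_trans)
      then have "\<eta>\<^sup>2 * T \<le> (exp \<eta> - 1)\<^sup>2 * (E + e)" using E0 e by (subst (asm) ennreal_le_iff) auto
      then show ?case using elim(2) by (simp add: power_divide pos_le_divide_eq mult.commute)
    qed
    then have "T \<le> 1\<^sup>2 * (E + e)" by (intro tendsto_lowerbound[OF lim]) auto
    then show ?thesis by simp
  qed
  then have "T \<le> E" by (rule field_le_epsilon)
  then show "(LINT x|hyp_volume. hyp_metric x (hyp_grad u x) (hyp_grad u x)) \<ge> (LINT x|hyp_volume. (u x)\<^sup>2) + sharp_constant p *
      (LINT x|hyp_volume. sinh (hyp_dist b x) powr ((p - 6) / 2) * \<bar>u x\<bar> powr p) powr (2 / p)"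
    by (simp add: T_def E_def)
qed

section \<open>Concentration at the base point\<close>

text \<open>A directional derivative of the composition is a directional derivative of
  \<open>f\<close> composed with the same affine map, so the induction runs over all
  \<open>f\<close>.\<close>

lemma continuously_differentiable_affine:
  fixes f :: "'a::real_normed_vector \<Rightarrow> 'b::real_normed_vector"
  assumes "continuously_differentiable k f"
  shows "continuously_differentiable k (\<lambda>x. f (s *\<^sub>R (x - b)))"
  using assms
proof (induction k arbitrary: f)
  case 0
  then show ?case
    by (auto intro!: continuous_on_compose2[of UNIV f] continuous_intros)
next
  case (Suc k)
  let ?A = "\<lambda>x. s *\<^sub>R (x - b)"
  have der: "((\<lambda>x. f (?A x)) has_derivative (\<lambda>w. frechet_derivative f (at (?A x)) (s *\<^sub>R w))) (at x)" for x
  proof -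
    have "(f has_derivative frechet_derivative f (at (?A x))) (at (?A x))"
      using Suc.prems by (simp add: frechet_derivative_works)
    moreover have "(?A has_derivative (\<lambda>w. s *\<^sub>R w)) (at x)"
      by (auto intro!: derivative_eq_intros)
    ultimately show ?thesis by (rule has_derivative_compose[rotated])
  qed
  have fd: "frechet_derivative (\<lambda>x. f (?A x)) (at x) = (\<lambda>w. frechet_derivative f (at (?A x)) (s *\<^sub>R w))" for x
    by (rule frechet_derivative_at[OF der, symmetric])
  have "continuously_differentiable k (\<lambda>x. frechet_derivative (\<lambda>x. f (?A x)) (at x) w)" for w
    unfolding fd by (rule Suc.IH) (use Suc.prems in simp)
  moreover have "(\<lambda>x. f (?A x)) differentiable (at x)" for x using der differentiableI by blast
  ultimately show ?case by simp
qed

lemma lborel_integral_affine: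
  fixes F :: "real^3 \<Rightarrow> real"
  assumes [measurable]: "F \<in> borel_measurable borel" and e: "0 < \<epsilon>"
  shows "(LINT x|lborel. F x) = \<epsilon> ^ 3 * (LINT y|lborel. F (b + \<epsilon> *\<^sub>R y))"
proof -
  have "(LINT x|lborel. F x) = (LINT x|density (distr lborel borel (\<lambda>x. b + \<epsilon> *\<^sub>R x)) (\<lambda>_. ennreal (\<bar>\<epsilon>\<bar> ^ DIM(real^3))). F x)"
    using lborel_affine[of \<epsilon> b] e by simp
  also have "\<dots> = (LINT x|distr lborel borel (\<lambda>x. b + \<epsilon> *\<^sub>R x). \<epsilon> ^ 3 * F x)"
    using e by (subst integral_density) auto
  also have "\<dots> = (LINT y|lborel. \<epsilon> ^ 3 * F (b + \<epsilon> *\<^sub>R y))"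
    by (subst integral_distr) auto
  finally show ?thesis by simp
qed

lemma hyp_volume_integral_affine:
  fixes F :: "real^3 \<Rightarrow> real"
  assumes [measurable]: "F \<in> borel_measurable borel" and e: "0 < \<epsilon>"
  shows "(LINT x|hyp_volume. F x) = \<epsilon> ^ 3 * (LINT y|lborel. indicator H3 (b + \<epsilon> *\<^sub>R y) / (b $ 3 + \<epsilon> * y $ 3) ^ 3 * F (b + \<epsilon> *\<^sub>R y))"
proof -
  have "(LINT x|hyp_volume. F x) = (LINT x|lborel. indicator H3 x / (x $ 3) ^ 3 * F x)"
    unfolding hyp_volume_def by (subst integral_density) (auto simp: indicator_def H3_def)
  also have "\<dots> = \<epsilon> ^ 3 * (LINT y|lborel. indicator H3 (b + \<epsilon> *\<^sub>R y) / ((b + \<epsilon> *\<^sub>R y) $ 3) ^ 3 * F (b + \<epsilon> *\<^sub>R y))"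
    by (rule lborel_integral_affine[OF _ e]) measurable
  finally show ?thesis by simp
qed

lemma sinh_hyp_dist:
  assumes b: "b \<in> H3" and x: "x \<in> H3"
  shows "sinh (hyp_dist b x) = dist b x * sqrt ((hyp_delta b x / 2 + 2) / (2 * (b $ 3 * x $ 3)))"
proof -
  define A where "A = hyp_delta b x / 2"
  have A: "A \<ge> 0" using hyp_delta_nonneg[OF b x] by (simp add: A_def)
  have "sinh (hyp_dist b x) = sqrt ((1 + A)\<^sup>2 - 1)"
    using A by (simp add: hyp_dist_delta A_def[symmetric] sinh_arcosh_real)
  also have "(1 + A)\<^sup>2 - 1 = A * (A + 2)" by (simp add: power2_eq_square algebra_simps)
  also have "\<dots> = (dist b x)\<^sup>2 * ((A + 2) / (2 * (b $ 3 * x $ 3)))"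
  proof -
    have "A = (dist b x)\<^sup>2 * (1 / (2 * (b $ 3 * x $ 3)))" by (simp add: A_def hyp_delta_def)
    then show ?thesis by (metis (no_types) mult.assoc mult.commute mult.right_neutral times_divide_eq_right)
  qed
  also have "sqrt \<dots> = dist b x * sqrt ((A + 2) / (2 * (b $ 3 * x $ 3)))"
    unfolding real_sqrt_mult[of "(dist b x)\<^sup>2"] by simp
  finally show ?thesis by (simp add: A_def)
qed

text \<open>In polar coordinates the integrand becomes a multiple of
  \<open>t powr ((p - 2) / 2)\<close>, whose exponent is positive.\<close>

lemma weight_locally_integrable:
  assumes p: "2 < p"
  shows "integrable lborel (\<lambda>y::real^3. norm y powr ((p - 6) / 2) * indicator (cball 0 r) y)"
proof -
  have "(\<integral>\<^sup>+y. ennreal (norm (y::real^3) powr ((p - 6) / 2) * indicator {..r} (norm y)) \<partial>lborel)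
      = (\<integral>\<^sup>+t. ennreal (4 * pi * t\<^sup>2) * indicator {0..} t * ennreal (t powr ((p - 6) / 2) * indicator {..r} t) \<partial>lborel)"
    by (rule nn_integral_norm) measurable
  also have "\<dots> \<le> (\<integral>\<^sup>+t. ennreal (4 * pi * r powr ((p - 2) / 2)) * indicator {0..r} t \<partial>lborel)"
  proof (intro nn_integral_mono)
    fix t :: real
    have "4 * pi * t\<^sup>2 * (t powr ((p - 6) / 2) * indicator {..r} t) \<le> 4 * pi * r powr ((p - 2) / 2)" if "0 \<le> t" "t \<le> r"
    proof (cases "t = 0")
      case False
      then have "t\<^sup>2 * t powr ((p - 6) / 2) = t powr (2 + (p - 6) / 2)" using that by (simp add: powr_add)
      also have "2 + (p - 6) / 2 = (p - 2) / 2" by (simp add: field_simps)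
      also have "t powr ((p - 2) / 2) \<le> r powr ((p - 2) / 2)" using that p by (intro powr_mono2) auto
      finally show ?thesis using that by (simp add: mult.assoc)
    qed simp
    then show "ennreal (4 * pi * t\<^sup>2) * indicator {0..} t * ennreal (t powr ((p - 6) / 2) * indicator {..r} t)
       \<le> ennreal (4 * pi * r powr ((p - 2) / 2)) * indicator {0..r} t"
      by (auto simp: indicator_def ennreal_mult'[symmetric] intro!: ennreal_leI)
  qed
  also have "\<dots> < \<infinity>"
    by (subst nn_integral_cmult_indicator) (auto simp: ennreal_mult_less_top emeasure_lborel_Icc_eq)
  finally have fin: "(\<integral>\<^sup>+y. ennreal (norm (y::real^3) powr ((p - 6) / 2) * indicator {..r} (norm y)) \<partial>lborel) < \<infinity>" .
  have eq: "indicator {..r} (norm y) = (indicator (cball 0 r) y :: real)" for y :: "real^3"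
    by (simp add: indicator_def)
  show ?thesis
    unfolding eq[symmetric] by (rule integrableI_nonneg) (use fin in auto)
qed

text \<open>The test function is shrunk by a factor \<open>\<epsilon>\<close> around
  \<open>b\<close>. The gradient integral and the power \<open>2 / p\<close> of the weighted
  integral both scale like \<open>\<epsilon>\<close>, and the L2 integral is dropped because it is
  nonnegative. In the limit the height \<open>B\<close> of \<open>b\<close> contributes the same
  factor \<open>1 / B\<close> to both sides.\<close>

lemma hyperbolic_imp_euclidean_inequality:
  assumes b: "b \<in> H3" and p: "2 < p" "p \<le> 6" and hyp: "hyperbolic_inequality b p C"
  shows "euclidean_inequality p C"
  unfolding euclidean_inequality_def
proof
  fix u :: "real^3 \<Rightarrow> real" assume u: "u \<in> test_functions UNIV"
  obtain S where S: "compact S" "S \<subseteq> UNIV" "\<And>x. x \<notin> S \<Longrightarrow> u x = 0" "\<And>x. x \<notin> S \<Longrightarrow> grad u x = 0"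
    by (rule test_function_support[OF u]) (rule that; assumption)
  obtain M where M: "0 < M" "\<And>x. \<bar>u x\<bar> \<le> M" "\<And>x. norm (grad u x) \<le> M"
    by (rule test_function_bounded[OF u]) (rule that; assumption)
  obtain r where r: "0 < r" "\<And>x. x \<in> S \<Longrightarrow> norm x \<le> r"
    using compact_imp_bounded[OF S(1)] unfolding bounded_pos by blast
  have [measurable]: "u \<in> borel_measurable borel" "grad u \<in> borel_measurable borel"
    by (rule borel_measurable_continuous_onI, rule test_function_grad[OF u])+
  define B where "B = b $ 3"
  have B: "B > 0" using b by (simp add: B_def H3_def)
  define a where "a = (p - 6) / 2"
  \<comment> \<open>So small that the shrunk support stays between the heights \<open>B / 2\<close>
    and \<open>2 * B\<close>.\<close>
  define e where "e = (\<lambda>n. B / (2 * r) / real (Suc n))"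
  have e: "0 < e n" "e n * r \<le> B / 2" for n
    using B r by (auto simp: e_def divide_simps mult_le_cancel_left1)
  have elim: "e \<longlonglongrightarrow> 0"
    unfolding e_def by (rule lim_const_over_n[THEN LIMSEQ_Suc])
  have hgt: "B / 2 \<le> B + e n * y $ 3" "B + e n * y $ 3 \<le> 2 * B" if "y \<in> S" for n y
  proof -
    have "\<bar>e n * y $ 3\<bar> \<le> e n * r"
      using e(1)[of n] component_le_norm_cart[of y 3] r(2)[OF that] by (simp add: abs_mult)
    then have "\<bar>e n * y $ 3\<bar> \<le> B / 2" using e(2)[of n] by linarith
    then show "B / 2 \<le> B + e n * y $ 3" "B + e n * y $ 3 \<le> 2 * B" by linarith+
  qed
  \<comment> \<open>Chosen so that at the point \<open>b + e n *\<^sub>R y\<close> the weight has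
    the base \<open>e n * norm y * sqrt (q n y)\<close>; as \<open>n\<close> grows,
    \<open>q n y\<close> tends to \<open>1 / B^2\<close>.\<close>
  define q where "q = (\<lambda>n (y :: real^3). ((e n)\<^sup>2 * (norm y)\<^sup>2 / (2 * (B * (B + e n * y $ 3))) + 2) / (2 * (B * (B + e n * y $ 3))))"
  have main: "C * (LINT y|lborel. 1 / (B + e n * y $ 3) ^ 3 * sqrt (q n y) powr a * (norm y powr a * \<bar>u y\<bar> powr p)) powr (2 / p)
      \<le> (LINT y|lborel. 1 / (B + e n * y $ 3) * (norm (grad u y))\<^sup>2)" for n
  proof -
    define \<epsilon> where "\<epsilon> = e n"
    have \<epsilon>: "\<epsilon> > 0" using e by (simp add: \<epsilon>_def)
    define v where "v = (\<lambda>x. u ((1 / \<epsilon>) *\<^sub>R (x - b)))"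
    have vb: "v (b + \<epsilon> *\<^sub>R y) = u y" for y using \<epsilon> by (simp add: v_def)
    have inH: "b + \<epsilon> *\<^sub>R y \<in> H3" if "y \<in> S" for y
      using hgt(1)[OF that, of n] B by (simp add: H3_def \<epsilon>_def B_def)
    have vt: "v \<in> test_functions H3"
    proof -
      define T where "T = (\<lambda>y. b + \<epsilon> *\<^sub>R y) ` S"
      have T: "compact T" unfolding T_def by (intro compact_continuous_image continuous_intros S(1))
      have "{x. v x \<noteq> 0} \<subseteq> T"
      proof
        fix x assume "x \<in> {x. v x \<noteq> 0}"
        then have "(1 / \<epsilon>) *\<^sub>R (x - b) \<in> S" using S(3) by (auto simp: v_def)
        moreover have "x = b + \<epsilon> *\<^sub>R ((1 / \<epsilon>) *\<^sub>R (x - b))" using \<epsilon> by simp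
        ultimately show "x \<in> T" unfolding T_def by blast
      qed
      then have cl: "closure {x. v x \<noteq> 0} \<subseteq> T" using compact_imp_closed[OF T] by (rule closure_minimal)
      then have "compact (closure {x. v x \<noteq> 0})"
        using compact_Int_closed[OF T closed_closure, of "{x. v x \<noteq> 0}"] by (simp add: inf.absorb2)
      moreover have "T \<subseteq> H3" using inH by (auto simp: T_def)
      moreover have "smooth v"
        using u continuously_differentiable_affine[of _ u "1 / \<epsilon>" b] by (simp add: v_def smooth_def test_functions_def)
      ultimately show ?thesis using cl by (auto simp: test_functions_def)
    qed
    have gv: "grad v (b + \<epsilon> *\<^sub>R y) = (1 / \<epsilon>) *\<^sub>R grad u y" for y
    proof -
      have "((\<lambda>x. (1 / \<epsilon>) *\<^sub>R (x - b)) has_derivative (\<lambda>w. (1 / \<epsilon>) *\<^sub>R w)) (at (b + \<epsilon> *\<^sub>R y))"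
        by (auto intro!: derivative_eq_intros)
      moreover have "(u has_derivative (\<lambda>w. grad u y \<bullet> w)) (at ((1 / \<epsilon>) *\<^sub>R ((b + \<epsilon> *\<^sub>R y) - b)))"
        using test_function_grad(1)[OF u, of y] \<epsilon> by simp
      ultimately have "(v has_derivative (\<lambda>w. grad u y \<bullet> ((1 / \<epsilon>) *\<^sub>R w))) (at (b + \<epsilon> *\<^sub>R y))"
        unfolding v_def by (rule has_derivative_compose)
      from has_derivative_unique[OF test_function_grad(1)[OF vt] this]
      have "(\<lambda>w. grad v (b + \<epsilon> *\<^sub>R y) \<bullet> w) = (\<lambda>w. grad u y \<bullet> ((1 / \<epsilon>) *\<^sub>R w))" .
      then have "grad v (b + \<epsilon> *\<^sub>R y) \<bullet> w = ((1 / \<epsilon>) *\<^sub>R grad u y) \<bullet> w" for w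
        by (auto dest: fun_cong[where x = w])
      then show ?thesis using vector_eq_rdot[of "grad v (b + \<epsilon> *\<^sub>R y)" "(1 / \<epsilon>) *\<^sub>R grad u y"] by simp
    qed
    have [measurable]: "v \<in> borel_measurable borel" "grad v \<in> borel_measurable borel"
      by (rule borel_measurable_continuous_onI, rule test_function_grad[OF vt])+
    have 1: "(LINT x|hyp_volume. hyp_metric x (hyp_grad v x) (hyp_grad v x)) =
        \<epsilon> * (LINT y|lborel. 1 / (B + e n * y $ 3) * (norm (grad u y))\<^sup>2)"
    proof -
      have "(LINT x|hyp_volume. hyp_metric x (hyp_grad v x) (hyp_grad v x)) =
          \<epsilon> ^ 3 * (LINT y|lborel. indicator H3 (b + \<epsilon> *\<^sub>R y) / (b $ 3 + \<epsilon> * y $ 3) ^ 3 *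
            hyp_metric (b + \<epsilon> *\<^sub>R y) (hyp_grad v (b + \<epsilon> *\<^sub>R y)) (hyp_grad v (b + \<epsilon> *\<^sub>R y)))"
        by (rule hyp_volume_integral_affine[OF _ \<epsilon>]) (unfold hyp_metric_def hyp_grad_def, measurable)
      also have "(\<lambda>y. indicator H3 (b + \<epsilon> *\<^sub>R y) / (b $ 3 + \<epsilon> * y $ 3) ^ 3 *
            hyp_metric (b + \<epsilon> *\<^sub>R y) (hyp_grad v (b + \<epsilon> *\<^sub>R y)) (hyp_grad v (b + \<epsilon> *\<^sub>R y))) =
          (\<lambda>y. 1 / \<epsilon>\<^sup>2 * (1 / (B + e n * y $ 3) * (norm (grad u y))\<^sup>2))"
      proof
        fix y
        show "indicator H3 (b + \<epsilon> *\<^sub>R y) / (b $ 3 + \<epsilon> * y $ 3) ^ 3 *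
            hyp_metric (b + \<epsilon> *\<^sub>R y) (hyp_grad v (b + \<epsilon> *\<^sub>R y)) (hyp_grad v (b + \<epsilon> *\<^sub>R y)) =
          1 / \<epsilon>\<^sup>2 * (1 / (B + e n * y $ 3) * (norm (grad u y))\<^sup>2)"
        proof (cases "y \<in> S")
          case True
          define t where "t = B + \<epsilon> * y $ 3"
          have t: "t > 0" using hgt(1)[OF True, of n] B by (simp add: t_def \<epsilon>_def)
          have "hyp_metric (b + \<epsilon> *\<^sub>R y) (hyp_grad v (b + \<epsilon> *\<^sub>R y)) (hyp_grad v (b + \<epsilon> *\<^sub>R y)) = t\<^sup>2 * (norm (grad u y) / \<epsilon>)\<^sup>2"
            unfolding hyp_metric_hyp_grad_self[OF inH[OF True]] gv using \<epsilon> by (simp add: t_def B_def)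
          then show ?thesis
            using inH[OF True] t \<epsilon> unfolding \<epsilon>_def[symmetric] B_def[symmetric] t_def[symmetric]
            by (simp add: power_divide power2_eq_square power3_eq_cube)
        next
          case False
          then show ?thesis using S(4)[OF False] by (simp add: hyp_metric_def hyp_grad_def gv)
        qed
      qed
      also have "\<epsilon> ^ 3 * (LINT y|lborel. 1 / \<epsilon>\<^sup>2 * (1 / (B + e n * y $ 3) * (norm (grad u y))\<^sup>2)) =
          \<epsilon> ^ 3 * (1 / \<epsilon>\<^sup>2) * (LINT y|lborel. 1 / (B + e n * y $ 3) * (norm (grad u y))\<^sup>2)"
        by (simp only: integral_mult_right_zero mult.assoc)
      also have "\<epsilon> ^ 3 * (1 / \<epsilon>\<^sup>2) = \<epsilon>" using \<epsilon> by (simp add: power2_eq_square power3_eq_cube)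
      finally show ?thesis .
    qed
    have 2: "(LINT x|hyp_volume. sinh (hyp_dist b x) powr ((p - 6) / 2) * \<bar>v x\<bar> powr p) =
        \<epsilon> powr (p / 2) * (LINT y|lborel. 1 / (B + e n * y $ 3) ^ 3 * sqrt (q n y) powr a * (norm y powr a * \<bar>u y\<bar> powr p))"
    proof -
      have "(LINT x|hyp_volume. sinh (hyp_dist b x) powr ((p - 6) / 2) * \<bar>v x\<bar> powr p) =
          \<epsilon> ^ 3 * (LINT y|lborel. indicator H3 (b + \<epsilon> *\<^sub>R y) / (b $ 3 + \<epsilon> * y $ 3) ^ 3 *
            (sinh (hyp_dist b (b + \<epsilon> *\<^sub>R y)) powr ((p - 6) / 2) * \<bar>v (b + \<epsilon> *\<^sub>R y)\<bar> powr p))"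
        by (rule hyp_volume_integral_affine[OF _ \<epsilon>]) measurable
      also have "(\<lambda>y. indicator H3 (b + \<epsilon> *\<^sub>R y) / (b $ 3 + \<epsilon> * y $ 3) ^ 3 *
            (sinh (hyp_dist b (b + \<epsilon> *\<^sub>R y)) powr ((p - 6) / 2) * \<bar>v (b + \<epsilon> *\<^sub>R y)\<bar> powr p)) =
          (\<lambda>y. \<epsilon> powr a * (1 / (B + e n * y $ 3) ^ 3 * sqrt (q n y) powr a * (norm y powr a * \<bar>u y\<bar> powr p)))"
      proof
        fix y
        show "indicator H3 (b + \<epsilon> *\<^sub>R y) / (b $ 3 + \<epsilon> * y $ 3) ^ 3 *
            (sinh (hyp_dist b (b + \<epsilon> *\<^sub>R y)) powr ((p - 6) / 2) * \<bar>v (b + \<epsilon> *\<^sub>R y)\<bar> powr p) =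
          \<epsilon> powr a * (1 / (B + e n * y $ 3) ^ 3 * sqrt (q n y) powr a * (norm y powr a * \<bar>u y\<bar> powr p))"
        proof (cases "y \<in> S")
          case True
          define t where "t = B + \<epsilon> * y $ 3"
          have t: "t > 0" using hgt(1)[OF True, of n] B by (simp add: t_def \<epsilon>_def)
          have "dist b (b + \<epsilon> *\<^sub>R y) = \<epsilon> * norm y" using \<epsilon> by (simp add: dist_norm)
          then have "sinh (hyp_dist b (b + \<epsilon> *\<^sub>R y)) = \<epsilon> * norm y * sqrt (q n y)"
            unfolding sinh_hyp_dist[OF b inH[OF True]] q_def hyp_delta_def
            by (simp add: B_def[symmetric] \<epsilon>_def[symmetric] power_mult_distrib mult_ac)
          moreover have "0 \<le> q n y" unfolding q_def \<epsilon>_def[symmetric] t_def[symmetric] using t B by simp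
          ultimately have "sinh (hyp_dist b (b + \<epsilon> *\<^sub>R y)) powr a = \<epsilon> powr a * norm y powr a * sqrt (q n y) powr a"
            using \<epsilon> by (simp add: powr_mult)
          then show ?thesis
            using inH[OF True] unfolding a_def[symmetric] \<epsilon>_def[symmetric] B_def[symmetric] t_def[symmetric] vb by simp
        next
          case False
          then show ?thesis using S(3)[OF False] p by (simp add: vb)
        qed
      qed
      also have "\<epsilon> ^ 3 * (LINT y|lborel. \<epsilon> powr a * (1 / (B + e n * y $ 3) ^ 3 * sqrt (q n y) powr a * (norm y powr a * \<bar>u y\<bar> powr p))) =
          (\<epsilon> ^ 3 * \<epsilon> powr a) * (LINT y|lborel. 1 / (B + e n * y $ 3) ^ 3 * sqrt (q n y) powr a * (norm y powr a * \<bar>u y\<bar> powr p))"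
        by (simp only: integral_mult_right_zero mult.assoc)
      also have "\<epsilon> ^ 3 * \<epsilon> powr a = \<epsilon> powr (p / 2)"
      proof -
        have "\<epsilon> ^ 3 * \<epsilon> powr a = \<epsilon> powr (3 + a)" using \<epsilon> by (simp add: powr_add)
        also have "3 + a = p / 2" by (simp add: a_def field_simps)
        finally show ?thesis .
      qed
      finally show ?thesis .
    qed
    define I where "I = (LINT y|lborel. 1 / (B + e n * y $ 3) ^ 3 * sqrt (q n y) powr a * (norm y powr a * \<bar>u y\<bar> powr p))"
    have I0: "0 \<le> I"
    proof -
      have "0 \<le> 1 / (B + e n * y $ 3) ^ 3 * sqrt (q n y) powr a * (norm y powr a * \<bar>u y\<bar> powr p)" for y
      proof (cases "y \<in> S")
        case True
        then show ?thesis using hgt(1)[OF True, of n] B by simp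
      qed (use S(3) p in simp)
      then show ?thesis unfolding I_def by (rule Bochner_Integration.integral_nonneg)
    qed
    have "(\<epsilon> powr (p / 2) * I) powr (2 / p) = \<epsilon> * I powr (2 / p)"
      using \<epsilon> I0 p by (simp add: powr_mult powr_powr)
    then have "(LINT x|hyp_volume. (v x)\<^sup>2) + C * (\<epsilon> * I powr (2 / p)) \<le> \<epsilon> * (LINT y|lborel. 1 / (B + e n * y $ 3) * (norm (grad u y))\<^sup>2)"
      using bspec[OF hyp[unfolded hyperbolic_inequality_def] vt] unfolding 1 2 I_def[symmetric] by simp
    moreover have "0 \<le> (LINT x|hyp_volume. (v x)\<^sup>2)" by (rule Bochner_Integration.integral_nonneg) simp
    ultimately have "C * (\<epsilon> * I powr (2 / p)) \<le> \<epsilon> * (LINT y|lborel. 1 / (B + e n * y $ 3) * (norm (grad u y))\<^sup>2)"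
      by linarith
    then have "\<epsilon> * (C * I powr (2 / p)) \<le> \<epsilon> * (LINT y|lborel. 1 / (B + e n * y $ 3) * (norm (grad u y))\<^sup>2)"
      by (simp only: mult.left_commute)
    then show ?thesis using \<epsilon> unfolding I_def[symmetric] by simp
  qed
  have Slim: "(\<lambda>n. B + e n * y $ 3) \<longlonglongrightarrow> B" for y :: "real^3"
  proof -
    have "(\<lambda>n. B + e n * y $ 3) \<longlonglongrightarrow> B + 0 * y $ 3" by (intro tendsto_intros elim)
    then show ?thesis by simp
  qed
  have gint: "integrable lborel (\<lambda>y. (norm (grad u y))\<^sup>2)"
  proof -
    have "integrable lborel (\<lambda>y. indicator S y *\<^sub>R (norm (grad u y))\<^sup>2)"
      by (rule borel_integrable_compact[OF S(1)]) (intro continuous_intros continuous_on_subset[OF test_function_grad(2)[OF u]], simp)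
    moreover have "(\<lambda>y. indicator S y *\<^sub>R (norm (grad u y))\<^sup>2) = (\<lambda>y. (norm (grad u y))\<^sup>2)"
      using S(4) by (auto simp: fun_eq_iff indicator_def)
    ultimately show ?thesis by simp
  qed
  have lim1: "(\<lambda>n. LINT y|lborel. 1 / (B + e n * y $ 3) * (norm (grad u y))\<^sup>2) \<longlonglongrightarrow> (LINT y|lborel. 1 / B * (norm (grad u y))\<^sup>2)"
  proof (rule integral_dominated_convergence[where w = "\<lambda>y. 2 / B * (norm (grad u y))\<^sup>2"])
    show "AE y in lborel. (\<lambda>n. 1 / (B + e n * y $ 3) * (norm (grad u y))\<^sup>2) \<longlonglongrightarrow> 1 / B * (norm (grad u y))\<^sup>2"
      using B by (intro AE_I2 tendsto_intros Slim) auto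
    show "AE y in lborel. norm (1 / (B + e n * y $ 3) * (norm (grad u y))\<^sup>2) \<le> 2 / B * (norm (grad u y))\<^sup>2" for n
    proof (rule AE_I2)
      fix y
      show "norm (1 / (B + e n * y $ 3) * (norm (grad u y))\<^sup>2) \<le> 2 / B * (norm (grad u y))\<^sup>2"
      proof (cases "y \<in> S")
        case True
        have "1 / (B + e n * y $ 3) \<le> 1 / (B / 2)"
          by (rule frac_le) (use hgt(1)[OF True, of n] B in auto)
        moreover have "0 \<le> 1 / (B + e n * y $ 3)" using hgt(1)[OF True, of n] B by simp
        ultimately have "\<bar>1 / (B + e n * y $ 3)\<bar> \<le> 2 / B" by simp
        then have "\<bar>1 / (B + e n * y $ 3)\<bar> * \<bar>(norm (grad u y))\<^sup>2\<bar> \<le> 2 / B * (norm (grad u y))\<^sup>2"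
          using B by (intro mult_mono) auto
        then show ?thesis by (simp only: real_norm_def abs_mult)
      qed (use S(4) in simp)
    qed
    show "integrable lborel (\<lambda>y. 2 / B * (norm (grad u y))\<^sup>2)" using gint by (rule integrable_mult_right)
  qed measurable
  \<comment> \<open>Since \<open>a \<le> 0\<close>, an upper bound for
    \<open>sqrt (q n y) powr a\<close> comes from the lower bound
    \<open>q n y \<ge> 1 / (2 * B^2)\<close> on the support.\<close>
  define c where "c = 8 / B ^ 3 * sqrt (1 / (2 * B\<^sup>2)) powr a * M powr p"
  have lim2: "(\<lambda>n. LINT y|lborel. 1 / (B + e n * y $ 3) ^ 3 * sqrt (q n y) powr a * (norm y powr a * \<bar>u y\<bar> powr p)) \<longlonglongrightarrow>
     (LINT y|lborel. 1 / B ^ 3 * sqrt (1 / B\<^sup>2) powr a * (norm y powr a * \<bar>u y\<bar> powr p))"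
  proof (rule integral_dominated_convergence[where w = "\<lambda>y. c * (norm y powr a * indicator (cball 0 r) y)"])
    show "integrable lborel (\<lambda>y::real^3. c * (norm y powr a * indicator (cball 0 r) y))"
      unfolding a_def by (rule integrable_mult_right[OF weight_locally_integrable[OF p(1)]])
    have ql: "(\<lambda>n. q n y) \<longlonglongrightarrow> 1 / B\<^sup>2" for y :: "real^3"
    proof -
      have "(\<lambda>n. q n y) \<longlonglongrightarrow> (0\<^sup>2 * (norm y)\<^sup>2 / (2 * (B * B)) + 2) / (2 * (B * B))"
        unfolding q_def using B by (intro tendsto_intros elim Slim) auto
      then show ?thesis by (simp add: power2_eq_square)
    qed
    show "AE y in lborel. (\<lambda>n. 1 / (B + e n * y $ 3) ^ 3 * sqrt (q n y) powr a * (norm y powr a * \<bar>u y\<bar> powr p)) \<longlonglongrightarrow>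
        1 / B ^ 3 * sqrt (1 / B\<^sup>2) powr a * (norm y powr a * \<bar>u y\<bar> powr p)"
      using B by (intro AE_I2 tendsto_intros Slim ql) auto
    show "AE y in lborel. norm (1 / (B + e n * y $ 3) ^ 3 * sqrt (q n y) powr a * (norm y powr a * \<bar>u y\<bar> powr p)) \<le>
        c * (norm y powr a * indicator (cball 0 r) y)" for n
    proof (rule AE_I2)
      fix y
      show "norm (1 / (B + e n * y $ 3) ^ 3 * sqrt (q n y) powr a * (norm y powr a * \<bar>u y\<bar> powr p)) \<le>
        c * (norm y powr a * indicator (cball 0 r) y)"
      proof (cases "y \<in> S")
        case True
        define t where "t = B + e n * y $ 3"
        have t: "B / 2 \<le> t" "t \<le> 2 * B" "t > 0" using hgt[OF True, of n] B by (auto simp: t_def)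
        have "(B / 2) ^ 3 \<le> t ^ 3" using t B by (intro power_mono) auto
        then have "1 / t ^ 3 \<le> 1 / (B / 2) ^ 3" using B t by (intro frac_le) auto
        then have 1: "1 / t ^ 3 \<le> 8 / B ^ 3" by (simp add: power_divide)
        have "1 / (2 * B\<^sup>2) = 2 / (2 * (B * (2 * B)))" by (simp add: power2_eq_square)
        also have "\<dots> \<le> 2 / (2 * (B * t))" using t B by (intro divide_left_mono) auto
        also have "\<dots> \<le> q n y" unfolding q_def t_def[symmetric] using t B by (intro divide_right_mono) auto
        finally have "sqrt (1 / (2 * B\<^sup>2)) \<le> sqrt (q n y)" by (rule real_sqrt_le_mono)
        then have 2: "sqrt (q n y) powr a \<le> sqrt (1 / (2 * B\<^sup>2)) powr a"
          using p B by (intro powr_mono2') (auto simp: a_def)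
        have 3: "\<bar>u y\<bar> powr p \<le> M powr p" using p M by (intro powr_mono2) auto
        have "norm (1 / t ^ 3 * sqrt (q n y) powr a * (norm y powr a * \<bar>u y\<bar> powr p)) =
            1 / t ^ 3 * sqrt (q n y) powr a * \<bar>u y\<bar> powr p * norm y powr a"
          using t by simp
        also have "\<dots> \<le> 8 / B ^ 3 * sqrt (1 / (2 * B\<^sup>2)) powr a * M powr p * norm y powr a"
          using B t by (intro mult_right_mono mult_mono 1 2 3) auto
        also have "\<dots> = c * (norm y powr a * indicator (cball 0 r) y)"
          using r(2)[OF True] by (simp add: c_def)
        finally show ?thesis unfolding t_def .
      next
        case False
        have "0 \<le> c" using B by (simp add: c_def)
        then show ?thesis using S(3)[OF False] p by simp
      qed
    qed
  qed (unfold q_def, measurable)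
  define W where "W = (LINT y|lborel. norm y powr a * \<bar>u y\<bar> powr p)"
  have W0: "0 \<le> W" unfolding W_def by (rule Bochner_Integration.integral_nonneg) simp
  \<comment> \<open>As \<open>3 + a = p / 2\<close>, the power \<open>2 / p\<close> of this factor
    is \<open>1 / B\<close>, the factor of the gradient term.\<close>
  have fac: "1 / B ^ 3 * sqrt (1 / B\<^sup>2) powr a = B powr (- (p / 2))"
  proof -
    have "sqrt (1 / B\<^sup>2) = B powr (-1)" using B by (simp add: real_sqrt_divide powr_minus_divide)
    then have "1 / B ^ 3 * sqrt (1 / B\<^sup>2) powr a = B powr (- 3) * B powr (- a)"
      using B by (simp add: powr_divide powr_minus_divide)
    also have "\<dots> = B powr (- 3 + - a)" by (simp only: powr_add)
    also have "- 3 + - a = - (p / 2)" by (simp add: a_def field_simps)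
    finally show ?thesis .
  qed
  have "(LINT y|lborel. 1 / B ^ 3 * sqrt (1 / B\<^sup>2) powr a * (norm y powr a * \<bar>u y\<bar> powr p)) = B powr (- (p / 2)) * W"
    unfolding fac W_def by simp
  with lim2 have lim2': "(\<lambda>n. LINT y|lborel. 1 / (B + e n * y $ 3) ^ 3 * sqrt (q n y) powr a * (norm y powr a * \<bar>u y\<bar> powr p)) \<longlonglongrightarrow> B powr (- (p / 2)) * W"
    by simp
  have nn: "0 \<le> (LINT y|lborel. 1 / (B + e n * y $ 3) ^ 3 * sqrt (q n y) powr a * (norm y powr a * \<bar>u y\<bar> powr p))" for n
  proof (rule Bochner_Integration.integral_nonneg)
    fix y
    show "0 \<le> 1 / (B + e n * y $ 3) ^ 3 * sqrt (q n y) powr a * (norm y powr a * \<bar>u y\<bar> powr p)"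
    proof (cases "y \<in> S")
      case True
      then show ?thesis using hgt(1)[OF True, of n] B by simp
    qed (use S(3) p in simp)
  qed
  have "(\<lambda>n. C * (LINT y|lborel. 1 / (B + e n * y $ 3) ^ 3 * sqrt (q n y) powr a * (norm y powr a * \<bar>u y\<bar> powr p)) powr (2 / p))
      \<longlonglongrightarrow> C * (B powr (- (p / 2)) * W) powr (2 / p)"
    using p nn by (intro tendsto_mult tendsto_const tendsto_powr' lim2') (auto intro!: always_eventually)
  then have "C * (B powr (- (p / 2)) * W) powr (2 / p) \<le> (LINT y|lborel. 1 / B * (norm (grad u y))\<^sup>2)"
    using lim1 main by (intro LIMSEQ_le) auto
  also have "(B powr (- (p / 2)) * W) powr (2 / p) = 1 / B * W powr (2 / p)"
    using B W0 p by (simp add: powr_mult powr_powr powr_divide powr_minus_divide)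
  also have "(LINT y|lborel. 1 / B * (norm (grad u y))\<^sup>2) = 1 / B * (LINT y|lborel. (norm (grad u y))\<^sup>2)"
    by (rule integral_mult_right_zero)
  finally have "C * W powr (2 / p) \<le> (LINT y|lborel. (norm (grad u y))\<^sup>2)"
    using B by (simp add: divide_le_cancel)
  then show "(LINT x|lborel. (norm (grad u x))\<^sup>2) \<ge> C * (LINT x|lborel. norm x powr ((p - 6) / 2) * \<bar>u x\<bar> powr p) powr (2 / p)"
    by (simp add: W_def a_def)
qed

section \<open>Sharpness in Euclidean space\<close>

definition bump :: "nat \<Rightarrow> real \<Rightarrow> real"
  where "bump k s = (if 0 < s then exp (- 1 / s) / s ^ k else 0)"

lemma power_le_fact_exp:
  fixes y :: real
  assumes "0 \<le> y"
  shows "y ^ j \<le> fact j * exp y"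
proof -
  have "sum (\<lambda>n. y ^ n /\<^sub>R fact n) {j} \<le> (\<Sum>n. y ^ n /\<^sub>R fact n)"
    by (rule sum_le_suminf[OF summable_exp_generic]) (use assms in auto)
  then have "y ^ j / fact j \<le> exp y" by (simp add: exp_def divide_inverse mult.commute)
  then show ?thesis by (simp add: pos_divide_le_eq mult.commute)
qed

lemma bump_nonneg: "0 \<le> bump k s"
  by (simp add: bump_def)

text \<open>With \<open>y = 1 / s\<close> this is
  \<open>y ^ (k + j) * exp (- y) \<le> fact (k + j)\<close>. The choice \<open>j = 2\<close> yields
  the derivative 0 at the origin, the choice \<open>j = 0\<close> boundedness.\<close>

lemma bump_le:
  assumes "0 < s"
  shows "bump k s \<le> fact (k + j) * s ^ j"
proof -
  have "(1 / s) ^ (k + j) \<le> fact (k + j) * exp (1 / s)"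
    using assms by (intro power_le_fact_exp) auto
  then have "exp (- (1 / s)) * (1 / s) ^ (k + j) \<le> exp (- (1 / s)) * (fact (k + j) * exp (1 / s))"
    by (intro mult_left_mono) auto
  also have "\<dots> = fact (k + j)" by (simp add: exp_minus)
  finally have "exp (- (1 / s)) * (1 / s) ^ (k + j) * s ^ j \<le> fact (k + j) * s ^ j"
    using assms by (intro mult_right_mono) auto
  moreover have "exp (- (1 / s)) * (1 / s) ^ (k + j) * s ^ j = bump k s"
    using assms by (simp add: bump_def power_add power_divide)
  ultimately show ?thesis by simp
qed

lemma bump_has_derivative:
  "(bump k has_real_derivative bump (k + 2) s - real k * bump (k + 1) s) (at s)"
proof -
  consider "s > 0" | "s < 0" | "s = 0" by linarith
  then show ?thesis
  proof cases
    case 1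
    have "((\<lambda>s. exp (- 1 / s) / s ^ k) has_real_derivative exp (- 1 / s) / s ^ (k + 2) - real k * (exp (- 1 / s) / s ^ (k + 1))) (at s)"
    proof (cases k)
      case 0
      then show ?thesis using 1 by (auto intro!: derivative_eq_intros simp: power2_eq_square)
    next
      case (Suc j)
      have de: "((\<lambda>s. exp (- 1 / s)) has_real_derivative exp (- 1 / s) * (1 / s\<^sup>2)) (at s)"
        using 1 by (auto intro!: derivative_eq_intros simp: power2_eq_square)
      have dp: "((\<lambda>s. s ^ Suc j) has_real_derivative real (Suc j) * s ^ j) (at s)"
        using DERIV_pow[of "Suc j" s] by simp
      define P where "P = s ^ j"
      have P: "P > 0" using 1 by (simp add: P_def)
      have "(e * (1 / s\<^sup>2) * s ^ Suc j - e * (n * s ^ j)) / (s ^ Suc j * s ^ Suc j) = e / s ^ (Suc j + 2) - n * (e / s ^ (Suc j + 1))" for e n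
        using 1 P by (simp add: P_def[symmetric] field_simps power2_eq_square)
      then show ?thesis unfolding Suc using DERIV_divide[OF de dp] 1 by simp
    qed
    then have "((\<lambda>s. exp (- 1 / s) / s ^ k) has_real_derivative bump (k + 2) s - real k * bump (k + 1) s) (at s)"
      using 1 by (simp add: bump_def)
    then show ?thesis
      by (rule has_field_derivative_transform_within_open[of _ _ _ "{0<..}"]) (use 1 in \<open>auto simp: bump_def\<close>)
  next
    case 2
    have "((\<lambda>s. 0) has_real_derivative 0) (at s)" by simp
    then have "(bump k has_real_derivative 0) (at s)"
      by (rule has_field_derivative_transform_within_open[of _ _ _ "{..<0}"]) (use 2 in \<open>auto simp: bump_def\<close>)
    then show ?thesis using 2 by (simp add: bump_def)
  next
    case 3
    have "((\<lambda>h. (bump k (0 + h) - bump k 0) / h) \<longlongrightarrow> 0) (at 0)"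
    proof (rule Lim_null_comparison)
      show "\<forall>\<^sub>F h in at 0. norm ((bump k (0 + h) - bump k 0) / h) \<le> fact (k + 2) * \<bar>h\<bar>"
      proof (rule always_eventually, rule allI)
        fix h :: real
        show "norm ((bump k (0 + h) - bump k 0) / h) \<le> fact (k + 2) * \<bar>h\<bar>"
        proof (cases "h > 0")
          case True
          then have "bump k h / h \<le> fact (k + 2) * h ^ 2 / h"
            by (intro divide_right_mono bump_le) auto
          then show ?thesis using True bump_nonneg[of k h] by (simp add: bump_def[of k 0] power2_eq_square)
        next
          case False
          then have "norm ((bump k (0 + h) - bump k 0) / h) = 0" by (simp add: bump_def)
          then show ?thesis by (simp only: mult_nonneg_nonneg fact_ge_zero abs_ge_zero)
        qed
      qed
      show "((\<lambda>h. fact (k + 2) * \<bar>h\<bar>) \<longlongrightarrow> 0) (at (0::real))"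
        by (auto intro!: tendsto_eq_intros)
    qed
    then have "(bump k has_real_derivative 0) (at 0)" by (simp add: DERIV_def)
    then show ?thesis using 3 by (simp add: bump_def)
  qed
qed

text \<open>A class of functions closed under directional derivatives; this is why \<open>bump\<close> carries the extra
  parameter \<open>k\<close>.\<close>

inductive elementary :: "('a::real_inner \<Rightarrow> real) \<Rightarrow> bool"
  where
  const: "elementary (\<lambda>x. c)"
| inner: "elementary (\<lambda>x. x \<bullet> w)"
| add: "elementary f \<Longrightarrow> elementary g \<Longrightarrow> elementary (\<lambda>x. f x + g x)"
| mult: "elementary f \<Longrightarrow> elementary g \<Longrightarrow> elementary (\<lambda>x. f x * g x)"
| powr: "elementary f \<Longrightarrow> (\<And>x. 0 < f x) \<Longrightarrow> elementary (\<lambda>x. f x powr a)"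
| bump: "elementary f \<Longrightarrow> elementary (\<lambda>x. bump k (f x))"

text \<open>\<open>D w\<close> is the directional derivative as a function of the point. It is
  elementary for each fixed \<open>w\<close>, which is what the recursion in
  \<open>continuously_differentiable\<close> asks for.\<close>

lemma elementary_derivative:
  assumes "elementary f"
  shows "\<exists>D. (\<forall>w. elementary (D w)) \<and> (\<forall>x. (f has_derivative (\<lambda>w. D w x)) (at x))"
  using assms
proof induction
  case (const c)
  show ?case by (rule exI[of _ "\<lambda>w x. 0"]) (auto intro: elementary.const)
next
  case (inner v)
  show ?case by (rule exI[of _ "\<lambda>w x. w \<bullet> v"]) (auto intro!: elementary.const derivative_eq_intros)
next
  case (add f g)
  then obtain D E where "\<forall>w. elementary (D w)" "\<forall>x. (f has_derivative (\<lambda>w. D w x)) (at x)"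
    "\<forall>w. elementary (E w)" "\<forall>x. (g has_derivative (\<lambda>w. E w x)) (at x)" by blast
  then show ?case by (intro exI[of _ "\<lambda>w x. D w x + E w x"]) (auto intro: elementary.add has_derivative_add)
next
  case (mult f g)
  then obtain D E where "\<forall>w. elementary (D w)" "\<forall>x. (f has_derivative (\<lambda>w. D w x)) (at x)"
    "\<forall>w. elementary (E w)" "\<forall>x. (g has_derivative (\<lambda>w. E w x)) (at x)" by blast
  then show ?case using mult.hyps
    by (intro exI[of _ "\<lambda>w x. f x * E w x + D w x * g x"]) (auto intro!: elementary.add elementary.mult has_derivative_mult)
next
  case (powr f a)
  then obtain D where D: "\<forall>w. elementary (D w)" "\<forall>x. (f has_derivative (\<lambda>w. D w x)) (at x)" by blast
  have "((\<lambda>x. f x powr a) has_derivative (\<lambda>w. a * f x powr (a - 1) * D w x)) (at x)" for x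
  proof -
    have "((\<lambda>t. t powr a) has_derivative (\<lambda>h. a * f x powr (a - 1) * h)) (at (f x))"
      using has_real_derivative_powr[OF powr.hyps(2)[of x], of a] by (simp add: has_field_derivative_def)
    from has_derivative_compose[OF D(2)[rule_format] this] show ?thesis .
  qed
  then show ?case using D(1) powr.hyps
    by (intro exI[of _ "\<lambda>w x. a * f x powr (a - 1) * D w x"]) (auto intro!: elementary.mult elementary.const elementary.powr)
next
  case (bump f k)
  then obtain D where D: "\<forall>w. elementary (D w)" "\<forall>x. (f has_derivative (\<lambda>w. D w x)) (at x)" by blast
  have "((\<lambda>x. bump k (f x)) has_derivative (\<lambda>w. (bump (k + 2) (f x) + (- real k) * bump (k + 1) (f x)) * D w x)) (at x)" for x
  proof -
    have "(bump k has_derivative (\<lambda>h. (bump (k + 2) (f x) + (- real k) * bump (k + 1) (f x)) * h)) (at (f x))"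
      using bump_has_derivative[of k "f x"] by (simp add: has_field_derivative_def)
    from has_derivative_compose[OF D(2)[rule_format] this] show ?thesis .
  qed
  moreover have "elementary (\<lambda>x. (bump (k + 2) (f x) + (- real k) * bump (k + 1) (f x)) * D w x)" for w
    by (intro elementary.mult elementary.add elementary.const elementary.bump bump.hyps(1) D(1)[rule_format])
  ultimately show ?case
    by (intro exI[of _ "\<lambda>w x. (bump (k + 2) (f x) + (- real k) * bump (k + 1) (f x)) * D w x"] conjI allI)
qed

lemma elementary_smooth:
  assumes "elementary f"
  shows "smooth f"
  unfolding smooth_def
proof
  fix k show "continuously_differentiable k f"
    using assms
  proof (induction k arbitrary: f)
    case (0 f)
    then obtain D where "\<forall>x. (f has_derivative (\<lambda>w. D w x)) (at x)" using elementary_derivative by blast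
    then show ?case by (auto intro!: continuous_at_imp_continuous_on has_derivative_continuous)
  next
    case (Suc k f)
    then obtain D where D: "\<forall>w. elementary (D w)" "\<forall>x. (f has_derivative (\<lambda>w. D w x)) (at x)"
      using elementary_derivative by blast
    have fd: "frechet_derivative f (at x) = (\<lambda>w. D w x)" for x
      using frechet_derivative_at[of f "\<lambda>w. D w x" x] D(2) by simp
    have "f differentiable (at x)" for x using D(2) differentiableI by blast
    then show ?case using D(1) Suc.IH by (simp add: fd)
  qed
qed

lemma elementary_norm_square: "elementary (\<lambda>x :: real^3. x \<bullet> x)"
proof -
  have "(\<lambda>x :: real^3. x \<bullet> x) = (\<lambda>x. (x \<bullet> axis 1 1) * (x \<bullet> axis 1 1) + (x \<bullet> axis 2 1) * (x \<bullet> axis 2 1) + (x \<bullet> axis 3 1) * (x \<bullet> axis 3 1))"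
    by (simp add: fun_eq_iff inner_vec_def[of x x for x] sum_3 inner_axis)
  then show ?thesis by (simp only:) (intro elementary.add elementary.mult elementary.inner)
qed

section \<open>Radial integrals as Beta functions\<close>

lemma has_integral_Beta_halfline:
  fixes m k l :: real
  assumes m: "0 < m" and k: "0 < (k + 1) / m" and l: "0 < l - (k + 1) / m"
  shows "((\<lambda>r. r powr k * (1 + r powr m) powr (- l)) has_integral Beta ((k + 1) / m) (l - (k + 1) / m) / m) {0<..}"
proof -
  define f where "f = (\<lambda>r. r powr k * (1 + r powr m) powr (- l))"
  \<comment> \<open>The inverse of \<open>y = r powr m / (1 + r powr m)\<close>, under which
    \<open>1 + r powr m\<close> becomes \<open>1 / (1 - y)\<close>.\<close>
  define g where "g = (\<lambda>y::real. (y / (1 - y)) powr (1 / m))"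
  define g' where "g' = (\<lambda>y::real. (1 / m) * (y / (1 - y)) powr (1 / m - 1) / (1 - y)\<^sup>2)"
  define B where "B = Beta ((k + 1) / m) (l - (k + 1) / m) / m"
  have im: "g ` {0<..<1} = {0<..}"
  proof (intro equalityI subsetI)
    fix r :: real assume "r \<in> {0<..}"
    then have r: "r > 0" by simp
    define y where "y = r powr m / (1 + r powr m)"
    have rm: "r powr m > 0" using r by simp
    have "0 < t / (1 + t) \<and> t / (1 + t) < 1" if "t > 0" for t :: real using that by simp
    from this[OF rm] have "y \<in> {0<..<1}" by (simp add: y_def)
    moreover have "y / (1 - y) = r powr m"
    proof -
      have "t / (1 + t) / (1 - t / (1 + t)) = t" if "t > 0" for t :: real
      proof -
        have "1 - t / (1 + t) = 1 / (1 + t)" using that by (simp add: field_simps)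
        then show ?thesis using that by simp
      qed
      from this[OF rm] show ?thesis unfolding y_def .
    qed
    then have "g y = r" using r m by (simp add: g_def powr_powr)
    ultimately show "r \<in> g ` {0<..<1}" by blast
  qed (auto simp: g_def)
  have inj: "inj_on g {0<..<1}"
  proof (rule inj_onI)
    fix x y :: real assume xy: "x \<in> {0<..<1}" "y \<in> {0<..<1}" "g x = g y"
    have gm: "g z powr m = z / (1 - z)" if "z \<in> {0<..<1}" for z using that m by (simp add: g_def powr_powr)
    have "x / (1 - x) = y / (1 - y)" using gm[OF xy(1)] gm[OF xy(2)] xy(3) by simp
    then have "x * (1 - y) = y * (1 - x)" using xy by (simp add: frac_eq_eq)
    then show "x = y" by (simp add: algebra_simps)
  qed
  have der: "(g has_field_derivative g' y) (at y within {0<..<1})" if "y \<in> {0<..<1}" for y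
  proof -
    have q: "((\<lambda>y. y / (1 - y)) has_real_derivative 1 / (1 - y)\<^sup>2) (at y)"
      using that by (auto intro!: derivative_eq_intros simp: power2_eq_square)
    have pos: "0 < y / (1 - y)" using that by simp
    have "((\<lambda>y. (y / (1 - y)) powr (1 / m)) has_real_derivative (1 / m) * (y / (1 - y)) powr (1 / m - 1) * (1 / (1 - y)\<^sup>2)) (at y)"
      using DERIV_chain2[OF has_real_derivative_powr[OF pos, of "1 / m"] q] .
    then show ?thesis unfolding g_def g'_def by (rule has_field_derivative_at_within[OF DERIV_cong]) simp
  qed
  have eq: "\<bar>g' y\<bar> * f (g y) = (1 / m) * (y powr ((k + 1) / m - 1) * (1 - y) powr (l - (k + 1) / m - 1))" if "y \<in> {0<..<1}" for y
  proof -
    have y: "0 < y" "0 < 1 - y" using that by auto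
    define z where "z = 1 - y"
    have z: "0 < z" using y by (simp add: z_def)
    have gm: "g y powr m = y / z" using y m by (simp add: g_def powr_powr z_def)
    have gk: "g y powr k = (y / z) powr (k / m)" using y by (simp add: g_def powr_powr z_def)
    have "1 + y / z = z powr (-1)" using z by (simp add: powr_minus_divide z_def field_simps)
    then have p1: "(1 + y / z) powr (- l) = z powr l" by (simp only: powr_powr) simp
    have "\<bar>g' y\<bar> * f (g y) = (1 / m) * (y / z) powr (1 / m - 1) * z powr (-2) * ((y / z) powr (k / m) * z powr l)"
      unfolding f_def gm gk p1 using m y z by (simp add: g'_def z_def[symmetric] abs_mult powr_minus_divide)
    also have "\<dots> = (1 / m) * ((y / z) powr ((k + 1) / m - 1) * z powr (l - 2))"
    proof -
      have "(y / z) powr ((k + 1) / m - 1) = (y / z) powr (1 / m - 1) * (y / z) powr (k / m)"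
        by (simp add: powr_add[symmetric] add_divide_distrib algebra_simps)
      moreover have "z powr (l - 2) = z powr (-2) * z powr l" by (simp add: powr_add[symmetric])
      ultimately show ?thesis by simp
    qed
    also have "(y / z) powr ((k + 1) / m - 1) * z powr (l - 2) = y powr ((k + 1) / m - 1) * z powr (l - (k + 1) / m - 1)"
    proof -
      have "z powr (l - (k + 1) / m - 1) = z powr (l - 2) / z powr ((k + 1) / m - 1)"
        by (simp add: powr_diff[symmetric])
      then show ?thesis using y z by (simp add: powr_divide)
    qed
    finally show ?thesis by (simp add: z_def)
  qed
  have hi: "((\<lambda>y. (1 / m) * (y powr ((k + 1) / m - 1) * (1 - y) powr (l - (k + 1) / m - 1))) has_integral B) {0<..<1}"
  proof -
    have "((\<lambda>y. (1 / m) * (y powr ((k + 1) / m - 1) * (1 - y) powr (l - (k + 1) / m - 1))) has_integral (1 / m) * Beta ((k + 1) / m) (l - (k + 1) / m)) {0..1}"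
      by (intro has_integral_mult_right has_integral_Beta_real k l)
    then show ?thesis unfolding B_def by (simp add: has_integral_Icc_iff_Ioo)
  qed
  then have hi': "((\<lambda>y. \<bar>g' y\<bar> * f (g y)) has_integral B) {0<..<1}"
    by (rule has_integral_eq[rotated]) (use eq in auto)
  have "(\<lambda>y. \<bar>g' y\<bar> * f (g y)) absolutely_integrable_on {0<..<1}"
    by (rule nonnegative_absolutely_integrable_1) (use hi' in \<open>auto simp: f_def\<close>)
  moreover have "integral {0<..<1} (\<lambda>y. \<bar>g' y\<bar> * f (g y)) = B" using hi' by (rule integral_unique)
  moreover have "{0<..<1::real} \<in> sets lebesgue" by simp
  ultimately have "f absolutely_integrable_on (g ` {0<..<1}) \<and> integral (g ` {0<..<1}) f = B"
    using has_absolute_integral_change_of_variables_1'[OF _ der inj, of f B] by blast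
  then have f: "f absolutely_integrable_on {0<..}" "integral {0<..} f = B" unfolding im by blast+
  from integrable_integral[OF set_lebesgue_integral_eq_integral(1)[OF f(1)]]
  show ?thesis unfolding f(2) unfolding f_def B_def .
qed

lemma bump_0_le: "t \<le> 1 \<Longrightarrow> bump 0 t \<le> exp (- 1)"
  by (simp add: bump_def pos_le_divide_eq)

text \<open>The common majorant for the energies and the weighted integrals of the truncated
  extremals: of order -2 at the origin and of order -4 at infinity, both integrable in dimension
  3.\<close>

lemma integrable_radial_tail:
  "integrable lborel (\<lambda>x::real^3. K / ((1 + (norm x)\<^sup>2) * (norm x)\<^sup>2))"
proof -
  have "(\<integral>\<^sup>+x. ennreal (1 / ((1 + (norm (x::real^3))\<^sup>2) * (norm x)\<^sup>2)) \<partial>lborel)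
      = (\<integral>\<^sup>+t. ennreal (4 * pi * t\<^sup>2) * indicator {0..} t * ennreal (1 / ((1 + t\<^sup>2) * t\<^sup>2)) \<partial>lborel)"
    by (rule nn_integral_norm) measurable
  also have "\<dots> \<le> (\<integral>\<^sup>+t. ennreal (4 * pi * (1 / (1 + t\<^sup>2))) * indicator {0..} t \<partial>lborel)"
  proof (intro nn_integral_mono)
    fix t :: real
    have "4 * pi * t\<^sup>2 * (1 / ((1 + t\<^sup>2) * t\<^sup>2)) \<le> 4 * pi * (1 / (1 + t\<^sup>2))"
      by (cases "t = 0") auto
    then show "ennreal (4 * pi * t\<^sup>2) * indicator {0..} t * ennreal (1 / ((1 + t\<^sup>2) * t\<^sup>2)) \<le> ennreal (4 * pi * (1 / (1 + t\<^sup>2))) * indicator {0..} t"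
      by (auto simp: indicator_def ennreal_mult'[symmetric] simp del: times_divide_eq_right intro!: ennreal_leI)
  qed
  also have "\<dots> = ennreal (4 * pi * (pi / 2) - 4 * pi * arctan 0)"
  proof (rule nn_integral_FTC_atLeast)
    show "((\<lambda>t. 4 * pi * arctan t) has_real_derivative 4 * pi * (1 / (1 + t\<^sup>2))) (at t)" for t
      by (auto intro!: derivative_eq_intros simp: divide_inverse)
    show "((\<lambda>t. 4 * pi * arctan t) \<longlongrightarrow> 4 * pi * (pi / 2)) at_top"
      by (intro tendsto_mult tendsto_const tendsto_arctan_at_top)
  qed auto
  also have "\<dots> < \<infinity>" by simp
  finally have "integrable lborel (\<lambda>x::real^3. 1 / ((1 + (norm x)\<^sup>2) * (norm x)\<^sup>2))"
    by (intro integrableI_nonneg) auto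
  from integrable_mult_right[OF this, of K] show ?thesis by simp
qed

lemma radial_Beta_integral:
  fixes m k l :: real and g :: "real \<Rightarrow> real"
  assumes m: "0 < m" and k: "0 < (k + 1) / m" and l: "0 < l - (k + 1) / m"
    and g: "\<And>t. 0 < t \<Longrightarrow> t\<^sup>2 * g t = t powr k * (1 + t powr m) powr (- l)"
    and [measurable]: "g \<in> borel_measurable borel"
    and pos: "\<And>t. 0 \<le> t \<Longrightarrow> 0 \<le> g t"
  shows "(LINT x|lborel. g (norm (x :: real^3))) = 4 * pi * (Beta ((k + 1) / m) (l - (k + 1) / m) / m)"
proof -
  have B0: "0 \<le> Beta ((k + 1) / m) (l - (k + 1) / m) / m"
    using m k l by (auto simp: Beta_def intro!: divide_nonneg_nonneg mult_nonneg_nonneg Gamma_real_nonneg less_imp_le)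
  have "(\<integral>\<^sup>+x. ennreal (g (norm (x :: real^3))) \<partial>lborel)
      = (\<integral>\<^sup>+t. ennreal (4 * pi * t\<^sup>2) * indicator {0..} t * ennreal (g t) \<partial>lborel)"
    by (rule nn_integral_norm) measurable
  also have "\<dots> = (\<integral>\<^sup>+t. ennreal (4 * pi * (t powr k * (1 + t powr m) powr (- l))) * indicator {0<..} t \<partial>lborel)"
  proof (rule nn_integral_cong_AE)
    show "AE t in lborel. ennreal (4 * pi * t\<^sup>2) * indicator {0..} t * ennreal (g t) =
        ennreal (4 * pi * (t powr k * (1 + t powr m) powr (- l))) * indicator {0<..} t"
      using AE_lborel_singleton[of 0]
    proof eventually_elim
      case (elim t)
      show ?case
      proof (cases "0 < t")
        case True
        then have eq: "4 * pi * t\<^sup>2 * g t = 4 * pi * (t powr k * (1 + t powr m) powr (- l))"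
          using g[OF True] by (simp only: mult.assoc)
        have "ennreal (4 * pi * t\<^sup>2) * ennreal (g t) = ennreal (4 * pi * t\<^sup>2 * g t)"
          by (rule ennreal_mult'[symmetric]) simp
        then show ?thesis unfolding eq using True by (simp add: indicator_def)
      qed (use elim in \<open>simp add: indicator_def\<close>)
    qed
  qed
  also have "\<dots> = ennreal (4 * pi * (Beta ((k + 1) / m) (l - (k + 1) / m) / m))"
    by (rule nn_integral_has_integral_lebesgue'[OF _ has_integral_mult_right[OF has_integral_Beta_halfline[OF m k l]]]) auto
  finally have "(\<integral>\<^sup>+x. ennreal (g (norm (x :: real^3))) \<partial>lborel) = ennreal (4 * pi * (Beta ((k + 1) / m) (l - (k + 1) / m) / m))" .
  moreover have "(LINT x|lborel. g (norm (x :: real^3))) = enn2real (\<integral>\<^sup>+x. ennreal (g (norm (x :: real^3))) \<partial>lborel)"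
    by (rule integral_eq_nn_integral) (auto intro!: AE_I2 pos)
  moreover have "0 \<le> 4 * pi * (Beta ((k + 1) / m) (l - (k + 1) / m) / m)"
    using B0 by (intro mult_nonneg_nonneg) auto
  ultimately show ?thesis by (simp only: enn2real_ennreal)
qed

text \<open>By dominated convergence both integrals of the truncated extremals tend to Beta
  integrals. The energy turns out to be \<open>m + 1 = p / 2\<close> times the weighted integral
  \<open>W\<close>, so \<open>C * W powr (2 / p) \<le> (m + 1) * W\<close>, and the sharp constant
  gives equality there.\<close>

lemma euclidean_constant_le:
  assumes p: "2 < p" "p \<le> 6" and C: "euclidean_inequality p C"
  shows "C \<le> sharp_constant p"
proof -
  define m where "m = (p - 2) / 2"
  \<comment> \<open>In the variable \<open>s = (norm x)^2\<close> the power
    \<open>norm x powr m\<close> of the extremal is \<open>s powr \<beta>\<close>.\<close>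
  define \<beta> where "\<beta> = m / 2"
  have m: "0 < m" "p = 2 * m + 2" using p by (auto simp: m_def field_simps)
  have \<beta>: "0 < \<beta>" "\<beta> \<le> 1" "m = 2 * \<beta>" using p by (auto simp: m_def \<beta>_def)
  define z where "z = 1 / m"
  have z: "z > 0" "z * m = 1" using m by (auto simp: z_def)
  define \<delta> where "\<delta> = (\<lambda>n. 1 / real (Suc n))"
  \<comment> \<open>\<open>1 + \<kappa> n * s\<close> is positive exactly for
    \<open>s < (real (Suc n))^2\<close>, so the cut-off lives in the ball of radius
    \<open>real (Suc n)\<close>.\<close>
  define \<kappa> where "\<kappa> = (\<lambda>n. - 1 / (real (Suc n))\<^sup>2)"
  have \<delta>: "0 < \<delta> n" for n by (simp add: \<delta>_def)
  have \<kappa>: "\<kappa> n < 0" for n by (simp add: \<kappa>_def divide_neg_pos)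
  have \<delta>lim: "\<delta> \<longlonglongrightarrow> 0" unfolding \<delta>_def by (rule lim_const_over_n[THEN LIMSEQ_Suc])
  have \<kappa>lim: "\<kappa> \<longlonglongrightarrow> 0"
  proof -
    have "(\<lambda>n. - (\<delta> n)\<^sup>2) \<longlonglongrightarrow> - (0\<^sup>2)" by (intro tendsto_intros \<delta>lim)
    then show ?thesis by (simp add: \<delta>_def \<kappa>_def power_divide)
  qed
  define A where "A = (\<lambda>n s. (1 + (\<delta> n + s) powr \<beta>) powr (- z))"
  define A' where "A' = (\<lambda>n s. - (1 / 2) * (1 + (\<delta> n + s) powr \<beta>) powr (- z - 1) * (\<delta> n + s) powr (\<beta> - 1))"
  \<comment> \<open>As functions of \<open>s = |x|\<^sup>2\<close>, \<open>A n\<close> is the extremal made smooth at the origin by the shift \<open>\<delta> n\<close>,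
    and \<open>X n\<close> is a cut-off function tending to \<open>1\<close>.\<close>
  define X where "X = (\<lambda>n s. exp 1 * bump 0 (1 + \<kappa> n * s))"
  define X' where "X' = (\<lambda>n s. exp 1 * bump 2 (1 + \<kappa> n * s) * \<kappa> n)"
  define u where "u = (\<lambda>n (x :: real^3). A n (x \<bullet> x) * X n (x \<bullet> x))"
  define F' where "F' = (\<lambda>n s. A' n s * X n s + A n s * X' n s)"
  define U where "U = (\<lambda>s. (1 + s powr \<beta>) powr (- z))"
  have base: "1 \<le> 1 + s powr \<beta>" for s :: real by simp
  have base': "0 < 1 + s powr \<beta>" for s :: real by (rule less_le_trans[OF zero_less_one base])
  have A_der: "(A n has_real_derivative A' n s) (at s)" if "0 \<le> s" for n s
  proof -
    have s: "0 < \<delta> n + s" using that \<delta>[of n] by simp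
    have t: "0 < 1 + (\<delta> n + s) powr \<beta>" using base[of "\<delta> n + s"] by linarith
    have 1: "((\<lambda>s. 1 + (\<delta> n + s) powr \<beta>) has_real_derivative \<beta> * (\<delta> n + s) powr (\<beta> - 1)) (at s)"
      using s by (auto intro!: derivative_eq_intros)
    have "(A n has_real_derivative (- z) * (1 + (\<delta> n + s) powr \<beta>) powr (- z - 1) * (\<beta> * (\<delta> n + s) powr (\<beta> - 1))) (at s)"
      unfolding A_def using DERIV_chain2[OF has_real_derivative_powr[OF t, of "- z"] 1] .
    moreover have "(- z) * P * (\<beta> * Q) = - (1 / 2) * P * Q" for P Q
    proof -
      have "z * \<beta> = 1 / 2" using \<beta>(3) z(2) by simp
      moreover have "(- z) * P * (\<beta> * Q) = - (z * \<beta>) * P * Q" by simp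
      ultimately show ?thesis by simp
    qed
    then have "(- z) * (1 + (\<delta> n + s) powr \<beta>) powr (- z - 1) * (\<beta> * (\<delta> n + s) powr (\<beta> - 1)) = A' n s"
      unfolding A'_def .
    ultimately show ?thesis by simp
  qed
  have X_der: "(X n has_real_derivative X' n s) (at s)" for n s
  proof -
    have 1: "((\<lambda>s. 1 + \<kappa> n * s) has_real_derivative \<kappa> n) (at s)" by (auto intro!: derivative_eq_intros)
    have 2: "(bump 0 has_real_derivative bump 2 (1 + \<kappa> n * s)) (at (1 + \<kappa> n * s))"
      using bump_has_derivative[of 0 "1 + \<kappa> n * s"] by (simp add: numeral_2_eq_2)
    have "((\<lambda>s. bump 0 (1 + \<kappa> n * s)) has_real_derivative bump 2 (1 + \<kappa> n * s) * \<kappa> n) (at s)"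
      by (rule DERIV_chain2[OF 2 1])
    from DERIV_cmult[OF this, of "exp 1"] show ?thesis unfolding X_def X'_def by (simp add: mult.assoc)
  qed
  have elem: "elementary (u n)" for n
    unfolding u_def A_def X_def
  proof (intro elementary.mult elementary.powr elementary.add elementary.const elementary.bump elementary_norm_square)
    show "0 < \<delta> n + x \<bullet> x" for x :: "real^3" using \<delta>[of n] inner_ge_zero[of x] by linarith
    show "0 < 1 + (\<delta> n + x \<bullet> x) powr \<beta>" for x :: "real^3" using base[of "\<delta> n + x \<bullet> x"] by linarith
  qed
  have Xz: "bump k (1 + \<kappa> n * s) = 0" if "(real (Suc n))\<^sup>2 \<le> s" for k n s
  proof -
    have "1 \<le> s / (real (Suc n))\<^sup>2" using that by (simp add: pos_le_divide_eq)
    then have "1 + \<kappa> n * s \<le> 0" by (simp add: \<kappa>_def)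
    then show ?thesis by (simp add: bump_def)
  qed
  have test: "u n \<in> test_functions UNIV" for n
  proof -
    have "{x. u n x \<noteq> 0} \<subseteq> cball 0 (real (Suc n))"
    proof
      fix x assume "x \<in> {x. u n x \<noteq> 0}"
      then have "\<not> (real (Suc n))\<^sup>2 \<le> x \<bullet> x" using Xz[of n "x \<bullet> x" 0] by (auto simp: u_def X_def)
      then have "(norm x)\<^sup>2 \<le> (real (Suc n))\<^sup>2" by (simp add: power2_norm_eq_inner)
      then have "norm x \<le> real (Suc n)" by (rule power2_le_imp_le) simp
      then show "x \<in> cball 0 (real (Suc n))" by simp
    qed
    then have "closure {x. u n x \<noteq> 0} \<subseteq> cball 0 (real (Suc n))" by (rule closure_minimal) simp
    then have "compact (closure {x. u n x \<noteq> 0})"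
      using compact_Int_closed[OF compact_cball closed_closure, of 0 "real (Suc n)" "{x. u n x \<noteq> 0}"] by (simp add: inf.absorb2)
    then show ?thesis using elementary_smooth[OF elem] by (simp add: test_functions_def)
  qed
  have gu: "(norm (grad (u n) x))\<^sup>2 = 4 * (F' n (x \<bullet> x))\<^sup>2 * (x \<bullet> x)" for n x
  proof -
    have 1: "((\<lambda>s. A n s * X n s) has_real_derivative F' n (x \<bullet> x)) (at (x \<bullet> x))"
      unfolding F'_def using DERIV_mult[OF A_der[of "x \<bullet> x" n] X_der[of n "x \<bullet> x"]] by (simp add: algebra_simps)
    have 2: "((\<lambda>x::real^3. x \<bullet> x) has_derivative (\<lambda>w. 2 * (x \<bullet> w))) (at x)"
      by (auto intro!: derivative_eq_intros simp: inner_commute)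
    have "(u n has_derivative (\<lambda>w. F' n (x \<bullet> x) * (2 * (x \<bullet> w)))) (at x)"
      unfolding u_def using has_derivative_compose[OF 2 1[unfolded has_field_derivative_def]] .
    from has_derivative_unique[OF test_function_grad(1)[OF test] this]
    have "(\<lambda>w. grad (u n) x \<bullet> w) = (\<lambda>w. F' n (x \<bullet> x) * (2 * (x \<bullet> w)))" .
    then have "grad (u n) x \<bullet> w = ((2 * F' n (x \<bullet> x)) *\<^sub>R x) \<bullet> w" for w
      by (auto dest: fun_cong[where x = w])
    then have "grad (u n) x = (2 * F' n (x \<bullet> x)) *\<^sub>R x"
      using vector_eq_rdot[of "grad (u n) x" "(2 * F' n (x \<bullet> x)) *\<^sub>R x"] by simp
    then show ?thesis by (simp add: power_mult_distrib power2_norm_eq_inner)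
  qed
  have U0: "0 \<le> U s" for s by (simp add: U_def)
  \<comment> \<open>As \<open>bump 0 1 = exp (- 1)\<close>, the factor \<open>exp 1\<close>
    normalises the cut-off to its maximum 1 at \<open>s = 0\<close>.\<close>
  have X01: "0 \<le> X n s" "X n s \<le> 1" if "0 \<le> s" for n s
  proof -
    show "0 \<le> X n s" by (simp add: X_def bump_nonneg)
    have "1 + \<kappa> n * s \<le> 1" using \<kappa>[of n] that by (simp add: mult_nonpos_nonneg)
    then have "exp 1 * bump 0 (1 + \<kappa> n * s) \<le> exp 1 * exp (- 1)" by (intro mult_left_mono bump_0_le) auto
    then show "X n s \<le> 1" by (simp add: X_def exp_minus)
  qed
  \<comment> \<open>The cut-off depends on \<open>s / (real (Suc n))^2\<close> only, so
    \<open>s\<close> times its derivative is bounded uniformly in \<open>n\<close>.\<close>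
  have X'b: "\<bar>X' n s\<bar> * s \<le> 2 * exp 1" if "0 < s" for n s
  proof (cases "(real (Suc n))\<^sup>2 \<le> s")
    case False
    have "\<bar>\<kappa> n\<bar> * s \<le> 1" using False by (simp add: \<kappa>_def abs_divide pos_divide_le_eq)
    moreover have "bump 2 (1 + \<kappa> n * s) \<le> 2"
      using bump_le[of "1 + \<kappa> n * s" 2 0] by (cases "0 < 1 + \<kappa> n * s") (auto simp: bump_def fact_numeral)
    ultimately have "bump 2 (1 + \<kappa> n * s) * (\<bar>\<kappa> n\<bar> * s) \<le> 2 * 1"
      using that by (intro mult_mono) (auto simp: bump_nonneg)
    then have "exp 1 * (bump 2 (1 + \<kappa> n * s) * (\<bar>\<kappa> n\<bar> * s)) \<le> exp 1 * (2 * 1)" by (intro mult_left_mono) auto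
    then show ?thesis by (simp add: X'_def abs_mult bump_nonneg mult_ac)
  qed (simp add: X'_def Xz)
  have AU: "0 \<le> A n s" "A n s \<le> U s" if "0 < s" for n s
  proof -
    show "0 \<le> A n s" by (simp add: A_def)
    have "s powr \<beta> \<le> (\<delta> n + s) powr \<beta>" using that \<delta>[of n] \<beta> by (intro powr_mono2) auto
    then show "A n s \<le> U s" unfolding A_def U_def using z base'[of s] by (intro powr_mono2') auto
  qed
  \<comment> \<open>Both powers in \<open>A'\<close> have nonpositive exponents, the second because
    \<open>\<beta> \<le> 1\<close>, that is \<open>p \<le> 6\<close>; so the shift only decreases
    them. Without the shift, \<open>s\<close> times the derivative is \<open>U s / 2\<close> times a
    factor at most 1, up to sign.\<close>
  have A'b: "\<bar>A' n s\<bar> * s \<le> 1 / 2 * U s" if s: "0 < s" for n s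
  proof -
    define d where "d = \<delta> n + s"
    have d: "s \<le> d" "0 < d" using \<delta>[of n] s by (auto simp: d_def)
    have "s powr \<beta> \<le> d powr \<beta>" using s d \<beta> by (intro powr_mono2) auto
    then have 1: "(1 + d powr \<beta>) powr (- z - 1) \<le> (1 + s powr \<beta>) powr (- z - 1)"
      using z base'[of s] by (intro powr_mono2') auto
    have 2: "d powr (\<beta> - 1) \<le> s powr (\<beta> - 1)" using s d \<beta> by (intro powr_mono2') auto
    have b: "0 < 1 + s powr \<beta>" using base[of s] by linarith
    have "\<bar>A' n s\<bar> * s = 1 / 2 * ((1 + d powr \<beta>) powr (- z - 1) * d powr (\<beta> - 1) * s)"
      by (simp add: A'_def d_def[symmetric] abs_mult)
    also have "\<dots> \<le> 1 / 2 * ((1 + s powr \<beta>) powr (- z - 1) * s powr (\<beta> - 1) * s)"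
      using s by (intro mult_left_mono mult_right_mono mult_mono 1 2) auto
    also have "(1 + s powr \<beta>) powr (- z - 1) * s powr (\<beta> - 1) * s = U s * (s powr \<beta> / (1 + s powr \<beta>))"
    proof -
      have "s powr (\<beta> - 1) * s = s powr \<beta>" using s by (simp add: powr_diff)
      moreover have "(1 + s powr \<beta>) powr (- z - 1) = U s / (1 + s powr \<beta>)"
        using b by (simp add: U_def powr_diff)
      ultimately show ?thesis by (simp only: mult.assoc times_divide_eq_left times_divide_eq_right)
    qed
    also have "U s * (s powr \<beta> / (1 + s powr \<beta>)) \<le> U s * 1"
      using b by (intro mult_left_mono U0) (auto simp: pos_divide_le_eq)
    finally show ?thesis by simp
  qed
  \<comment> \<open>Since \<open>1 / \<beta> = 2 * z\<close>, the quantity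
    \<open>(1 + s powr \<beta>) powr (2 * z)\<close> dominates both 1 and \<open>s\<close>, hence
    their mean.\<close>
  have U2: "(U s)\<^sup>2 \<le> 2 / (1 + s)" if s: "0 < s" for s
  proof -
    have b: "0 < 1 + s powr \<beta>" using base[of s] by linarith
    have zb: "1 / \<beta> = 2 * z" using \<beta>(3) by (simp add: z_def)
    have "s = (s powr \<beta>) powr (1 / \<beta>)" using s \<beta> by (simp add: powr_powr)
    also have "\<dots> \<le> (1 + s powr \<beta>) powr (1 / \<beta>)" using \<beta> by (intro powr_mono2) auto
    finally have 1: "s \<le> (1 + s powr \<beta>) powr (2 * z)" unfolding zb .
    have 2: "1 \<le> (1 + s powr \<beta>) powr (2 * z)" using z by (intro ge_one_powr_ge_zero) auto
    have "(U s)\<^sup>2 = (1 + s powr \<beta>) powr (- (2 * z))" using b by (simp add: U_def powr_powr[symmetric] powr_add[symmetric] power2_eq_square)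
    also have "\<dots> = 1 / (1 + s powr \<beta>) powr (2 * z)" by (simp add: powr_minus_divide)
    also have "\<dots> \<le> 1 / ((1 + s) / 2)" using 1 2 s by (intro frac_le) auto
    finally show ?thesis by simp
  qed
  \<comment> \<open>\<open>1 / 2\<close> comes from \<open>A'b\<close>, \<open>2 * exp 1\<close>
    from \<open>X'b\<close>, the last factor 2 from \<open>U2\<close>, and 4 is the square of the
    factor in the derivative \<open>2 * x\<close> of \<open>x \<bullet> x\<close>.\<close>
  define K where "K = 4 * (1 / 2 + 2 * exp 1)\<^sup>2 * (2 :: real)"
  have K: "2 \<le> K"
  proof -
    have "(1 / 2)\<^sup>2 \<le> (1 / 2 + 2 * exp 1 :: real)\<^sup>2" by (intro power_mono) auto
    then show ?thesis by (simp add: K_def power_divide)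
  qed
  have Eb: "4 * (F' n s)\<^sup>2 * s \<le> K / ((1 + s) * s)" if s: "0 < s" for n s
  proof -
    have "\<bar>F' n s\<bar> * s \<le> \<bar>A' n s\<bar> * X n s * s + A n s * \<bar>X' n s\<bar> * s"
      unfolding F'_def distrib_right[symmetric] using X01[of s n] AU[OF s, of n] s
      by (intro mult_right_mono order_trans[OF abs_triangle_ineq]) (auto simp: abs_mult)
    moreover have "\<bar>A' n s\<bar> * s * X n s \<le> \<bar>A' n s\<bar> * s * 1"
      using X01[of s n] s by (intro mult_left_mono) auto
    moreover have "A n s * (\<bar>X' n s\<bar> * s) \<le> U s * (2 * exp 1)"
      using AU[OF s, of n] s by (intro mult_mono X'b U0) auto
    moreover have "\<bar>A' n s\<bar> * s \<le> 1 / 2 * U s" by (rule A'b[OF s])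
    ultimately have "\<bar>F' n s\<bar> * s \<le> (1 / 2 + 2 * exp 1) * U s" by (simp add: algebra_simps)
    then have "(\<bar>F' n s\<bar> * s)\<^sup>2 \<le> ((1 / 2 + 2 * exp 1) * U s)\<^sup>2" using s by (intro power_mono) auto
    then have "(F' n s)\<^sup>2 * s\<^sup>2 \<le> (1 / 2 + 2 * exp 1)\<^sup>2 * (U s)\<^sup>2" by (simp add: power_mult_distrib)
    also have "\<dots> \<le> (1 / 2 + 2 * exp 1)\<^sup>2 * (2 / (1 + s))" using U2[OF s] by (intro mult_left_mono) auto
    finally have "4 * ((F' n s)\<^sup>2 * s\<^sup>2) \<le> K / (1 + s)" by (simp add: K_def)
    then have "4 * ((F' n s)\<^sup>2 * s\<^sup>2) / s \<le> K / (1 + s) / s" using s by (intro divide_right_mono) auto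
    then show ?thesis using s by (simp add: power2_eq_square)
  qed
  define a where "a = (p - 6) / 2"
  \<comment> \<open>The limits of the two integrands as functions of \<open>t = norm x\<close>;
    \<open>Einf\<close> is the squared gradient of the extremal away from the origin.\<close>
  define Einf where "Einf = (\<lambda>t. (1 + (t\<^sup>2) powr \<beta>) powr (- 2 * z - 2) * (t\<^sup>2) powr (2 * \<beta> - 1))"
  define Winf where "Winf = (\<lambda>t. t powr a * U (t\<^sup>2) powr p)"
  have xx: "x \<bullet> x = (norm x)\<^sup>2" for x :: "real^3" by (simp add: power2_norm_eq_inner)
  have sq: "(t\<^sup>2) powr \<beta> = t powr m" if "0 < t" for t :: real
  proof -
    have "(t powr 2) powr \<beta> = t powr m" unfolding powr_powr \<beta>(3) ..
    then show ?thesis using that by simp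
  qed
  have Alim: "(\<lambda>n. A n s) \<longlonglongrightarrow> U s" "(\<lambda>n. A' n s) \<longlonglongrightarrow> - (1 / 2) * (1 + s powr \<beta>) powr (- z - 1) * s powr (\<beta> - 1)"
    if s: "0 < s" for s
  proof -
    have dl: "(\<lambda>n. \<delta> n + s) \<longlonglongrightarrow> s" using tendsto_add[OF \<delta>lim tendsto_const[of s]] by simp
    have b: "1 + s powr \<beta> \<noteq> 0" using base[of s] by linarith
    show "(\<lambda>n. A n s) \<longlonglongrightarrow> U s"
      unfolding A_def U_def using s b by (intro tendsto_powr tendsto_add tendsto_const dl) auto
    show "(\<lambda>n. A' n s) \<longlonglongrightarrow> - (1 / 2) * (1 + s powr \<beta>) powr (- z - 1) * s powr (\<beta> - 1)"
      unfolding A'_def using s b by (intro tendsto_mult tendsto_powr tendsto_add tendsto_const dl) auto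
  qed
  have blim: "(\<lambda>n. bump k (1 + \<kappa> n * s)) \<longlonglongrightarrow> exp (- 1)" for k s
  proof -
    have "(\<lambda>n. 1 + \<kappa> n * s) \<longlonglongrightarrow> 1 + 0 * s" by (intro tendsto_intros \<kappa>lim)
    then have "(\<lambda>n. 1 + \<kappa> n * s) \<longlonglongrightarrow> 1" by simp
    from isCont_tendsto_compose[OF DERIV_isCont[OF bump_has_derivative] this, of k]
    show ?thesis by (simp add: bump_def[of k 1])
  qed
  have Xlim: "(\<lambda>n. X n s) \<longlonglongrightarrow> 1" "(\<lambda>n. X' n s) \<longlonglongrightarrow> 0" for s
  proof -
    have "(\<lambda>n. X n s) \<longlonglongrightarrow> exp 1 * exp (- 1)" unfolding X_def by (intro tendsto_mult tendsto_const blim)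
    then show "(\<lambda>n. X n s) \<longlonglongrightarrow> 1" by (simp add: exp_minus)
    have "(\<lambda>n. X' n s) \<longlonglongrightarrow> exp 1 * exp (- 1) * 0" unfolding X'_def by (intro tendsto_mult tendsto_const blim \<kappa>lim)
    then show "(\<lambda>n. X' n s) \<longlonglongrightarrow> 0" by simp
  qed
  have limE: "(\<lambda>n. LINT x|lborel. (norm (grad (u n) x))\<^sup>2) \<longlonglongrightarrow> (LINT x|lborel. Einf (norm (x :: real^3)))"
  proof (rule integral_dominated_convergence[where w = "\<lambda>x. K / ((1 + (norm x)\<^sup>2) * (norm x)\<^sup>2)"])
    show "AE x in lborel. (\<lambda>n. (norm (grad (u n) x))\<^sup>2) \<longlonglongrightarrow> Einf (norm (x :: real^3))"
      using AE_lborel_singleton[of 0]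
    proof eventually_elim
      case (elim x)
      define s where "s = (norm x)\<^sup>2"
      have s: "0 < s" using elim by (simp add: s_def)
      define c where "c = - (1 / 2) * (1 + s powr \<beta>) powr (- z - 1) * s powr (\<beta> - 1)"
      have "(\<lambda>n. F' n s) \<longlonglongrightarrow> c * 1 + U s * 0"
        unfolding F'_def c_def by (intro tendsto_intros Alim Xlim s)
      then have "(\<lambda>n. 4 * (F' n s)\<^sup>2 * s) \<longlonglongrightarrow> 4 * (c * 1 + U s * 0)\<^sup>2 * s" by (intro tendsto_intros)
      moreover have "4 * (c * 1 + U s * 0)\<^sup>2 * s = Einf (norm x)"
      proof -
        have b: "0 < 1 + s powr \<beta>" using base[of s] by linarith
        have "((1 + s powr \<beta>) powr (- z - 1))\<^sup>2 = (1 + s powr \<beta>) powr (- 2 * z - 2)"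
          by (simp add: power2_eq_square powr_add[symmetric])
        moreover have "(s powr (\<beta> - 1))\<^sup>2 * s = s powr (2 * \<beta> - 1)"
        proof -
          have "(s powr (\<beta> - 1))\<^sup>2 * s = s powr (\<beta> - 1) * s powr (\<beta> - 1) * s powr 1"
            using s by (simp add: power2_eq_square)
          also have "\<dots> = s powr (\<beta> - 1 + (\<beta> - 1) + 1)" by (simp only: powr_add)
          finally show ?thesis by (simp add: algebra_simps)
        qed
        ultimately show ?thesis by (simp add: c_def Einf_def s_def[symmetric] power_mult_distrib power_divide mult.assoc)
      qed
      ultimately show ?case unfolding gu xx s_def[symmetric] by simp
    qed
    show "AE x in lborel. norm ((norm (grad (u n) x))\<^sup>2) \<le> K / ((1 + (norm x)\<^sup>2) * (norm x)\<^sup>2)" for n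
      using AE_lborel_singleton[of 0]
    proof eventually_elim
      case (elim x)
      then show ?case using Eb[of "(norm x)\<^sup>2" n] unfolding gu xx by simp
    qed
    show "(\<lambda>x. (norm (grad (u n) x))\<^sup>2) \<in> borel_measurable lborel" for n
      using borel_measurable_continuous_onI[OF test_function_grad(2)[OF test[of n]]] by simp
    show "(\<lambda>x::real^3. Einf (norm x)) \<in> borel_measurable lborel" unfolding Einf_def by measurable
  qed (rule integrable_radial_tail)
  \<comment> \<open>From \<open>p = 2 * m + 2\<close> and \<open>z * m = 1\<close> the power
    \<open>U s powr p\<close> is \<open>(U s)^2 / (1 + s powr \<beta>)^2\<close>, and
    \<open>t powr a\<close> is \<open>s powr \<beta> / s\<close>; so \<open>U2\<close> again gives
    the majorant.\<close>
  have Wb: "t powr a * U (t\<^sup>2) powr p \<le> K / ((1 + t\<^sup>2) * t\<^sup>2)" if t: "0 < t" for t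
  proof -
    define s where "s = t\<^sup>2"
    have s: "0 < s" using t by (simp add: s_def)
    have b: "0 < 1 + s powr \<beta>" using base[of s] by linarith
    have "t powr a = t powr m / t\<^sup>2"
    proof -
      have "a = m - 2" by (simp add: a_def m_def field_simps)
      then show ?thesis using t by (simp add: powr_diff)
    qed
    then have ta: "t powr a = s powr \<beta> / s" using sq[OF t] by (simp add: s_def)
    have "U s powr p = U s powr (2 + 2 * m)" by (simp add: m(2) add.commute)
    also have "\<dots> = (U s)\<^sup>2 * U s powr (2 * m)" using b by (simp add: powr_add U_def)
    also have "U s powr (2 * m) = (1 + s powr \<beta>) powr (- 2)"
    proof -
      have "- z * (2 * m) = - 2" using z by simp
      then show ?thesis by (simp only: U_def powr_powr)
    qed
    finally have Up: "U s powr p = (U s)\<^sup>2 * (1 / (1 + s powr \<beta>)\<^sup>2)" using b by (simp add: powr_minus_divide)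
    have "s powr \<beta> * (1 / (1 + s powr \<beta>)\<^sup>2) \<le> 1"
    proof -
      have "s powr \<beta> \<le> (1 + s powr \<beta>)\<^sup>2" by (simp add: power2_eq_square algebra_simps)
      then show ?thesis using b by (simp add: pos_divide_le_eq)
    qed
    then have "(U s)\<^sup>2 / s * (s powr \<beta> * (1 / (1 + s powr \<beta>)\<^sup>2)) \<le> (U s)\<^sup>2 / s * 1"
      using s by (intro mult_left_mono) auto
    also have "\<dots> \<le> K / (1 + s) / s"
    proof -
      have "2 / (1 + s) \<le> K / (1 + s)" using K s by (intro divide_right_mono) auto
      then have "(U s)\<^sup>2 \<le> K / (1 + s)" using U2[OF s] by linarith
      from divide_right_mono[OF this, of s] show ?thesis using s by simp
    qed
    finally show ?thesis unfolding ta Up s_def[symmetric] by (simp add: mult.commute)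
  qed
  have limW: "(\<lambda>n. LINT x|lborel. norm x powr a * \<bar>u n x\<bar> powr p) \<longlonglongrightarrow> (LINT x|lborel. Winf (norm (x :: real^3)))"
  proof (rule integral_dominated_convergence[where w = "\<lambda>x. K / ((1 + (norm x)\<^sup>2) * (norm x)\<^sup>2)"])
    show "AE x in lborel. (\<lambda>n. norm x powr a * \<bar>u n x\<bar> powr p) \<longlonglongrightarrow> Winf (norm (x :: real^3))"
      using AE_lborel_singleton[of 0]
    proof eventually_elim
      case (elim x)
      define s where "s = (norm x)\<^sup>2"
      have s: "0 < s" using elim by (simp add: s_def)
      have "(\<lambda>n. norm x powr a * \<bar>A n s * X n s\<bar> powr p) \<longlonglongrightarrow> norm x powr a * \<bar>U s * 1\<bar> powr p"
        using p by (intro tendsto_mult tendsto_const tendsto_powr' tendsto_rabs Alim Xlim s) (auto intro!: always_eventually)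
      then show ?case using U0[of s] by (simp add: u_def Winf_def xx s_def[symmetric])
    qed
    show "AE x in lborel. norm (norm x powr a * \<bar>u n x\<bar> powr p) \<le> K / ((1 + (norm x)\<^sup>2) * (norm x)\<^sup>2)" for n
      using AE_lborel_singleton[of 0]
    proof eventually_elim
      case (elim x)
      define s where "s = (norm x)\<^sup>2"
      have s: "0 < s" using elim by (simp add: s_def)
      have "\<bar>u n x\<bar> = A n s * X n s" using AU(1)[OF s, of n] X01(1)[of s n] s by (simp add: u_def xx s_def)
      also have "\<dots> \<le> U s * 1" using AU[OF s, of n] X01[of s n] s U0 by (intro mult_mono) auto
      finally have "\<bar>u n x\<bar> powr p \<le> U s powr p" using p by (intro powr_mono2) auto
      then have "norm x powr a * \<bar>u n x\<bar> powr p \<le> norm x powr a * U s powr p" by (intro mult_left_mono) auto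
      also have "\<dots> \<le> K / ((1 + (norm x)\<^sup>2) * (norm x)\<^sup>2)" unfolding s_def using elim by (intro Wb) simp
      finally show ?case by simp
    qed
    have "u n \<in> borel_measurable borel" for n by (rule borel_measurable_continuous_onI[OF test_function_grad(3)[OF test]])
    then show "(\<lambda>x. norm x powr a * \<bar>u n x\<bar> powr p) \<in> borel_measurable lborel" for n by simp
    show "(\<lambda>x::real^3. Winf (norm x)) \<in> borel_measurable lborel" unfolding Winf_def U_def by measurable
  qed (rule integrable_radial_tail)
  define W where "W = 4 * pi * (Beta (1 + z) (1 + z) / m)"
  have l: "2 * z + 2 - (2 * m + 1) / m = z" "(2 * m + 1) / m = 2 + z" "2 * z + 2 - (m + 1) / m = 1 + z" "(m + 1) / m = 1 + z"
    "2 * z + 2 - (2 + z) = z" "2 * z + 2 - (1 + z) = 1 + z"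
    using m by (auto simp: z_def field_simps)
  have E_eq: "(LINT x|lborel. Einf (norm (x :: real^3))) = 4 * pi * (Beta (2 + z) z / m)"
  proof -
    have "(LINT x|lborel. Einf (norm (x :: real^3))) = 4 * pi * (Beta ((2 * m + 1) / m) (2 * z + 2 - (2 * m + 1) / m) / m)"
    proof (rule radial_Beta_integral[OF m(1)])
      show "0 < (2 * m + 1) / m" "0 < 2 * z + 2 - (2 * m + 1) / m" using l z by simp_all
      show "t\<^sup>2 * Einf t = t powr (2 * m) * (1 + t powr m) powr (- (2 * z + 2))" if t: "0 < t" for t
      proof -
        have "(t\<^sup>2) powr (2 * \<beta> - 1) = (t powr 2) powr (m - 1)" using t \<beta>(3) by simp
        also have "\<dots> = t powr (2 * m - 2)" unfolding powr_powr by (simp add: algebra_simps)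
        also have "\<dots> = t powr (2 * m) / t\<^sup>2" using t by (simp add: powr_diff)
        finally have 1: "t\<^sup>2 * (t\<^sup>2) powr (2 * \<beta> - 1) = t powr (2 * m)" using t by simp
        have 2: "- 2 * z - 2 = - (2 * z + 2)" by simp
        have "t\<^sup>2 * Einf t = t\<^sup>2 * (t\<^sup>2) powr (2 * \<beta> - 1) * (1 + t powr m) powr (- (2 * z + 2))"
          unfolding Einf_def sq[OF t] 2 by (simp only: mult_ac)
        then show ?thesis unfolding 1 .
      qed
      show "Einf \<in> borel_measurable borel" unfolding Einf_def by measurable
    qed (simp add: Einf_def)
    then show ?thesis unfolding l .
  qed
  have W_eq: "(LINT x|lborel. Winf (norm (x :: real^3))) = W"
  proof -
    have "(LINT x|lborel. Winf (norm (x :: real^3))) = 4 * pi * (Beta ((m + 1) / m) (2 * z + 2 - (m + 1) / m) / m)"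
    proof (rule radial_Beta_integral[OF m(1)])
      show "0 < (m + 1) / m" "0 < 2 * z + 2 - (m + 1) / m" using l z by simp_all
      show "t\<^sup>2 * Winf t = t powr m * (1 + t powr m) powr (- (2 * z + 2))" if t: "0 < t" for t
      proof -
        have "a = m - 2" by (simp add: a_def m_def field_simps)
        then have "t\<^sup>2 * t powr a = t powr m" using t by (simp add: powr_diff)
        moreover have "U (t\<^sup>2) powr p = (1 + t powr m) powr (- (2 * z + 2))"
        proof -
          have "- z * p = - (2 * z + 2)" using z by (simp add: m(2) algebra_simps)
          then show ?thesis unfolding U_def sq[OF t] powr_powr by simp
        qed
        ultimately show ?thesis by (simp add: Winf_def)
      qed
      show "Winf \<in> borel_measurable borel" unfolding Winf_def U_def by measurable
    qed (simp add: Winf_def)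
    then show ?thesis unfolding l W_def .
  qed
  have G: "Gamma (1 + z) > 0" "Gamma z > 0" "Gamma (2 + 2 * z) > 0"
    using z by (auto intro!: Gamma_real_pos)
  have W: "W = 4 * pi * ((Gamma (1 + z))\<^sup>2 / Gamma (2 + 2 * z) / m)"
    by (simp add: W_def Beta_def power2_eq_square algebra_simps)
  have W0: "0 < W" unfolding W using G m by simp
  \<comment> \<open>\<open>Gamma (2 + z) = (1 + z) * Gamma (1 + z)\<close> and
    \<open>Gamma z = m * Gamma (1 + z)\<close>, so the energy is \<open>(1 + z) * m = m + 1\<close>
    times the weighted integral.\<close>
  have E: "4 * pi * (Beta (2 + z) z / m) = (m + 1) * W"
  proof -
    have "1 + z \<notin> \<int>\<^sub>\<le>\<^sub>0" "z \<notin> \<int>\<^sub>\<le>\<^sub>0" using z nonpos_Ints_nonpos[of "1 + z"] nonpos_Ints_nonpos[of z] by auto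
    then have g: "Gamma (2 + z) = (1 + z) * Gamma (1 + z)" "Gamma (1 + z) = z * Gamma z"
      using Gamma_plus1[of "1 + z"] Gamma_plus1[of z] by (simp_all add: add.commute add.left_commute)
    have "Gamma z = m * Gamma (1 + z)" unfolding g(2) using z(2) by (simp add: mult.assoc[symmetric] mult.commute)
    then have "Gamma (2 + z) * Gamma z = (1 + z) * m * (Gamma (1 + z))\<^sup>2" unfolding g(1) by (simp add: power2_eq_square)
    also have "(1 + z) * m = m + 1" using z(2) by (simp add: algebra_simps)
    finally have "Beta (2 + z) z = (m + 1) * ((Gamma (1 + z))\<^sup>2 / Gamma (2 + 2 * z))"
      by (simp add: Beta_def algebra_simps)
    then show ?thesis unfolding W by simp
  qed
  have S: "sharp_constant p * W powr (2 / p) = (m + 1) * W"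
  proof -
    define e where "e = 2 / p"
    have e: "(p - 2) / p = 1 - e" using p by (simp add: e_def field_simps)
    have pz: "p / (p - 2) = 1 + z" "2 * p / (p - 2) = 2 + 2 * z"
    proof -
      have "p - 2 = 2 * m" using m(2) by simp
      then show "p / (p - 2) = 1 + z" "2 * p / (p - 2) = 2 + 2 * z" using m by (auto simp: z_def field_simps)
    qed
    \<comment> \<open>The bracket in \<open>sharp_constant\<close> is exactly half the weighted
      integral of the extremal.\<close>
    have W2: "4 * pi * (Gamma (1 + z))\<^sup>2 / ((p - 2) * Gamma (2 + 2 * z)) = W / 2"
      unfolding W by (simp add: m(2))
    have "sharp_constant p = p / 2 powr e * (W / 2) powr (1 - e)"
      unfolding sharp_constant_def pz e e_def[symmetric] W2 ..
    also have "(W / 2) powr (1 - e) = W / W powr e * (2 powr e / 2)"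
      using W0 by (simp add: powr_diff powr_divide)
    finally have "sharp_constant p * W powr e = p / 2 * W" using W0 by simp
    then show ?thesis by (simp add: e_def m(2) algebra_simps)
  qed
  have "(\<lambda>n. C * (LINT x|lborel. norm x powr a * \<bar>u n x\<bar> powr p) powr (2 / p)) \<longlonglongrightarrow> C * W powr (2 / p)"
    using limW W0 unfolding W_eq by (intro tendsto_mult tendsto_const tendsto_powr) auto
  moreover have "C * (LINT x|lborel. norm x powr a * \<bar>u n x\<bar> powr p) powr (2 / p) \<le> (LINT x|lborel. (norm (grad (u n) x))\<^sup>2)" for n
    using bspec[OF C[unfolded euclidean_inequality_def] test[of n]] unfolding a_def .
  ultimately have "C * W powr (2 / p) \<le> 4 * pi * (Beta (2 + z) z / m)"
    using limE unfolding E_eq by (intro LIMSEQ_le) auto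
  then have "C * W powr (2 / p) \<le> sharp_constant p * W powr (2 / p)" unfolding E S .
  then show ?thesis using W0 by simp
qed

theorem theorem14:
  fixes p :: real and b :: "real^3"
  assumes "2 < p" and "p \<le> 6" and "b \<in> H3"
  shows "S3_bar b p = S3 p \<and>
    S3 p = p / 2 powr (2 / p) *
      (4 * pi * (Gamma (p / (p - 2)))\<^sup>2 / ((p - 2) * Gamma (2 * p / (p - 2)))) powr ((p - 2) / p)"
proof -
  \<comment> \<open>Both greatest constants exist: the sharp constant satisfies each inequality, and
    every other valid constant is at most as large, in the hyperbolic case by passing to the
    Euclidean inequality.\<close>
  note hyp = hyperbolic_inequality_sharp_constant[OF assms(3,1,2)]
  have "S3 p = sharp_constant p"
    unfolding S3_def
    using hyperbolic_imp_euclidean_inequality[OF assms(3,1,2) hyp] euclidean_constant_le[OF assms(1,2)]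
    by (rule Greatest_equality)
  moreover have "S3_bar b p = sharp_constant p"
    unfolding S3_bar_def
    using hyp euclidean_constant_le[OF assms(1,2) hyperbolic_imp_euclidean_inequality[OF assms(3,1,2)]]
    by (rule Greatest_equality)
  ultimately show ?thesis by (simp add: sharp_constant_def)
qed

end
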